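(* Let $A$ be an Artin algebra, $\Lambda=T_2(A)=\begin{pmatrix}A&A\\0&A\end{pmatrix}$, and $\binom{X}{Y}_\varphi$ a left $\Lambda$-module. Let $\pi:X\to\mathrm{Coker}\,\varphi$ and $p:X^*\to\mathrm{Coker}\,\pi^*$ be the canonical epimorphisms, and let $\beta:\mathrm{Coker}\,\pi^*\to Y^*$ be the unique $A$-map with $\varphi^*=\beta p$. Then: (1) There is a left $\Lambda$-module isomorphism $\binom{X}{Y}_\varphi^{**}\cong\binom{X^{**}}{(\mathrm{Coker}\,\pi^* )^*}_{p^*}$, where $p^*:(\mathrm{Coker}\,\pi^* )^*\to X^{**}$ is the $A$-monomorphism induced by $p:X^*\to\mathrm{Coker}\,\pi^*$, such that, taking this isomorphism as an identification, the canonical $\Lambda$-map $\phi_{\binom{X}{Y}_\varphi}:\binom{X}{Y}_\varphi\to\binom{X^{**}}{(\mathrm{Coker}\,\pi^* )^*}_{p^*}$ is given by $\phi_{\binom{X}{Y}_\varphi}=\binom{\phi_X}{\beta^*\phi_Y}$. (2) $\binom{X}{Y}_\varphi$ is torsionless and double semi-Gorenstein-projective if and only if $\binom{X}{Y}_\varphi$ is monic, $X$, $Y$ and $\mathrm{Coker}\,\varphi$ are double semi-Gorenstein-projective, and $X$ and $Y$ are torsionless. (3) $\binom{X}{Y}_\varphi$ is double semi-Gorenstein-projective with $\phi_{\binom{X}{Y}_\varphi}$ an epimorphism if and only if $\varphi^*:X^*\to Y^*$ is an epimorphism, $X$ and $Y$ are double semi-Gorenstein-projective, $(\mathrm{Coker}\,\varphi)^*$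 is semi-Gorenstein-projective, and $\phi_X$ and $\phi_Y$ are epimorphisms.
   Context: All modules are finitely generated. For an Artin algebra $R$ and a left or right $R$-module $N$, $N^*=\mathrm{Hom}_R(N,R)$ is the $R$-dual (a module on the other side), and $\phi_N:N\to N^{**}$, $\phi_N(n)(f)=f(n)$, is the canonical map. $N$ is torsionless if $\phi_N$ is a monomorphism (equivalently $N$ is a submodule of a projective module). $N$ is semi-Gorenstein-projective if $\mathrm{Ext}_R^i(N,R)=0$ for all $i\ge1$; $N$ is double semi-Gorenstein-projective if both $N$ and $N^*$ are semi-Gorenstein-projective. A left $T_2(A)$-module is identified with a triple $\binom{X}{Y}_\varphi$, where $X,Y$ are left $A$-modules and $\varphi:Y\to X$ is a left $A$-map; the action is $\begin{pmatrix}a_1&a_2\\0&a_3\end{pmatrix}\binom{x}{y}=\binom{a_1x+a_2\varphi(y)}{a_3y}$. It is monic if $\varphi$ is a monomorphism. Since $0\to(\mathrm{Coker}\,\varphi)^*\xrightarrow{\pi^*}X^*\xrightarrow{\varphi^*}Y^*$ is exact, $\varphi^*$ factors uniquely through $p$, which defines $\beta$. For maps such as $\beta:\mathrm{Coker}\,\pi^*\to Y^*$ the dual is $\beta^*:Y^{**}\to(\mathrm{Coker}\,\pi^* )^*$. *)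

theory Defs
  imports "HOL-Algebra.Module" "HOL-Algebra.QuotRing" "HOL-Algebra.Free_Abelian_Groups"
begin

hide_const (open) Wellorder_Constructions.zero

section \<open>Modules over a not necessarily commutative ring\<close>

text \<open>
  The library locale \<^locale>\<open>module\<close> requires a commutative ring of scalars. Here the ring is
  arbitrary, and the record type of the library is reused; its fields \<^const>\<open>monoid.mult\<close> and
  \<^const>\<open>monoid.one\<close> play no role in a module and are left undefined.
\<close>

locale left_module = R?: ring R + M?: abelian_group M
  for R :: "('a, 'r) ring_scheme" (structure) and M :: "('a, 'b, 'm) module_scheme" (structure) +
  assumes smult_closed [simp, intro]:
      "\<lbrakk>a \<in> carrier R; x \<in> carrier M\<rbrakk> \<Longrightarrow> a \<odot>\<^bsub>M\<^esub> x \<in> carrier M"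
    and smult_l_distr:
      "\<lbrakk>a \<in> carrier R; b \<in> carrier R; x \<in> carrier M\<rbrakk> \<Longrightarrow>
       (a \<oplus> b) \<odot>\<^bsub>M\<^esub> x = a \<odot>\<^bsub>M\<^esub> x \<oplus>\<^bsub>M\<^esub> b \<odot>\<^bsub>M\<^esub> x"
    and smult_r_distr:
      "\<lbrakk>a \<in> carrier R; x \<in> carrier M; y \<in> carrier M\<rbrakk> \<Longrightarrow>
       a \<odot>\<^bsub>M\<^esub> (x \<oplus>\<^bsub>M\<^esub> y) = a \<odot>\<^bsub>M\<^esub> x \<oplus>\<^bsub>M\<^esub> a \<odot>\<^bsub>M\<^esub> y"
    and smult_assoc1:
      "\<lbrakk>a \<in> carrier R; b \<in> carrier R; x \<in> carrier M\<rbrakk> \<Longrightarrow>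
       (a \<otimes> b) \<odot>\<^bsub>M\<^esub> x = a \<odot>\<^bsub>M\<^esub> (b \<odot>\<^bsub>M\<^esub> x)"
    and smult_one [simp]: "x \<in> carrier M \<Longrightarrow> \<one> \<odot>\<^bsub>M\<^esub> x = x"

definition finitely_generated :: "('a, 'r) ring_scheme \<Rightarrow> ('a, 'b, 'm) module_scheme \<Rightarrow> bool"
  where "finitely_generated R M \<longleftrightarrow>
    (\<exists>S. finite S \<and> S \<subseteq> carrier M \<and> (\<forall>H. submodule H R M \<and> S \<subseteq> H \<longrightarrow> H = carrier M))"

text \<open>
  A right module over \<open>R\<close> is a left module over \<open>opp R\<close>: the term \<open>a \<odot>\<^bsub>N\<^esub> x\<close> then stands for
  the right action \<open>x a\<close>. Note \<open>opp (opp R) = R\<close>.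
\<close>

definition opp :: "('a, 'r) ring_scheme \<Rightarrow> ('a, 'r) ring_scheme"
  where "opp R = R\<lparr>monoid.mult := \<lambda>a b. b \<otimes>\<^bsub>R\<^esub> a\<rparr>"

definition regular :: "('a, 'r) ring_scheme \<Rightarrow> ('a, 'a) module"
  where "regular R = \<lparr>carrier = carrier R, monoid.mult = undefined, one = undefined,
    zero = \<zero>\<^bsub>R\<^esub>, add = add R, smult = monoid.mult R\<rparr>"

definition mod_hom ::
    "('a, 'r) ring_scheme \<Rightarrow> ('a, 'b, 'm) module_scheme \<Rightarrow> ('a, 'c, 'n) module_scheme \<Rightarrow> ('b \<Rightarrow> 'c) set"
  where "mod_hom R M N =
    {f \<in> hom (add_monoid M) (add_monoid N).
      \<forall>a \<in> carrier R. \<forall>x \<in> carrier M. f (a \<odot>\<^bsub>M\<^esub> x) = a \<odot>\<^bsub>N\<^esub> f x}"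

definition mod_iso ::
    "('a, 'r) ring_scheme \<Rightarrow> ('a, 'b, 'm) module_scheme \<Rightarrow> ('a, 'c, 'n) module_scheme \<Rightarrow> ('b \<Rightarrow> 'c) set"
  where "mod_iso R M N = {f \<in> mod_hom R M N. bij_betw f (carrier M) (carrier N)}"

text \<open>
  The members of \<^const>\<open>mod_hom\<close> are arbitrary outside the carrier; the elements of the group
  \<open>Hom\<^sub>R(M, N)\<close> are therefore taken extensional, so that distinct elements are distinct maps.
\<close>

definition Hom_group ::
    "('a, 'r) ring_scheme \<Rightarrow> ('a, 'b, 'm) module_scheme \<Rightarrow> ('a, 'c, 'n) module_scheme \<Rightarrow> ('b \<Rightarrow> 'c) monoid"
  where "Hom_group R M N = \<lparr>carrier = mod_hom R M N \<inter> extensional (carrier M),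
    monoid.mult = (\<lambda>f g. \<lambda>x\<in>carrier M. f x \<oplus>\<^bsub>N\<^esub> g x),
    one = (\<lambda>x\<in>carrier M. \<zero>\<^bsub>N\<^esub>)\<rparr>"


section \<open>Cokernels\<close>

definition quot_module ::
    "('a, 'b, 'm) module_scheme \<Rightarrow> 'b set \<Rightarrow> ('a, 'b set) module"
  where "quot_module M H = \<lparr>carrier = a_rcosets\<^bsub>M\<^esub> H, monoid.mult = undefined, one = undefined,
    zero = H, add = set_add M, smult = (\<lambda>a C. \<Union>x\<in>C. H +>\<^bsub>M\<^esub> (a \<odot>\<^bsub>M\<^esub> x))\<rparr>"

definition coker ::
    "('a, 'b, 'm) module_scheme \<Rightarrow> ('a, 'c, 'n) module_scheme \<Rightarrow> ('b \<Rightarrow> 'c) \<Rightarrow> ('a, 'c set) module"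
  where "coker M N f = quot_module N (f ` carrier M)"

definition coker_map ::
    "('a, 'b, 'm) module_scheme \<Rightarrow> ('a, 'c, 'n) module_scheme \<Rightarrow> ('b \<Rightarrow> 'c) \<Rightarrow> 'c \<Rightarrow> 'c set"
  where "coker_map M N f x = (f ` carrier M) +>\<^bsub>N\<^esub> x"


section \<open>Duality\<close>

text \<open>
  The dual of a left \<open>R\<close>-module is the right \<open>R\<close>-module \<open>Hom\<^sub>R(M, R)\<close> with \<open>(f a)(x) = f(x) a\<close>,
  that is, a left module over \<^term>\<open>opp R\<close>. Applied to \<^term>\<open>opp R\<close>, the same definition gives
  the dual of a right \<open>R\<close>-module, with \<open>(a f)(x) = a f(x)\<close>. The bidual of a left
  \<open>R\<close>-module \<open>M\<close> is thus \<open>dual (opp R) (dual R M)\<close>.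
\<close>

definition dual :: "('a, 'r) ring_scheme \<Rightarrow> ('a, 'b, 'm) module_scheme \<Rightarrow> ('a, 'b \<Rightarrow> 'a) module"
  where "dual R M = \<lparr>carrier = carrier (Hom_group R M (regular R)),
    monoid.mult = undefined, one = undefined,
    zero = \<one>\<^bsub>Hom_group R M (regular R)\<^esub>,
    add = monoid.mult (Hom_group R M (regular R)),
    smult = (\<lambda>a f. \<lambda>x\<in>carrier M. f x \<otimes>\<^bsub>R\<^esub> a)\<rparr>"

text \<open>For \<open>f : M \<rightarrow> N\<close> the map \<open>f\<^sup>* : N\<^sup>* \<rightarrow> M\<^sup>*\<close> is \<open>dual_map M f\<close>.\<close>

definition dual_map :: "('a, 'b, 'm) module_scheme \<Rightarrow> ('b \<Rightarrow> 'c) \<Rightarrow> ('c \<Rightarrow> 'd) \<Rightarrow> ('b \<Rightarrow> 'd)"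
  where "dual_map M f = (\<lambda>g. compose (carrier M) g f)"

definition bidual_map ::
    "('a, 'r) ring_scheme \<Rightarrow> ('a, 'b, 'm) module_scheme \<Rightarrow> 'b \<Rightarrow> ('b \<Rightarrow> 'a) \<Rightarrow> 'a"
  where "bidual_map R M x = (\<lambda>f\<in>carrier (dual R M). f x)"

definition torsionless :: "('a, 'r) ring_scheme \<Rightarrow> ('a, 'b, 'm) module_scheme \<Rightarrow> bool"
  where "torsionless R M \<longleftrightarrow> inj_on (bidual_map R M) (carrier M)"

definition bidual_map_epi :: "('a, 'r) ring_scheme \<Rightarrow> ('a, 'b, 'm) module_scheme \<Rightarrow> bool"
  where "bidual_map_epi R M \<longleftrightarrow>
    bidual_map R M ` carrier M = carrier (dual (opp R) (dual R M))"


section \<open>Ext\<close>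

definition free_module :: "('a, 'r) ring_scheme \<Rightarrow> 'i set \<Rightarrow> ('a, 'i \<Rightarrow> 'a) module"
  where "free_module R B = \<lparr>carrier = {v \<in> B \<rightarrow>\<^sub>E carrier R. finite {b \<in> B. v b \<noteq> \<zero>\<^bsub>R\<^esub>}},
    monoid.mult = undefined, one = undefined,
    zero = (\<lambda>b\<in>B. \<zero>\<^bsub>R\<^esub>),
    add = (\<lambda>v w. \<lambda>b\<in>B. v b \<oplus>\<^bsub>R\<^esub> w b),
    smult = (\<lambda>a v. \<lambda>b\<in>B. a \<otimes>\<^bsub>R\<^esub> v b)\<rparr>"

text \<open>
  \<open>free_resolution R N B d e\<close> means that
  \<open>\<cdots> \<rightarrow> R\<^bsup>(B 2)\<^esup> \<rightarrow> R\<^bsup>(B 1)\<^esup> \<rightarrow> R\<^bsup>(B 0)\<^esup> \<rightarrow> N \<rightarrow> 0\<close>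
  is exact, with differentials \<open>d i : R\<^bsup>(B (i+1))\<^esup> \<rightarrow> R\<^bsup>(B i)\<^esup>\<close> and augmentation \<open>e\<close>.
\<close>

definition free_resolution ::
    "('a, 'r) ring_scheme \<Rightarrow> ('a, 'b, 'm) module_scheme \<Rightarrow>
     (nat \<Rightarrow> 'i set) \<Rightarrow> (nat \<Rightarrow> ('i \<Rightarrow> 'a) \<Rightarrow> ('i \<Rightarrow> 'a)) \<Rightarrow> (('i \<Rightarrow> 'a) \<Rightarrow> 'b) \<Rightarrow> bool"
  where "free_resolution R N B d e \<longleftrightarrow>
    e \<in> mod_hom R (free_module R (B 0)) N \<and>
    e ` carrier (free_module R (B 0)) = carrier N \<and>
    (\<forall>i. d i \<in> mod_hom R (free_module R (B (Suc i))) (free_module R (B i))) \<and>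
    d 0 ` carrier (free_module R (B 1)) = a_kernel (free_module R (B 0)) N e \<and>
    (\<forall>i. d (Suc i) ` carrier (free_module R (B (Suc (Suc i)))) =
      a_kernel (free_module R (B (Suc i))) (free_module R (B i)) (d i))"

text \<open>
  The groups of cocycles and of coboundaries, and the cohomology, in degree \<open>i\<close> of the complex
  \<open>Hom\<^sub>R(R\<^bsup>(B 0)\<^esup>, M) \<rightarrow> Hom\<^sub>R(R\<^bsup>(B 1)\<^esup>, M) \<rightarrow> \<cdots>\<close>.
\<close>

definition cocycles ::
    "('a, 'r) ring_scheme \<Rightarrow> (nat \<Rightarrow> 'i set) \<Rightarrow> (nat \<Rightarrow> ('i \<Rightarrow> 'a) \<Rightarrow> ('i \<Rightarrow> 'a)) \<Rightarrow>
     ('a, 'c, 'l) module_scheme \<Rightarrow> nat \<Rightarrow> (('i \<Rightarrow> 'a) \<Rightarrow> 'c) set"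
  where "cocycles R B d M i =
    kernel (Hom_group R (free_module R (B i)) M) (Hom_group R (free_module R (B (Suc i))) M)
      (dual_map (free_module R (B (Suc i))) (d i))"

fun coboundaries ::
    "('a, 'r) ring_scheme \<Rightarrow> (nat \<Rightarrow> 'i set) \<Rightarrow> (nat \<Rightarrow> ('i \<Rightarrow> 'a) \<Rightarrow> ('i \<Rightarrow> 'a)) \<Rightarrow>
     ('a, 'c, 'l) module_scheme \<Rightarrow> nat \<Rightarrow> (('i \<Rightarrow> 'a) \<Rightarrow> 'c) set"
  where
    "coboundaries R B d M 0 = {\<one>\<^bsub>Hom_group R (free_module R (B 0)) M\<^esub>}"
  | "coboundaries R B d M (Suc i) =
      dual_map (free_module R (B (Suc i))) (d i) ` carrier (Hom_group R (free_module R (B i)) M)"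

definition cohomology ::
    "('a, 'r) ring_scheme \<Rightarrow> (nat \<Rightarrow> 'i set) \<Rightarrow> (nat \<Rightarrow> ('i \<Rightarrow> 'a) \<Rightarrow> ('i \<Rightarrow> 'a)) \<Rightarrow>
     ('a, 'c, 'l) module_scheme \<Rightarrow> nat \<Rightarrow> (('i \<Rightarrow> 'a) \<Rightarrow> 'c) set monoid"
  where "cohomology R B d M i =
    (Hom_group R (free_module R (B i)) M)\<lparr>carrier := cocycles R B d M i\<rparr> Mod coboundaries R B d M i"

text \<open>
  \<open>Ext\<^sup>i\<^sub>R(N, M)\<close> is computed from an arbitrarily chosen free resolution of \<open>N\<close>; up to isomorphism
  it does not depend on the choice. The bases are sets of lists over \<open>'a + 'b\<close>, where \<open>'a\<close> and \<open>'b\<close>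
  are the types of the elements of \<open>R\<close> and \<open>N\<close>: this type is large enough for a free
  resolution of \<open>N\<close> to exist, by the lemma \<open>free_resolution_exists\<close> below.
\<close>

definition Ext ::
    "('a, 'r) ring_scheme \<Rightarrow> nat \<Rightarrow> ('a, 'b, 'm) module_scheme \<Rightarrow> ('a, 'c, 'l) module_scheme \<Rightarrow>
     ((('a + 'b) list \<Rightarrow> 'a) \<Rightarrow> 'c) set monoid"
  where "Ext R i N M =
    (let (B, d) = (SOME (B, d). \<exists>e. free_resolution R N B d e) in cohomology R B d M i)"

definition semi_Gorenstein_projective ::
    "('a, 'r) ring_scheme \<Rightarrow> ('a, 'b, 'm) module_scheme \<Rightarrow> bool"
  where "semi_Gorenstein_projective R N \<longleftrightarrow> (\<forall>i\<ge>1. trivial_group (Ext R i N (regular R)))"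

definition double_semi_Gorenstein_projective ::
    "('a, 'r) ring_scheme \<Rightarrow> ('a, 'b, 'm) module_scheme \<Rightarrow> bool"
  where "double_semi_Gorenstein_projective R N \<longleftrightarrow>
    semi_Gorenstein_projective R N \<and> semi_Gorenstein_projective (opp R) (dual R N)"


section \<open>Artin algebras\<close>

locale artinian_cring = cring +
  assumes descending_chain:
    "\<lbrakk>\<And>n. ideal (I n) R; \<And>n. I (Suc n) \<subseteq> I n\<rbrakk> \<Longrightarrow> \<exists>n::nat. \<forall>m\<ge>n. I m = I n"

text \<open>As in the library locale \<^locale>\<open>algebra\<close>, the record \<open>M\<close> carries both the ring
  structure of the algebra and its structure as a module over the commutative ring \<open>R\<close>.\<close>

locale artin_algebra = module + M?: ring M + R?: artinian_cring R +
  assumes smult_mult_left: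
      "\<lbrakk>a \<in> carrier R; x \<in> carrier M; y \<in> carrier M\<rbrakk> \<Longrightarrow>
       (a \<odot>\<^bsub>M\<^esub> x) \<otimes>\<^bsub>M\<^esub> y = a \<odot>\<^bsub>M\<^esub> (x \<otimes>\<^bsub>M\<^esub> y)"
    and smult_mult_right:
      "\<lbrakk>a \<in> carrier R; x \<in> carrier M; y \<in> carrier M\<rbrakk> \<Longrightarrow>
       x \<otimes>\<^bsub>M\<^esub> (a \<odot>\<^bsub>M\<^esub> y) = a \<odot>\<^bsub>M\<^esub> (x \<otimes>\<^bsub>M\<^esub> y)"
    and fin_gen: "finitely_generated R M"


section \<open>Upper triangular matrices and their modules\<close>

text \<open>The triple \<open>(a\<^sub>1, a\<^sub>2, a\<^sub>3)\<close> is the matrix with rows \<open>(a\<^sub>1, a\<^sub>2)\<close> and \<open>(0, a\<^sub>3)\<close>.\<close>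

definition T2 :: "('a, 'r) ring_scheme \<Rightarrow> ('a \<times> 'a \<times> 'a) ring"
  where "T2 R = \<lparr>carrier = carrier R \<times> carrier R \<times> carrier R,
    monoid.mult = (\<lambda>(a1, a2, a3) (b1, b2, b3).
      (a1 \<otimes>\<^bsub>R\<^esub> b1, (a1 \<otimes>\<^bsub>R\<^esub> b2) \<oplus>\<^bsub>R\<^esub> (a2 \<otimes>\<^bsub>R\<^esub> b3), a3 \<otimes>\<^bsub>R\<^esub> b3)),
    one = (\<one>\<^bsub>R\<^esub>, \<zero>\<^bsub>R\<^esub>, \<one>\<^bsub>R\<^esub>),
    zero = (\<zero>\<^bsub>R\<^esub>, \<zero>\<^bsub>R\<^esub>, \<zero>\<^bsub>R\<^esub>),
    add = (\<lambda>(a1, a2, a3) (b1, b2, b3). (a1 \<oplus>\<^bsub>R\<^esub> b1, a2 \<oplus>\<^bsub>R\<^esub> b2, a3 \<oplus>\<^bsub>R\<^esub> b3))\<rparr>"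

text \<open>The left \<open>T2 R\<close>-module given by a map \<open>\<phi> : Y \<rightarrow> X\<close> of left \<open>R\<close>-modules.\<close>

definition T2_module ::
    "('a, 'x, 'm) module_scheme \<Rightarrow> ('a, 'y, 'n) module_scheme \<Rightarrow> ('y \<Rightarrow> 'x) \<Rightarrow>
     ('a \<times> 'a \<times> 'a, 'x \<times> 'y) module"
  where "T2_module X Y \<phi> = \<lparr>carrier = carrier X \<times> carrier Y,
    monoid.mult = undefined, one = undefined,
    zero = (\<zero>\<^bsub>X\<^esub>, \<zero>\<^bsub>Y\<^esub>),
    add = (\<lambda>(x, y) (x', y'). (x \<oplus>\<^bsub>X\<^esub> x', y \<oplus>\<^bsub>Y\<^esub> y')),
    smult = (\<lambda>(a1, a2, a3) (x, y). ((a1 \<odot>\<^bsub>X\<^esub> x) \<oplus>\<^bsub>X\<^esub> (a2 \<odot>\<^bsub>X\<^esub> \<phi> y), a3 \<odot>\<^bsub>Y\<^esub> y))\<rparr>"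


section \<open>Well-definedness\<close>

lemma opp_simps [simp]:
  "carrier (opp R) = carrier R" "monoid.mult (opp R) = (\<lambda>a b. b \<otimes>\<^bsub>R\<^esub> a)" "one (opp R) = one R"
  "zero (opp R) = zero R" "add (opp R) = add R" "opp (opp R) = R"
  by (simp_all add: opp_def)

lemma regular_simps [simp]:
  "carrier (regular R) = carrier R" "zero (regular R) = zero R" "add (regular R) = add R"
  "smult (regular R) = monoid.mult R"
  by (simp_all add: regular_def)

lemma abelian_groupI':
  assumes "abelian_group R" "carrier S = carrier R" "add S = add R" "zero S = zero R"
  shows "abelian_group S"
proof -
  interpret abelian_group R by fact
  show ?thesis
    by (rule abelian_groupI) (use assms a_assoc a_comm in \<open>auto intro: l_neg\<close>)
qed

lemma ring_opp:
  assumes "ring R" shows "ring (opp R)"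
proof -
  interpret ring R by fact
  show ?thesis
    by (rule ringI) (auto intro: abelian_groupI'[OF is_abelian_group] monoidI m_assoc simp: l_distr r_distr m_assoc)
qed

lemma left_module_regular:
  assumes "ring R" shows "left_module R (regular R)"
proof -
  interpret ring R by fact
  show ?thesis
    by (intro left_module.intro left_module_axioms.intro)
       (auto intro: assms abelian_groupI'[OF is_abelian_group] simp: l_distr r_distr m_assoc)
qed

lemma ring_T2:
  assumes "ring R" shows "ring (T2 R)"
proof -
  interpret ring R by fact
  show ?thesis
  proof (rule ringI)
    show "abelian_group (T2 R)"
    proof (rule abelian_groupI)
      fix x assume "x \<in> carrier (T2 R)"
      then obtain a b c where x: "x = (a,b,c)" "a \<in> carrier R" "b \<in> carrier R" "c \<in> carrier R"
        by (auto simp: T2_def)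
      then show "\<exists>y\<in>carrier (T2 R). y \<oplus>\<^bsub>T2 R\<^esub> x = \<zero>\<^bsub>T2 R\<^esub>"
        by (intro bexI[of _ "(\<ominus>\<^bsub>R\<^esub> a, \<ominus>\<^bsub>R\<^esub> b, \<ominus>\<^bsub>R\<^esub> c)"]) (auto simp: T2_def l_neg)
    qed (auto simp: T2_def a_ac)
    show "monoid (T2 R)"
      by (rule monoidI) (auto simp: T2_def m_assoc l_distr r_distr a_assoc)
  qed (auto simp: T2_def l_distr r_distr a_ac)
qed

lemma left_module_T2_module:
  assumes "left_module R X" "left_module R Y" "\<phi> \<in> mod_hom R Y X"
  shows "left_module (T2 R) (T2_module X Y \<phi>)"
proof -
  interpret X: left_module R X by fact
  interpret Y: left_module R Y by fact
  have phi: "\<phi> y \<in> carrier X" "\<phi> (y \<oplus>\<^bsub>Y\<^esub> y') = \<phi> y \<oplus>\<^bsub>X\<^esub> \<phi> y'" "\<phi> (a \<odot>\<^bsub>Y\<^esub> y) = a \<odot>\<^bsub>X\<^esub> \<phi> y"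
    if "y \<in> carrier Y" "y' \<in> carrier Y" "a \<in> carrier R" for a y y'
    using assms(3) that by (auto simp: mod_hom_def hom_def)
  have phi0: "\<phi> y \<in> carrier X" if "y \<in> carrier Y" for y
    using assms(3) that by (auto simp: mod_hom_def hom_def)
  have sm0: "\<zero>\<^bsub>R\<^esub> \<odot>\<^bsub>X\<^esub> x = \<zero>\<^bsub>X\<^esub>" if "x \<in> carrier X" for x
    using X.smult_l_distr[of "\<zero>\<^bsub>R\<^esub>" "\<zero>\<^bsub>R\<^esub>" x] that
    by (metis X.R.l_zero X.R.zero_closed X.M.add.r_cancel_one' X.smult_closed)
  show ?thesis
  proof (intro left_module.intro left_module_axioms.intro)
    show "ring (T2 R)" by (rule ring_T2) unfold_locales
    show "abelian_group (T2_module X Y \<phi>)"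
    proof (rule abelian_groupI)
      fix x assume "x \<in> carrier (T2_module X Y \<phi>)"
      then obtain a b where x: "x = (a,b)" "a \<in> carrier X" "b \<in> carrier Y"
        by (auto simp: T2_module_def)
      then show "\<exists>y\<in>carrier (T2_module X Y \<phi>). y \<oplus>\<^bsub>T2_module X Y \<phi>\<^esub> x = \<zero>\<^bsub>T2_module X Y \<phi>\<^esub>"
        by (intro bexI[of _ "(\<ominus>\<^bsub>X\<^esub> a, \<ominus>\<^bsub>Y\<^esub> b)"]) (auto simp: T2_module_def X.M.l_neg Y.M.l_neg)
    qed (auto simp: T2_module_def X.M.a_ac Y.M.a_ac)
  qed (auto simp: T2_def T2_module_def phi0 phi sm0 X.smult_l_distr X.smult_r_distr Y.smult_l_distr Y.smult_r_distr
        X.smult_assoc1 Y.smult_assoc1 X.M.a_ac)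
qed

lemma left_module_dual:
  assumes "left_module R M" shows "left_module (opp R) (dual R M)"
proof -
  interpret M: left_module R M by fact
  have sm0: "a \<otimes>\<^bsub>R\<^esub> \<zero>\<^bsub>R\<^esub> = \<zero>\<^bsub>R\<^esub>" if "a \<in> carrier R" for a using that by simp
  show ?thesis
  proof (intro left_module.intro left_module_axioms.intro)
    show "ring (opp R)" by (rule ring_opp) unfold_locales
    show "abelian_group (dual R M)"
    proof (rule abelian_groupI)
      fix f assume f: "f \<in> carrier (dual R M)"
      then show "\<exists>g\<in>carrier (dual R M). g \<oplus>\<^bsub>dual R M\<^esub> f = \<zero>\<^bsub>dual R M\<^esub>"
        by (intro bexI[of _ "\<lambda>x\<in>carrier M. \<ominus>\<^bsub>R\<^esub> f x"])
           (auto simp: dual_def Hom_group_def mod_hom_def hom_def M.R.l_neg M.R.minus_add M.R.r_minus Pi_iff)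
    qed (auto simp: dual_def Hom_group_def mod_hom_def hom_def Pi_iff M.R.a_ac M.R.r_distr intro!: restrict_ext extensionalityI[where A = "carrier M"])
  qed (auto simp: dual_def Hom_group_def mod_hom_def hom_def Pi_iff M.R.a_ac M.R.r_distr M.R.l_distr M.R.m_assoc
        intro!: restrict_ext extensionalityI[where A = "carrier M"])
qed


lemma mod_homD:
  assumes "f \<in> mod_hom R M N" "x \<in> carrier M"
  shows "f x \<in> carrier N" "y \<in> carrier M \<Longrightarrow> f (x \<oplus>\<^bsub>M\<^esub> y) = f x \<oplus>\<^bsub>N\<^esub> f y"
    "a \<in> carrier R \<Longrightarrow> f (a \<odot>\<^bsub>M\<^esub> x) = a \<odot>\<^bsub>N\<^esub> f x"
  using assms by (auto simp: mod_hom_def hom_def)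

lemma submodule_image:
  assumes "left_module R M" "left_module R N" "f \<in> mod_hom R M N"
  shows "submodule (f ` carrier M) R N"
proof -
  interpret M: left_module R M by fact
  interpret N: left_module R N by fact
  have "group_hom (add_monoid M) (add_monoid N) f"
    using assms(3) by (intro group_hom.intro group_hom_axioms.intro M.M.a_group N.M.a_group) (auto simp: mod_hom_def)
  then have "subgroup (f ` carrier (add_monoid M)) (add_monoid N)"
    by (rule group_hom.img_is_subgroup)
  then show ?thesis
    using mod_homD(3)[OF assms(3)] M.smult_closed
    by (auto simp: submodule_def submodule_axioms_def) (metis image_eqI mod_homD(3)[OF assms(3)] M.smult_closed)
qed

lemma comm_group_more:
  assumes "comm_group \<lparr>carrier = C, monoid.mult = m, one = e\<rparr>"
  shows "comm_group \<lparr>carrier = C, monoid.mult = m, one = e, \<dots> = z\<rparr>"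
proof -
  interpret comm_group "\<lparr>carrier = C, monoid.mult = m, one = e\<rparr>" by fact
  show ?thesis
    by (rule comm_groupI) (use m_closed one_closed m_assoc m_comm l_one l_inv_ex in auto)
qed

lemma left_module_quot_module:
  assumes "left_module R M" "submodule H R M"
  shows "left_module R (quot_module M H)"
    and "(\<lambda>x. H +>\<^bsub>M\<^esub> x) \<in> mod_hom R M (quot_module M H)"
proof -
  interpret M: left_module R M by fact
  interpret H: submodule H R M by fact
  interpret H: abelian_subgroup H M
    by (rule abelian_subgroupI3) (auto simp: additive_subgroup_def H.subgroup_axioms M.M.abelian_group_axioms)
  have rc: "(\<Union>x\<in>H +>\<^bsub>M\<^esub> m. H +>\<^bsub>M\<^esub> (a \<odot>\<^bsub>M\<^esub> x)) = H +>\<^bsub>M\<^esub> (a \<odot>\<^bsub>M\<^esub> m)"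
    if "a \<in> carrier R" "m \<in> carrier M" for a m
  proof -
    have "H +>\<^bsub>M\<^esub> (a \<odot>\<^bsub>M\<^esub> x) = H +>\<^bsub>M\<^esub> (a \<odot>\<^bsub>M\<^esub> m)" if x: "x \<in> H +>\<^bsub>M\<^esub> m" for x
    proof -
      obtain h where h: "h \<in> H" "x = h \<oplus>\<^bsub>M\<^esub> m" using x by (auto simp: a_r_coset_def')
      then have "a \<odot>\<^bsub>M\<^esub> x = a \<odot>\<^bsub>M\<^esub> h \<oplus>\<^bsub>M\<^esub> a \<odot>\<^bsub>M\<^esub> m"
        using \<open>a \<in> carrier R\<close> \<open>m \<in> carrier M\<close> H.a_Hcarr by (simp add: M.smult_r_distr)
      then have "a \<odot>\<^bsub>M\<^esub> x \<in> H +>\<^bsub>M\<^esub> (a \<odot>\<^bsub>M\<^esub> m)"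
        using h H.smult_closed \<open>a \<in> carrier R\<close> by (auto simp: a_r_coset_def')
      then show ?thesis
        using H.a_repr_independence' \<open>a \<in> carrier R\<close> \<open>m \<in> carrier M\<close> by auto
    qed
    moreover have "m \<in> H +>\<^bsub>M\<^esub> m" using that by (rule_tac H.a_rcos_self)
    ultimately show ?thesis by blast
  qed
  have add: "(H +>\<^bsub>M\<^esub> x) <+>\<^bsub>M\<^esub> (H +>\<^bsub>M\<^esub> y) = H +>\<^bsub>M\<^esub> (x \<oplus>\<^bsub>M\<^esub> y)"
    if "x \<in> carrier M" "y \<in> carrier M" for x y
    using H.a_rcos_sum that by simp
  have cl: "H +>\<^bsub>M\<^esub> x \<in> a_rcosets\<^bsub>M\<^esub> H" if "x \<in> carrier M" for x
    using that by (auto simp: A_RCOSETS_def')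
  have ex: "\<exists>x\<in>carrier M. C = H +>\<^bsub>M\<^esub> x" if "C \<in> a_rcosets\<^bsub>M\<^esub> H" for C
    using that by (auto simp: A_RCOSETS_def')
  have Q: "C \<in> carrier (quot_module M H) \<longleftrightarrow> (\<exists>x\<in>carrier M. C = H +>\<^bsub>M\<^esub> x)"
    "a \<in> carrier R \<Longrightarrow> x \<in> carrier M \<Longrightarrow> a \<odot>\<^bsub>quot_module M H\<^esub> (H +>\<^bsub>M\<^esub> x) = H +>\<^bsub>M\<^esub> (a \<odot>\<^bsub>M\<^esub> x)"
    "x \<in> carrier M \<Longrightarrow> y \<in> carrier M \<Longrightarrow>
      (H +>\<^bsub>M\<^esub> x) \<oplus>\<^bsub>quot_module M H\<^esub> (H +>\<^bsub>M\<^esub> y) = H +>\<^bsub>M\<^esub> (x \<oplus>\<^bsub>M\<^esub> y)" for C a x y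
    using cl by (auto simp: quot_module_def rc add dest: ex)
  show "left_module R (quot_module M H)"
  proof (intro left_module.intro left_module_axioms.intro)
    show "ring R" by unfold_locales
    have "comm_group (add_monoid (quot_module M H))"
      using comm_group_more[OF H.a_factorgroup_is_comm_group[unfolded A_FactGroup_def FactGroup_def]]
      by (simp add: A_FactGroup_def FactGroup_def quot_module_def A_RCOSETS_def set_add_def)
    then show "abelian_group (quot_module M H)"
      by (intro abelian_group.intro abelian_group_axioms.intro abelian_monoid.intro) (auto simp: comm_group_def)
  qed (auto simp: Q M.smult_l_distr M.smult_r_distr M.smult_assoc1)
  show "(\<lambda>x. H +>\<^bsub>M\<^esub> x) \<in> mod_hom R M (quot_module M H)"
    by (auto simp: mod_hom_def hom_def quot_module_def rc add cl)
qed

lemma left_module_coker: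
  assumes "left_module R M" "left_module R N" "f \<in> mod_hom R M N"
  shows "left_module R (coker M N f)" and "coker_map M N f \<in> mod_hom R N (coker M N f)"
  using left_module_quot_module[OF assms(2) submodule_image[OF assms]]
  by (simp_all add: coker_def coker_map_def[abs_def])

lemma dual_map_mod_hom:
  assumes "left_module R M" "left_module R N" "f \<in> mod_hom R M N"
  shows "dual_map M f \<in> mod_hom (opp R) (dual R N) (dual R M)"
proof -
  interpret M: left_module R M by fact
  interpret N: left_module R N by fact
  note f = mod_homD[OF assms(3)]
  show ?thesis
    by (auto simp: mod_hom_def hom_def dual_def Hom_group_def dual_map_def compose_def Pi_iff f
          intro!: restrict_ext)
qed


lemma quot_module_ex1:
  assumes "left_module R M" "left_module R N" "submodule H R M" "f \<in> mod_hom R M N"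
    and zero: "\<And>h. h \<in> H \<Longrightarrow> f h = \<zero>\<^bsub>N\<^esub>"
  shows "\<exists>!g. g \<in> mod_hom R (quot_module M H) N \<inter> extensional (carrier (quot_module M H)) \<and>
    (\<forall>x \<in> carrier M. f x = g (H +>\<^bsub>M\<^esub> x))"
proof -
  interpret M: left_module R M by fact
  interpret N: left_module R N by fact
  interpret H: submodule H R M by fact
  interpret H: abelian_subgroup H M
    by (rule abelian_subgroupI3) (auto simp: additive_subgroup_def H.subgroup_axioms M.M.abelian_group_axioms)
  note f = mod_homD[OF assms(4)]
  let ?Q = "quot_module M H"
  have q: "(\<lambda>x. H +>\<^bsub>M\<^esub> x) \<in> mod_hom R M ?Q" and Q: "left_module R ?Q"
    using left_module_quot_module[OF assms(1,3)] by auto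
  interpret Q: left_module R ?Q by fact
  have ex: "C \<in> carrier ?Q \<longleftrightarrow> (\<exists>x\<in>carrier M. C = H +>\<^bsub>M\<^esub> x)" for C
    by (auto simp: A_RCOSETS_def' quot_module_def)
  have wd: "f x = f y" if "x \<in> carrier M" "y \<in> carrier M" "H +>\<^bsub>M\<^esub> x = H +>\<^bsub>M\<^esub> y" for x y
  proof -
    have "x \<in> H +>\<^bsub>M\<^esub> y" using H.a_rcos_self that by metis
    then obtain h where "h \<in> H" "x = h \<oplus>\<^bsub>M\<^esub> y" by (auto simp: a_r_coset_def')
    then show ?thesis using f(2)[of h y] zero f(1)[of y] that H.a_Hcarr by auto
  qed
  define g where "g = (\<lambda>C\<in>carrier ?Q. f (SOME x. x \<in> carrier M \<and> C = H +>\<^bsub>M\<^esub> x))"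
  have g: "g (H +>\<^bsub>M\<^esub> x) = f x" if "x \<in> carrier M" for x
  proof -
    have *: "H +>\<^bsub>M\<^esub> x \<in> carrier ?Q" using that ex by auto
    have "(SOME z. z \<in> carrier M \<and> H +>\<^bsub>M\<^esub> x = H +>\<^bsub>M\<^esub> z) \<in> carrier M \<and>
      H +>\<^bsub>M\<^esub> x = H +>\<^bsub>M\<^esub> (SOME z. z \<in> carrier M \<and> H +>\<^bsub>M\<^esub> x = H +>\<^bsub>M\<^esub> z)"
      by (rule someI[of _ x]) (use that in auto)
    then show ?thesis using wd[OF that] * by (auto simp: g_def)
  qed
  have "g \<in> mod_hom R ?Q N"
    unfolding mod_hom_def hom_def
    using g f M.smult_closed
    by (auto simp: ex mod_homD(2,3)[OF q, symmetric])
  moreover have "g \<in> extensional (carrier ?Q)" by (simp add: g_def)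
  moreover have "\<forall>x \<in> carrier M. f x = g (H +>\<^bsub>M\<^esub> x)" using g by simp
  moreover have "h = g" if "h \<in> extensional (carrier ?Q)" "\<forall>x \<in> carrier M. f x = h (H +>\<^bsub>M\<^esub> x)" for h
  proof (rule extensionalityI[OF that(1)])
    show "g \<in> extensional (carrier ?Q)" by (simp add: g_def)
    show "h C = g C" if "C \<in> carrier ?Q" for C
      using that g \<open>\<forall>x \<in> carrier M. f x = h (H +>\<^bsub>M\<^esub> x)\<close> by (auto simp: ex)
  qed
  ultimately show ?thesis by blast
qed

text \<open>
  Since \<open>\<phi>\<^sup>*\<close> vanishes on the image of \<open>\<pi>\<^sup>*\<close>, it factors uniquely through \<open>p\<close>.
\<close>

lemma ex1_beta:
  fixes R :: "('a, 'r) ring_scheme" and X :: "('a, 'x, 'm) module_scheme" and Y :: "('a, 'y, 'n) module_scheme"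
    and \<phi> and C \<pi> D p
  defines "C \<equiv> coker Y X \<phi>" and "\<pi> \<equiv> coker_map Y X \<phi>"
    and "D \<equiv> coker (dual R C) (dual R X) (dual_map X \<pi>)"
    and "p \<equiv> coker_map (dual R C) (dual R X) (dual_map X \<pi>)"
  assumes X: "left_module R X" and Y: "left_module R Y" and \<phi>: "\<phi> \<in> mod_hom R Y X"
  shows "\<exists>!\<beta>. \<beta> \<in> mod_hom (opp R) D (dual R Y) \<inter> extensional (carrier D) \<and>
    (\<forall>f \<in> carrier (dual R X). dual_map Y \<phi> f = \<beta> (p f))"
proof -
  interpret X: left_module R X by fact
  interpret Y: left_module R Y by fact
  have C: "left_module R C" "\<pi> \<in> mod_hom R X C"
    using left_module_coker[OF Y X \<phi>] by (simp_all add: C_def \<pi>_def)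
  interpret sm: submodule "\<phi> ` carrier Y" R X by (rule submodule_image[OF Y X \<phi>])
  interpret sm: abelian_subgroup "\<phi> ` carrier Y" X
    by (rule abelian_subgroupI3) (auto simp: additive_subgroup_def sm.subgroup_axioms X.M.abelian_group_axioms)
  have pz: "\<pi> (\<phi> y) = \<zero>\<^bsub>C\<^esub>" if "y \<in> carrier Y" for y
    using that sm.a_rcos_const by (auto simp: \<pi>_def C_def coker_def coker_map_def quot_module_def)
  have z: "g \<zero>\<^bsub>C\<^esub> = \<zero>\<^bsub>R\<^esub>" if "g \<in> mod_hom R C (regular R)" for g
  proof -
    interpret C: left_module R C by fact
    have "g \<zero>\<^bsub>C\<^esub> \<in> carrier R" "g (\<zero>\<^bsub>C\<^esub> \<oplus>\<^bsub>C\<^esub> \<zero>\<^bsub>C\<^esub>) = g \<zero>\<^bsub>C\<^esub> \<oplus>\<^bsub>R\<^esub> g \<zero>\<^bsub>C\<^esub>"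
      using mod_homD(1,2)[OF that C.M.zero_closed] C.M.zero_closed by auto
    then show ?thesis by simp
  qed
  have sub: "submodule (dual_map X \<pi> ` carrier (dual R C)) (opp R) (dual R X)"
    by (intro submodule_image left_module_dual dual_map_mod_hom C X)
  have "dual_map Y \<phi> h = \<zero>\<^bsub>dual R Y\<^esub>" if "h \<in> dual_map X \<pi> ` carrier (dual R C)" for h
    using that pz z mod_homD(1)[OF \<phi>]
    by (auto simp: dual_map_def dual_def Hom_group_def compose_def intro!: restrict_ext)
  from quot_module_ex1[OF left_module_dual[OF X] left_module_dual[OF Y] sub dual_map_mod_hom[OF Y X \<phi>] this]
  show ?thesis by (simp add: D_def p_def coker_def coker_map_def)
qed


lemma left_module_free_module:
  assumes "ring R" shows "left_module R (free_module R B)"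
proof -
  interpret ring R by fact
  have fin: "finite {b \<in> B. v b \<oplus>\<^bsub>R\<^esub> w b \<noteq> \<zero>\<^bsub>R\<^esub>}"
    if "finite {b \<in> B. v b \<noteq> \<zero>\<^bsub>R\<^esub>}" "finite {b \<in> B. w b \<noteq> \<zero>\<^bsub>R\<^esub>}" for v w
    by (rule finite_subset[OF _ finite_UnI[OF that]]) auto
  have fin2: "finite {b \<in> B. a \<otimes>\<^bsub>R\<^esub> v b \<noteq> \<zero>\<^bsub>R\<^esub>}"
    if "a \<in> carrier R" "finite {b \<in> B. v b \<noteq> \<zero>\<^bsub>R\<^esub>}" for v a
    by (rule finite_subset[OF _ that(2)]) (use that(1) in auto)
  have fin3: "finite {b \<in> B. \<ominus>\<^bsub>R\<^esub> v b \<noteq> \<zero>\<^bsub>R\<^esub>}"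
    if "finite {b \<in> B. v b \<noteq> \<zero>\<^bsub>R\<^esub>}" for v
    by (rule finite_subset[OF _ that]) auto
  show ?thesis
  proof (intro left_module.intro left_module_axioms.intro)
    show "abelian_group (free_module R B)"
    proof (rule abelian_groupI)
      fix v assume "v \<in> carrier (free_module R B)"
      then show "\<exists>w\<in>carrier (free_module R B). w \<oplus>\<^bsub>free_module R B\<^esub> v = \<zero>\<^bsub>free_module R B\<^esub>"
        by (intro bexI[of _ "\<lambda>b\<in>B. \<ominus>\<^bsub>R\<^esub> v b"])
           (auto simp: free_module_def PiE_iff l_neg fin3 cong: conj_cong)
    qed (auto simp: free_module_def PiE_iff a_ac fin cong: conj_cong intro!: extensionalityI[where A = B])
  qed (auto simp: assms free_module_def PiE_iff a_ac fin fin2 l_distr r_distr m_assoc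
        cong: conj_cong intro!: extensionalityI[where A = B])
qed

lemma free_cover:
  fixes M :: "('a, 'b, 'm) module_scheme"
  assumes "left_module R M" "carrier M \<lesssim> (UNIV :: 'i set)"
  obtains B :: "'i set" and f where "f \<in> mod_hom R (free_module R B) M"
    and "f ` carrier (free_module R B) = carrier M"
proof -
  interpret M: left_module R M by fact
  obtain j :: "'b \<Rightarrow> 'i" where j: "inj_on j (carrier M)"
    using assms(2) by (auto simp: lepoll_def)
  define B where "B = j ` carrier M"
  define g where "g = inv_into (carrier M) j"
  have g: "g b \<in> carrier M" if "b \<in> B" for b
    using that by (auto simp: g_def B_def j)
  have gj: "g (j m) = m" if "m \<in> carrier M" for m
    using that j by (auto simp: g_def)
  define F where "F = free_module R B"
  define f where "f v = (\<Oplus>\<^bsub>M\<^esub>b\<in>{b\<in>B. v b \<noteq> \<zero>\<^bsub>R\<^esub>}. v b \<odot>\<^bsub>M\<^esub> g b)" for v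
  have sm0: "\<zero>\<^bsub>R\<^esub> \<odot>\<^bsub>M\<^esub> x = \<zero>\<^bsub>M\<^esub>" if "x \<in> carrier M" for x
    using M.smult_l_distr[of "\<zero>\<^bsub>R\<^esub>" "\<zero>\<^bsub>R\<^esub>" x] that
    by (metis M.R.l_zero M.R.zero_closed M.M.add.r_cancel_one' M.smult_closed)
  have s0: "a \<odot>\<^bsub>M\<^esub> \<zero>\<^bsub>M\<^esub> = \<zero>\<^bsub>M\<^esub>" if "a \<in> carrier R" for a
    using M.smult_r_distr[of a "\<zero>\<^bsub>M\<^esub>" "\<zero>\<^bsub>M\<^esub>"] that
    by (metis M.M.l_zero M.M.zero_closed M.M.add.r_cancel_one' M.smult_closed)
  have cl: "v b \<odot>\<^bsub>M\<^esub> g b \<in> carrier M" if "v \<in> carrier F" "b \<in> B" for v b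
    using that g by (auto simp: F_def free_module_def)
  have fS: "f v = (\<Oplus>\<^bsub>M\<^esub>b\<in>S. v b \<odot>\<^bsub>M\<^esub> g b)"
    if "v \<in> carrier F" "finite S" "S \<subseteq> B" "{b\<in>B. v b \<noteq> \<zero>\<^bsub>R\<^esub>} \<subseteq> S" for v S
    unfolding f_def
    by (rule M.M.add.finprod_mono_neutral_cong_left) (use that g sm0 cl in auto)
  interpret F: left_module R F
    unfolding F_def by (rule left_module_free_module) unfold_locales
  have supp: "finite {b\<in>B. v b \<noteq> \<zero>\<^bsub>R\<^esub>}" if "v \<in> carrier F" for v
    using that by (simp add: F_def free_module_def)
  have fcl: "f v \<in> carrier M" if "v \<in> carrier F" for v
    unfolding f_def using that cl by (intro M.M.finsum_closed) auto
  have "f \<in> mod_hom R F M"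
    unfolding mod_hom_def hom_def
  proof (clarsimp simp: fcl, intro conjI ballI)
    fix v w assume v: "v \<in> carrier F" and w: "w \<in> carrier F"
    define S where "S = {b\<in>B. v b \<noteq> \<zero>\<^bsub>R\<^esub>} \<union> {b\<in>B. w b \<noteq> \<zero>\<^bsub>R\<^esub>}"
    have S: "finite S" "S \<subseteq> B" using supp v w by (auto simp: S_def)
    have add: "(v \<oplus>\<^bsub>F\<^esub> w) b = v b \<oplus>\<^bsub>R\<^esub> w b" if "b \<in> B" for b
      using that by (simp add: F_def free_module_def)
    have vw: "v b \<in> carrier R" "w b \<in> carrier R" if "b \<in> B" for b
      using that v w by (auto simp: F_def free_module_def)
    have "f (v \<oplus>\<^bsub>F\<^esub> w) = (\<Oplus>\<^bsub>M\<^esub>b\<in>S. (v \<oplus>\<^bsub>F\<^esub> w) b \<odot>\<^bsub>M\<^esub> g b)"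
      by (rule fS) (use v w S add in \<open>auto simp: S_def\<close>)
    also have "\<dots> = (\<Oplus>\<^bsub>M\<^esub>b\<in>S. v b \<odot>\<^bsub>M\<^esub> g b \<oplus>\<^bsub>M\<^esub> w b \<odot>\<^bsub>M\<^esub> g b)"
      by (rule M.M.add.finprod_cong') (use S g vw add cl v w in \<open>auto simp: M.smult_l_distr subset_iff\<close>)
    also have "\<dots> = (\<Oplus>\<^bsub>M\<^esub>b\<in>S. v b \<odot>\<^bsub>M\<^esub> g b) \<oplus>\<^bsub>M\<^esub> (\<Oplus>\<^bsub>M\<^esub>b\<in>S. w b \<odot>\<^bsub>M\<^esub> g b)"
      by (rule M.M.finsum_addf) (use S cl v w in auto)
    also have "\<dots> = f v \<oplus>\<^bsub>M\<^esub> f w"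
      using fS[OF v S] fS[OF w S] by (auto simp: S_def)
    finally show "f (v \<oplus>\<^bsub>F\<^esub> w) = f v \<oplus>\<^bsub>M\<^esub> f w" .
  next
    fix a v assume a: "a \<in> carrier R" and v: "v \<in> carrier F"
    define S where "S = {b\<in>B. v b \<noteq> \<zero>\<^bsub>R\<^esub>}"
    have S: "finite S" "S \<subseteq> B" using supp v by (auto simp: S_def)
    have sm: "(a \<odot>\<^bsub>F\<^esub> v) b = a \<otimes>\<^bsub>R\<^esub> v b" if "b \<in> B" for b
      using that by (simp add: F_def free_module_def)
    have vb: "v b \<in> carrier R" if "b \<in> B" for b
      using that v by (auto simp: F_def free_module_def)
    have "a \<odot>\<^bsub>M\<^esub> (\<Oplus>\<^bsub>M\<^esub>b\<in>T. v b \<odot>\<^bsub>M\<^esub> g b) = (\<Oplus>\<^bsub>M\<^esub>b\<in>T. (a \<odot>\<^bsub>F\<^esub> v) b \<odot>\<^bsub>M\<^esub> g b)"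
      if "finite T" "T \<subseteq> B" for T
      using that
    proof (induction T rule: finite_induct)
      case empty show ?case by (simp add: s0 a)
    next
      case (insert b T)
      then have T: "(\<lambda>b. v b \<odot>\<^bsub>M\<^esub> g b) \<in> T \<rightarrow> carrier M" "(\<lambda>b. (a \<odot>\<^bsub>F\<^esub> v) b \<odot>\<^bsub>M\<^esub> g b) \<in> T \<rightarrow> carrier M"
        using cl v a by (auto intro!: cl)
      show ?case
        using insert T cl v a g[of b] vb
        by (simp add: M.smult_r_distr M.M.finsum_closed sm M.smult_assoc1)
    qed
    from this[OF S] have eq: "a \<odot>\<^bsub>M\<^esub> (\<Oplus>\<^bsub>M\<^esub>b\<in>S. v b \<odot>\<^bsub>M\<^esub> g b) = (\<Oplus>\<^bsub>M\<^esub>b\<in>S. (a \<odot>\<^bsub>F\<^esub> v) b \<odot>\<^bsub>M\<^esub> g b)" .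
    show "f (a \<odot>\<^bsub>F\<^esub> v) = a \<odot>\<^bsub>M\<^esub> f v"
    proof -
      have "{b \<in> B. (a \<odot>\<^bsub>F\<^esub> v) b \<noteq> \<zero>\<^bsub>R\<^esub>} \<subseteq> S" using sm a by (auto simp: S_def)
      then have "f (a \<odot>\<^bsub>F\<^esub> v) = (\<Oplus>\<^bsub>M\<^esub>b\<in>S. (a \<odot>\<^bsub>F\<^esub> v) b \<odot>\<^bsub>M\<^esub> g b)"
        by (rule fS[OF F.smult_closed[OF a v] S])
      with eq show ?thesis using fS[OF v S] by (simp add: S_def)
    qed
  qed
  moreover have "f ` carrier F = carrier M"
  proof
    show "f ` carrier F \<subseteq> carrier M" using fcl by auto
    show "carrier M \<subseteq> f ` carrier F"
    proof
      fix m assume m: "m \<in> carrier M"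
      define v where "v = (\<lambda>b\<in>B. if b = j m then \<one>\<^bsub>R\<^esub> else \<zero>\<^bsub>R\<^esub>)"
      have jm: "j m \<in> B" using m by (auto simp: B_def)
      have "finite {b \<in> B. v b \<noteq> \<zero>\<^bsub>R\<^esub>}"
        by (rule finite_subset[of _ "{j m}"]) (auto simp: v_def)
      then have v: "v \<in> carrier F" by (auto simp: F_def free_module_def v_def)
      have "f v = (\<Oplus>\<^bsub>M\<^esub>b\<in>{j m}. v b \<odot>\<^bsub>M\<^esub> g b)"
        by (rule fS) (use v jm in \<open>auto simp: v_def\<close>)
      also have "\<dots> = m" using m jm gj cl[OF v jm] by (simp add: v_def)
      finally show "m \<in> f ` carrier F" using v by auto
    qed
  qed
  ultimately show ?thesis using that unfolding F_def by blast
qed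

lemma lepoll_free_module:
  fixes R :: "('a, 'r) ring_scheme" and B :: "('a + 'b) list set"
  shows "carrier (free_module R B) \<lesssim> (UNIV :: ('a + 'b) list set)"
proof -
  let ?U = "UNIV :: ('a + 'b) list set"
  let ?A = "UNIV :: 'a set"
  let ?G = "\<lambda>v. {(b, v b) | b. b \<in> B \<and> v b \<noteq> \<zero>\<^bsub>R\<^esub>}"
  have "infinite ?U" by (rule infinite_UNIV_listI)
  have "inj_on ?G (carrier (free_module R B))"
  proof (rule inj_onI)
    fix v w assume v: "v \<in> carrier (free_module R B)" and w: "w \<in> carrier (free_module R B)"
      and eq: "?G v = ?G w"
    show "v = w"
    proof (rule extensionalityI[where A = B])
      show "v \<in> extensional B" "w \<in> extensional B" using v w by (auto simp: free_module_def PiE_def)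
      fix b assume "b \<in> B"
      then show "v b = w b" using eq by (cases "v b = \<zero>\<^bsub>R\<^esub>"; cases "w b = \<zero>\<^bsub>R\<^esub>") (auto simp: set_eq_iff)
    qed
  qed
  moreover have "?G ` carrier (free_module R B) \<subseteq> Fpow (?U \<times> ?A)"
  proof -
    have "?G v = (\<lambda>b. (b, v b)) ` {b \<in> B. v b \<noteq> \<zero>\<^bsub>R\<^esub>}" for v by auto
    then show ?thesis by (auto simp: Fpow_def free_module_def)
  qed
  ultimately have "carrier (free_module R B) \<lesssim> Fpow (?U \<times> ?A)" by (auto simp: lepoll_def)
  also have "Fpow (?U \<times> ?A) \<approx> ?U \<times> ?A"
    using \<open>infinite ?U\<close> by (intro eqpoll_Fpow) (blast dest: finite_cartesian_productD1)
  also have "?U \<times> ?A \<lesssim> ?U \<times> ?U"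
  proof -
    have "inj_on (\<lambda>(u, a). (u, [Inl a :: 'a + 'b])) (?U \<times> ?A)" by (auto simp: inj_on_def)
    then show ?thesis unfolding lepoll_def
      by (intro exI[of _ "\<lambda>(u, a). (u, [Inl a :: 'a + 'b])"]) simp
  qed
  also have "?U \<times> ?U \<approx> ?U"
    using card_of_Times_same_infinite[OF \<open>infinite ?U\<close>] by (simp add: eqpoll_iff_card_of_ordIso)
  finally show ?thesis .
qed

lemma a_kernel_submodule:
  assumes "left_module R M" "left_module R N" "f \<in> mod_hom R M N"
  shows "left_module R (M\<lparr>carrier := a_kernel M N f\<rparr>)"
proof -
  interpret M: left_module R M by fact
  interpret N: left_module R N by fact
  note f = mod_homD[OF assms(3)]
  have "group_hom (add_monoid M) (add_monoid N) f"
    using assms(3) by (intro group_hom.intro group_hom_axioms.intro M.M.a_group N.M.a_group) (auto simp: mod_hom_def)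
  then have sg: "subgroup (a_kernel M N f) (add_monoid M)"
    unfolding a_kernel_def by (rule group_hom.subgroup_kernel)
  have s0: "a \<odot>\<^bsub>N\<^esub> \<zero>\<^bsub>N\<^esub> = \<zero>\<^bsub>N\<^esub>" if "a \<in> carrier R" for a
    using N.smult_r_distr[of a "\<zero>\<^bsub>N\<^esub>" "\<zero>\<^bsub>N\<^esub>"] that
    by (metis N.M.l_zero N.M.zero_closed N.M.add.r_cancel_one' N.smult_closed)
  have K: "x \<in> a_kernel M N f \<longleftrightarrow> x \<in> carrier M \<and> f x = \<zero>\<^bsub>N\<^esub>" for x
    by (auto simp: a_kernel_def' )
  have "comm_group (add_monoid (M\<lparr>carrier := a_kernel M N f\<rparr>))"
    using group.subgroup_imp_group[OF M.M.a_group sg] subgroup.subset[OF sg]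
    by (intro group.group_comm_groupI) (auto simp: subset_iff intro: M.M.a_comm)
  then have "abelian_group (M\<lparr>carrier := a_kernel M N f\<rparr>)"
    by (intro abelian_group.intro abelian_group_axioms.intro abelian_monoid.intro) (auto simp: comm_group_def)
  then show ?thesis
    by (intro left_module.intro left_module_axioms.intro)
       (auto simp: K f s0 M.smult_l_distr M.smult_r_distr M.smult_assoc1 M.R.ring_axioms)
qed

lemma mod_hom_carrier_update:
  assumes "f \<in> mod_hom R M (N\<lparr>carrier := H\<rparr>)" "H \<subseteq> carrier N"
  shows "f \<in> mod_hom R M N"
  using assms by (auto simp: mod_hom_def hom_def)

text \<open>The choice in the definition of \<^const>\<open>Ext\<close> is a choice from a nonempty set.\<close>

lemma free_resolution_exists:
  fixes R :: "('a, 'r) ring_scheme" and N :: "('a, 'b, 'm) module_scheme"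
  assumes "left_module R N"
  shows "\<exists>(B :: nat \<Rightarrow> ('a + 'b) list set) d e. free_resolution R N B d e"
proof -
  interpret N: left_module R N by fact
  have free: "left_module R (free_module R B)" for B :: "('a + 'b) list set"
    by (rule left_module_free_module) unfold_locales
  have sub: "a_kernel M M' f \<subseteq> carrier M"
    for M :: "('a, 'c) module" and M' :: "('a, 'd, 'k) module_scheme" and f
    by (auto simp: a_kernel_def')
  have step: "\<exists>(B' :: ('a + 'b) list set) d. d \<in> mod_hom R (free_module R B') (free_module R B) \<and>
      d ` carrier (free_module R B') = a_kernel (free_module R B) M f"
    if M: "left_module R M" "f \<in> mod_hom R (free_module R B) M"
    for B :: "('a + 'b) list set" and M :: "('a, 'c, 'k) module_scheme" and f
  proof -
    let ?K = "(free_module R B)\<lparr>carrier := a_kernel (free_module R B) M f\<rparr>"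
    have "carrier ?K \<lesssim> (UNIV :: ('a + 'b) list set)"
      using lepoll_trans[OF subset_imp_lepoll[OF sub] lepoll_free_module] by simp
    with a_kernel_submodule[OF free M] obtain B' :: "('a + 'b) list set" and d
      where "d \<in> mod_hom R (free_module R B') ?K" "d ` carrier (free_module R B') = carrier ?K"
      by (rule free_cover)
    then show ?thesis
      using mod_hom_carrier_update[where f = d and N = "free_module R B", OF _ sub]
      by (intro exI[of _ B'] exI[of _ d]) simp
  qed
  have "inj (\<lambda>x :: 'b. [Inr x :: 'a + 'b])" by (auto simp: inj_on_def)
  then have "carrier N \<lesssim> (UNIV :: ('a + 'b) list set)"
    unfolding lepoll_def by (meson inj_on_subset subset_UNIV)
  with assms obtain B0 :: "('a + 'b) list set" and e
    where e: "e \<in> mod_hom R (free_module R B0) N" "e ` carrier (free_module R B0) = carrier N"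
    by (rule free_cover)
  obtain B1 :: "('a + 'b) list set" and d0 where d0: "d0 \<in> mod_hom R (free_module R B1) (free_module R B0)"
      "d0 ` carrier (free_module R B1) = a_kernel (free_module R B0) N e"
    using step[OF assms e(1)] by blast
  define P where "P = (\<lambda>(i::nat) (B :: ('a + 'b) list set, B' :: ('a + 'b) list set, d).
    d \<in> mod_hom R (free_module R B') (free_module R B) \<and> (i = 0 \<longrightarrow> (B, B', d) = (B0, B1, d0)))"
  define Q where "Q = (\<lambda>(i::nat) (B :: ('a + 'b) list set, B' :: ('a + 'b) list set, d)
      (C :: ('a + 'b) list set, C' :: ('a + 'b) list set, d').
    C = B' \<and> d' ` carrier (free_module R C') = a_kernel (free_module R B') (free_module R B) d)"
  have "\<exists>F. \<forall>i. P i (F i) \<and> Q i (F i) (F (Suc i))"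
  proof (rule dependent_nat_choice)
    show "\<exists>x. P 0 x" using d0 by (auto simp: P_def)
    fix x i assume "P i x"
    then obtain B B' d where x: "x = (B, B', d)" "d \<in> mod_hom R (free_module R B') (free_module R B)"
      by (cases x) (auto simp: P_def)
    from step[OF free x(2)] obtain C' :: "('a + 'b) list set" and d' where
      "d' \<in> mod_hom R (free_module R C') (free_module R B')"
      "d' ` carrier (free_module R C') = a_kernel (free_module R B') (free_module R B) d" by blast
    then have "P (Suc i) (B', C', d') \<and> Q i x (B', C', d')" by (simp add: P_def Q_def x)
    then show "\<exists>y. P (Suc i) y \<and> Q i x y" by blast
  qed
  then obtain F where F: "\<And>i. P i (F i)" "\<And>i. Q i (F i) (F (Suc i))" by blast
  define B where "B i = fst (F i)" for i
  define d where "d i = snd (snd (F i))" for i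
  have Suc: "fst (snd (F i)) = B (Suc i)" for i
    using F(2)[of i] by (auto simp: Q_def B_def split: prod.splits)
  have F0: "F 0 = (B0, B1, d0)" using F(1)[of 0] by (auto simp: P_def split: prod.splits)
  have B0: "B 0 = B0" "B 1 = B1" "d 0 = d0"
    using F0 Suc[of 0] by (auto simp: B_def d_def)
  have FE: "F i = (B i, B (Suc i), d i)" for i
    using Suc[of i] by (simp add: B_def d_def prod_eq_iff)
  have "d i \<in> mod_hom R (free_module R (B (Suc i))) (free_module R (B i))" for i
    using F(1)[of i] by (simp add: FE P_def)
  moreover have "d (Suc i) ` carrier (free_module R (B (Suc (Suc i)))) =
      a_kernel (free_module R (B (Suc i))) (free_module R (B i)) (d i)" for i
    using F(2)[of i] by (simp add: FE Q_def)
  ultimately have "free_resolution R N B d e"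
    using e d0 B0 by (simp add: free_resolution_def)
  then show ?thesis by blast
qed

end

theory Submission
  imports Defs
begin

text \<open>
  A module over the triangular ring is a triple \<open>\<phi> : Y \<rightarrow> X\<close>. Cutting a projective resolution of the
  triple with the two diagonal idempotents gives projective resolutions of \<open>X\<close> and \<open>Y\<close>, and the
  regular module is the sum of \<open>(A, 0)\<close> and \<open>(A, A)\<close>; hence the triple is semi-Gorenstein-projective
  iff \<open>X\<close> and \<open>Y\<close> are and \<open>\<phi>\<^sup>*\<close> is onto. The dual of the triple is the triple
  \<open>\<pi>\<^sup>* : (Coker \<phi>)\<^sup>* \<rightarrow> X\<^sup>*\<close> over the opposite ring, so the same criterion applies to it, and applying
  this description of the dual twice yields the bidual. If \<open>\<phi>\<^sup>*\<close> is onto then \<open>\<beta>\<close> is bijective and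
  \<open>0 \<rightarrow> (Coker \<phi>)\<^sup>* \<rightarrow> X\<^sup>* \<rightarrow> Y\<^sup>* \<rightarrow> 0\<close> is exact. In a short exact sequence whose first two terms are
  semi-Gorenstein-projective, the third is so iff every map from the first term to the ring extends
  to the second; this reduces (2) and (3) to statements about \<open>X\<close> and \<open>Y\<close>.
\<close>

section \<open>Homomorphisms of modules\<close>

text \<open>The definition of \<open>Ext\<close> evaluates one free resolution picked by
  \<open>SOME\<close>, with bases in a type that depends on the module.
  \<open>semi_Gorenstein_projective_iff\<close> removes the choice: vanishing can be read off any
  projective resolution, of any element type. From there on everything is done on cocycles
  (\<open>dual_acyclic\<close>), and long exact sequences appear as explicit corrections of
  cochains. Surjectivity of \<open>\<phi>\<^sup>*\<close> comes from the sequence 0 -> (A, 0) -> (A,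
  A) -> (0, A) -> 0. Maps from the triple M into (A, A) are maps X -> A, maps into (0, A) are
  functionals on Y when composed from the former, so Hom(M, (A, A)) -> Hom(M, (0, A)) is
  \<open>\<phi>\<^sup>*\<close>, and Ext^1(M, (A, 0)) = 0 forces it to be onto. Applied to the dual
  triple, the criterion produces a second surjectivity condition, on the dual of
  \<open>\<pi>\<^sup>*\<close>. It does not occur in (2) or (3): when \<open>\<phi>\<^sup>*\<close>
  is onto and the duals of X and of the cokernel are semi-Gorenstein-projective, it is equivalent to
  the dual of Y being so.\<close>

lemma (in abelian_group) minus_eq_zero_iff [simp]:
  assumes "x \<in> carrier G" "y \<in> carrier G"
  shows "x \<ominus> y = \<zero> \<longleftrightarrow> x = y"
  using assms by (metis a_inv_closed minus_eq minus_equality minus_minus r_neg)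

lemma (in left_module) smult_l_null [simp]:
  assumes "x \<in> carrier M"
  shows "\<zero> \<odot>\<^bsub>M\<^esub> x = \<zero>\<^bsub>M\<^esub>"
  using smult_l_distr[of "\<zero>" "\<zero>" x] assms
  by (metis R.l_zero R.zero_closed M.add.r_cancel_one' smult_closed)

lemma (in left_module) smult_r_null [simp]:
  assumes "a \<in> carrier R"
  shows "a \<odot>\<^bsub>M\<^esub> \<zero>\<^bsub>M\<^esub> = \<zero>\<^bsub>M\<^esub>"
  using smult_r_distr[of a "\<zero>\<^bsub>M\<^esub>" "\<zero>\<^bsub>M\<^esub>"] assms
  by (metis M.l_zero M.zero_closed M.add.r_cancel_one' smult_closed)

lemma (in left_module) smult_r_minus:
  assumes "a \<in> carrier R" "x \<in> carrier M"
  shows "a \<odot>\<^bsub>M\<^esub> (\<ominus>\<^bsub>M\<^esub> x) = \<ominus>\<^bsub>M\<^esub> (a \<odot>\<^bsub>M\<^esub> x)"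
proof -
  have "a \<odot>\<^bsub>M\<^esub> (\<ominus>\<^bsub>M\<^esub> x) \<oplus>\<^bsub>M\<^esub> a \<odot>\<^bsub>M\<^esub> x = \<zero>\<^bsub>M\<^esub>"
    using assms by (simp add: M.l_neg flip: smult_r_distr)
  then show ?thesis
    using assms by (simp add: M.minus_equality)
qed

lemma mod_homI:
  assumes "\<And>x. x \<in> carrier M \<Longrightarrow> f x \<in> carrier N"
    and "\<And>x y. x \<in> carrier M \<Longrightarrow> y \<in> carrier M \<Longrightarrow> f (x \<oplus>\<^bsub>M\<^esub> y) = f x \<oplus>\<^bsub>N\<^esub> f y"
    and "\<And>a x. a \<in> carrier R \<Longrightarrow> x \<in> carrier M \<Longrightarrow> f (a \<odot>\<^bsub>M\<^esub> x) = a \<odot>\<^bsub>N\<^esub> f x"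
  shows "f \<in> mod_hom R M N"
  using assms by (auto simp: mod_hom_def hom_def)

lemma mod_hom_cong:
  assumes "f \<in> mod_hom R M N" "left_module R M" "\<And>x. x \<in> carrier M \<Longrightarrow> g x = f x"
  shows "g \<in> mod_hom R M N"
proof -
  interpret M: left_module R M by fact
  show ?thesis using assms(3) by (intro mod_homI) (auto simp: mod_homD[OF assms(1)])
qed

lemma mod_hom_id: "(\<lambda>x. x) \<in> mod_hom R M M"
  by (intro mod_homI) auto

lemma mod_hom_comp:
  assumes "f \<in> mod_hom R M N" "g \<in> mod_hom R N P"
  shows "(\<lambda>x. g (f x)) \<in> mod_hom R M P"
  by (intro mod_homI) (auto simp: mod_homD[OF assms(1)] mod_homD[OF assms(2)])

lemma mod_hom_const_zero:
  assumes "left_module R N"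
  shows "(\<lambda>_. \<zero>\<^bsub>N\<^esub>) \<in> mod_hom R M N"
proof -
  interpret N: left_module R N by fact
  show ?thesis by (intro mod_homI) auto
qed

lemma mod_hom_add:
  assumes "left_module R N" "f \<in> mod_hom R M N" "g \<in> mod_hom R M N"
  shows "(\<lambda>x. f x \<oplus>\<^bsub>N\<^esub> g x) \<in> mod_hom R M N"
proof -
  interpret N: left_module R N by fact
  show ?thesis
    by (intro mod_homI)
       (auto simp: mod_homD[OF assms(2)] mod_homD[OF assms(3)] N.M.a_ac N.smult_r_distr)
qed

lemma mod_hom_minus:
  assumes "left_module R N" "f \<in> mod_hom R M N"
  shows "(\<lambda>x. \<ominus>\<^bsub>N\<^esub> f x) \<in> mod_hom R M N"
proof -
  interpret N: left_module R N by fact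
  show ?thesis
    by (intro mod_homI) (auto simp: mod_homD[OF assms(2)] N.smult_r_minus N.M.minus_add)
qed

lemma mod_hom_diff:
  assumes "left_module R N" "f \<in> mod_hom R M N" "g \<in> mod_hom R M N"
  shows "(\<lambda>x. f x \<ominus>\<^bsub>N\<^esub> g x) \<in> mod_hom R M N"
  unfolding a_minus_def by (intro mod_hom_add mod_hom_minus assms)

lemma mod_hom_zero:
  assumes "left_module R M" "left_module R N" "f \<in> mod_hom R M N"
  shows "f \<zero>\<^bsub>M\<^esub> = \<zero>\<^bsub>N\<^esub>"
proof -
  interpret M: left_module R M by fact
  interpret N: left_module R N by fact
  show ?thesis using mod_homD(3)[OF assms(3) M.M.zero_closed M.R.zero_closed] mod_homD(1)[OF assms(3)]
    by simp
qed

lemma mod_hom_a_inv: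
  assumes "left_module R M" "left_module R N" "f \<in> mod_hom R M N" "x \<in> carrier M"
  shows "f (\<ominus>\<^bsub>M\<^esub> x) = \<ominus>\<^bsub>N\<^esub> f x"
proof -
  interpret M: left_module R M by fact
  interpret N: left_module R N by fact
  have "f (\<ominus>\<^bsub>M\<^esub> x) \<oplus>\<^bsub>N\<^esub> f x = \<zero>\<^bsub>N\<^esub>"
    using assms(4) mod_homD(2)[OF assms(3), of "\<ominus>\<^bsub>M\<^esub> x" x] mod_hom_zero[OF assms(1-3)]
    by (simp add: M.M.l_neg)
  then show ?thesis
    using assms(4) by (simp add: N.M.minus_equality mod_homD[OF assms(3)])
qed

lemma mod_hom_a_minus:
  assumes "left_module R M" "left_module R N" "f \<in> mod_hom R M N" "x \<in> carrier M" "y \<in> carrier M"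
  shows "f (x \<ominus>\<^bsub>M\<^esub> y) = f x \<ominus>\<^bsub>N\<^esub> f y"
proof -
  interpret M: left_module R M by fact
  show ?thesis
    using assms(4,5) by (simp add: a_minus_def mod_homD[OF assms(3)] mod_hom_a_inv[OF assms(1-3)])
qed

text \<open>The factor theorem, stated for an arbitrary epimorphism \<open>q\<close> and not for
  cosets, so that it serves augmentations of resolutions, cokernel projections and
  \<open>\<beta>\<close> alike.\<close>

lemma mod_hom_factor_surj:
  assumes "left_module R E" "left_module R N" "left_module R L"
    and q: "q \<in> mod_hom R E N" "q ` carrier E = carrier N"
    and k: "k \<in> mod_hom R E L" "\<And>x. x \<in> carrier E \<Longrightarrow> q x = \<zero>\<^bsub>N\<^esub> \<Longrightarrow> k x = \<zero>\<^bsub>L\<^esub>"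
  obtains t where "t \<in> mod_hom R N L" "\<And>x. x \<in> carrier E \<Longrightarrow> t (q x) = k x"
proof -
  interpret E: left_module R E by fact
  interpret N: left_module R N by fact
  interpret L: left_module R L by fact
  \<comment> \<open>Any preimage will do: two preimages under \<open>q\<close> differ by an element
    of its kernel, on which \<open>k\<close> vanishes.\<close>
  define t where "t n = k (inv_into (carrier E) q n)" for n
  have t: "t (q x) = k x" if "x \<in> carrier E" for x
  proof -
    define y where "y = inv_into (carrier E) q (q x)"
    have y: "y \<in> carrier E" "q y = q x"
      unfolding y_def using that by (auto intro: inv_into_into f_inv_into_f)
    then have "k (y \<ominus>\<^bsub>E\<^esub> x) = \<zero>\<^bsub>L\<^esub>"
      using that mod_homD(1)[OF q(1) that]
      by (intro k(2)) (simp_all add: mod_hom_a_minus[OF assms(1,2) q(1)])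
    then show ?thesis using y(1) that
      by (simp add: t_def y_def[symmetric] mod_hom_a_minus[OF assms(1,3) k(1)] mod_homD(1)[OF k(1)])
  qed
  have N: "\<exists>x\<in>carrier E. n = q x" if "n \<in> carrier N" for n using that q(2) by auto
  have "t \<in> mod_hom R N L"
  proof (rule mod_homI)
    fix n m assume "n \<in> carrier N" "m \<in> carrier N"
    then obtain x y where "x \<in> carrier E" "n = q x" "y \<in> carrier E" "m = q y" using N by meson
    then show "t (n \<oplus>\<^bsub>N\<^esub> m) = t n \<oplus>\<^bsub>L\<^esub> t m"
      using t[of "x \<oplus>\<^bsub>E\<^esub> y"] by (simp add: t mod_homD[OF q(1)] mod_homD[OF k(1)])
  next
    fix a n assume "a \<in> carrier R" "n \<in> carrier N"
    moreover then obtain x where "x \<in> carrier E" "n = q x" using N by meson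
    ultimately show "t (a \<odot>\<^bsub>N\<^esub> n) = a \<odot>\<^bsub>L\<^esub> t n"
      using t[of "a \<odot>\<^bsub>E\<^esub> x"] by (simp add: t mod_homD[OF q(1)] mod_homD[OF k(1)])
  next
    fix n assume "n \<in> carrier N"
    then obtain x where "x \<in> carrier E" "n = q x" using N by meson
    then show "t n \<in> carrier L" by (simp add: t mod_homD[OF k(1)])
  qed
  with t show thesis by (intro that)
qed

section \<open>Projective modules\<close>

definition unit_vector :: "('a, 'r) ring_scheme \<Rightarrow> 'i set \<Rightarrow> 'i \<Rightarrow> 'i \<Rightarrow> 'a"
  where "unit_vector R B b = (\<lambda>c\<in>B. if c = b then \<one>\<^bsub>R\<^esub> else \<zero>\<^bsub>R\<^esub>)"

lemma unit_vector_closed: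
  assumes "ring R" "b \<in> B"
  shows "unit_vector R B b \<in> carrier (free_module R B)"
proof -
  interpret ring R by fact
  have "finite {c \<in> B. unit_vector R B b c \<noteq> \<zero>\<^bsub>R\<^esub>}"
    by (rule finite_subset[of _ "{b}"]) (auto simp: unit_vector_def)
  then show ?thesis by (auto simp: free_module_def unit_vector_def)
qed

text \<open>Vectors have finite support, hence are finite combinations of unit vectors.\<close>

lemma free_module_hom_eqI:
  assumes "ring R" "left_module R N"
    and f: "f \<in> mod_hom R (free_module R B) N" and g: "g \<in> mod_hom R (free_module R B) N"
    and eq: "\<And>b. b \<in> B \<Longrightarrow> f (unit_vector R B b) = g (unit_vector R B b)"
    and v: "v \<in> carrier (free_module R B)"
  shows "f v = g v"
proof -
  interpret N: left_module R N by fact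
  let ?F = "free_module R B"
  note F = left_module_free_module[OF assms(1), of B]
  interpret F: left_module R ?F by (rule F)
  \<comment> \<open>The induction runs over a finite set containing the support. Its step splits off
    one coordinate: \<open>v\<close> is \<open>?w\<close>, which is zero at \<open>b\<close>, plus
    the multiple \<open>?u\<close> of a unit vector.\<close>
  have "f v = g v" if "finite S" "v \<in> carrier ?F" "{b \<in> B. v b \<noteq> \<zero>\<^bsub>R\<^esub>} \<subseteq> S" "S \<subseteq> B" for S v
    using that
  proof (induction S arbitrary: v rule: finite_induct)
    case empty
    then have "v = \<zero>\<^bsub>?F\<^esub>"
      by (intro extensionalityI[where A = B]) (auto simp: free_module_def PiE_def)
    then show ?case using mod_hom_zero[OF F assms(2) f] mod_hom_zero[OF F assms(2) g] by simp
  next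
    case (insert b S)
    let ?w = "\<lambda>c\<in>B. if c = b then \<zero>\<^bsub>R\<^esub> else v c"
    let ?u = "v b \<odot>\<^bsub>?F\<^esub> unit_vector R B b"
    have "finite {c \<in> B. ?w c \<noteq> \<zero>\<^bsub>R\<^esub>}"
      by (rule finite_subset[of _ "{c \<in> B. v c \<noteq> \<zero>\<^bsub>R\<^esub>}"])
         (use insert.prems in \<open>auto simp: free_module_def\<close>)
    then have w: "?w \<in> carrier ?F"
      using insert.prems by (auto simp: free_module_def simp del: restrict_apply)
    have vb: "v b \<in> carrier R" using insert.prems by (auto simp: free_module_def)
    have b: "unit_vector R B b \<in> carrier ?F" using insert.prems assms(1) by (intro unit_vector_closed) auto
    have fw: "f ?w = g ?w" by (rule insert.IH[OF w]) (use insert.prems in auto)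
    have v: "v = ?w \<oplus>\<^bsub>?F\<^esub> ?u"
      using insert.prems vb
      by (intro extensionalityI[where A = B]) (auto simp: free_module_def PiE_iff unit_vector_def)
    have expand: "h v = h ?w \<oplus>\<^bsub>N\<^esub> v b \<odot>\<^bsub>N\<^esub> h (unit_vector R B b)" if "h \<in> mod_hom R ?F N" for h
      using mod_homD(2)[OF that w F.smult_closed[OF vb b]] mod_homD(3)[OF that b vb] v by simp
    show ?case
      using expand[OF f] expand[OF g] fw eq[of b] insert.prems by simp
  qed
  from this[of "{b \<in> B. v b \<noteq> \<zero>\<^bsub>R\<^esub>}"] v show ?thesis by (auto simp: free_module_def)
qed

lemma free_module_extend:
  assumes "left_module R M" and u: "\<And>b. b \<in> B \<Longrightarrow> u b \<in> carrier M"
  obtains f where "f \<in> mod_hom R (free_module R B) M"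
    "\<And>b. b \<in> B \<Longrightarrow> f (unit_vector R B b) = u b"
proof -
  interpret M: left_module R M by fact
  define F where "F = free_module R B"
  interpret F: left_module R F
    unfolding F_def by (rule left_module_free_module) unfold_locales
  define supp where "supp v = {b \<in> B. v b \<noteq> \<zero>\<^bsub>R\<^esub>}" for v
  define f where "f v = (\<Oplus>\<^bsub>M\<^esub>b\<in>supp v. v b \<odot>\<^bsub>M\<^esub> u b)" for v
  have F: "v b \<in> carrier R" "finite (supp v)" if "v \<in> carrier F" "b \<in> B" for v b
    using that by (auto simp: F_def free_module_def supp_def)
  have fin: "finite (supp v)" if "v \<in> carrier F" for v
    using that by (auto simp: F_def free_module_def supp_def)
  have sub: "supp v \<subseteq> B" for v by (auto simp: supp_def)
  \<comment> \<open>Summation over any finite set containing the support gives the same value; this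
    lets two vectors be summed over a common index set.\<close>
  have f_eq: "f v = (\<Oplus>\<^bsub>M\<^esub>b\<in>S. v b \<odot>\<^bsub>M\<^esub> u b)"
    if "v \<in> carrier F" "finite S" "S \<subseteq> B" "supp v \<subseteq> S" for v S
    unfolding f_def
  proof (rule M.M.add.finprod_mono_neutral_cong_left)
    show "finite S" "supp v \<subseteq> S" by (fact that)+
    show "(\<lambda>b. v b \<odot>\<^bsub>M\<^esub> u b) \<in> S \<rightarrow> carrier M"
      using that u F(1) by (auto simp: subset_iff)
    show "v b \<odot>\<^bsub>M\<^esub> u b = \<zero>\<^bsub>M\<^esub>" if "b \<in> S - supp v" for b
    proof -
      have "v b = \<zero>\<^bsub>R\<^esub>" "b \<in> B" using that \<open>S \<subseteq> B\<close> by (auto simp: supp_def)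
      then show ?thesis using u by simp
    qed
  qed simp
  have "f \<in> mod_hom R F M"
  proof (rule mod_homI)
    fix v assume "v \<in> carrier F"
    then show "f v \<in> carrier M"
      unfolding f_def using u F sub by (intro M.M.finsum_closed) (auto dest: subsetD[OF sub])
  next
    fix v w assume v: "v \<in> carrier F" and w: "w \<in> carrier F"
    define S where "S = supp v \<union> supp w"
    have S: "finite S" "S \<subseteq> B" "supp v \<subseteq> S" "supp w \<subseteq> S"
      using fin v w sub by (auto simp: S_def)
    have vw: "(v \<oplus>\<^bsub>F\<^esub> w) b = v b \<oplus>\<^bsub>R\<^esub> w b" if "b \<in> B" for b
      using that by (simp add: F_def free_module_def)
    have supp: "supp (v \<oplus>\<^bsub>F\<^esub> w) \<subseteq> S" by (auto simp: supp_def S_def vw)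
    have "f (v \<oplus>\<^bsub>F\<^esub> w) = (\<Oplus>\<^bsub>M\<^esub>b\<in>S. v b \<odot>\<^bsub>M\<^esub> u b \<oplus>\<^bsub>M\<^esub> w b \<odot>\<^bsub>M\<^esub> u b)"
      unfolding f_eq[OF F.M.a_closed[OF v w] S(1,2) supp]
      by (rule M.M.add.finprod_cong') (use S(2) u F v w in \<open>auto simp: vw M.smult_l_distr subset_iff\<close>)
    also have "\<dots> = f v \<oplus>\<^bsub>M\<^esub> f w"
      unfolding f_eq[OF v S(1-3)] f_eq[OF w S(1,2,4)]
      by (rule M.M.finsum_addf) (use S(2) u F v w in auto)
    finally show "f (v \<oplus>\<^bsub>F\<^esub> w) = f v \<oplus>\<^bsub>M\<^esub> f w" .
  next
    fix a v assume a: "a \<in> carrier R" and v: "v \<in> carrier F"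
    have av: "(a \<odot>\<^bsub>F\<^esub> v) b = a \<otimes>\<^bsub>R\<^esub> v b" if "b \<in> B" for b
      using that by (simp add: F_def free_module_def)
    have "(\<Oplus>\<^bsub>M\<^esub>b\<in>S. (a \<odot>\<^bsub>F\<^esub> v) b \<odot>\<^bsub>M\<^esub> u b) = a \<odot>\<^bsub>M\<^esub> (\<Oplus>\<^bsub>M\<^esub>b\<in>S. v b \<odot>\<^bsub>M\<^esub> u b)"
      if "finite S" "S \<subseteq> B" for S
      using that
    proof (induction S rule: finite_induct)
      case empty then show ?case using a by simp
    next
      case (insert b S)
      then have "(\<lambda>b. v b \<odot>\<^bsub>M\<^esub> u b) \<in> S \<rightarrow> carrier M" "(\<lambda>b. (a \<odot>\<^bsub>F\<^esub> v) b \<odot>\<^bsub>M\<^esub> u b) \<in> S \<rightarrow> carrier M"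
        using a v u F by (auto simp: av subset_iff)
      with insert a v show ?case
        by (simp add: av u F M.smult_r_distr M.smult_assoc1 M.M.finsum_closed)
    qed
    moreover have "supp (a \<odot>\<^bsub>F\<^esub> v) \<subseteq> supp v" using a by (auto simp: supp_def av)
    ultimately show "f (a \<odot>\<^bsub>F\<^esub> v) = a \<odot>\<^bsub>M\<^esub> f v"
      using a v fin sub by (simp add: f_eq[of _ "supp v"])
  qed
  moreover have "f (unit_vector R B b) = u b" if "b \<in> B" for b
  proof -
    have "f (unit_vector R B b) = (\<Oplus>\<^bsub>M\<^esub>c\<in>{b}. unit_vector R B b c \<odot>\<^bsub>M\<^esub> u c)"
      using that unit_vector_closed[of R b B] M.R.ring_axioms
      by (intro f_eq) (auto simp: F_def supp_def unit_vector_def)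
    then show ?thesis using u that by (simp add: unit_vector_def)
  qed
  ultimately show thesis using that unfolding F_def by blast
qed

text \<open>Lift the images of the basis one by one and extend linearly. Asking for containment of
  images, and not for surjectivity of \<open>h\<close>, lets exactness of a complex be used
  directly, with no kernel module as target.\<close>

lemma free_module_lift:
  assumes "left_module R E" "left_module R E'"
    and h: "h \<in> mod_hom R E E'" and k: "k \<in> mod_hom R (free_module R B) E'"
    and sub: "k ` carrier (free_module R B) \<subseteq> h ` carrier E"
  obtains l where "l \<in> mod_hom R (free_module R B) E"
    "\<And>x. x \<in> carrier (free_module R B) \<Longrightarrow> h (l x) = k x"
proof -
  interpret E: left_module R E by fact
  have R: "ring R" by unfold_locales
  have "\<forall>b\<in>B. \<exists>y\<in>carrier E. h y = k (unit_vector R B b)"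
    using sub unit_vector_closed[OF R] by (metis image_subset_iff image_iff)
  then obtain u where u: "\<And>b. b \<in> B \<Longrightarrow> u b \<in> carrier E \<and> h (u b) = k (unit_vector R B b)" by metis
  then obtain l where l: "l \<in> mod_hom R (free_module R B) E" "\<And>b. b \<in> B \<Longrightarrow> l (unit_vector R B b) = u b"
    using free_module_extend[OF assms(1), of B u] by metis
  have "h (l x) = k x" if "x \<in> carrier (free_module R B)" for x
    by (rule free_module_hom_eqI[OF R assms(2) mod_hom_comp[OF l(1) h] k _ that]) (simp add: u l(2))
  with l(1) show thesis by (rule that)
qed

text \<open>
  The lifting property quantifies over modules of all types. Being a retract of a free module whose
  basis has the type of the module itself is equivalent to it and can be stated in the logic.
\<close>

definition projective :: "('a, 'r) ring_scheme \<Rightarrow> ('a, 'p, 'm) module_scheme \<Rightarrow> bool"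
  where "projective R P \<longleftrightarrow> (\<exists>(B :: 'p set) g s. g \<in> mod_hom R (free_module R B) P \<and>
    s \<in> mod_hom R P (free_module R B) \<and> (\<forall>x\<in>carrier P. g (s x) = x))"

text \<open>The carrier of \<open>P\<close> embeds in its own type, so a free cover with basis in
  that type exists; a splitting of this cover is the required retraction.\<close>

lemma projectiveI:
  fixes P :: "('a, 'p, 'm) module_scheme"
  assumes "left_module R P"
    and "\<And>(B :: 'p set) g. g \<in> mod_hom R (free_module R B) P \<Longrightarrow> g ` carrier (free_module R B) = carrier P \<Longrightarrow>
      \<exists>s \<in> mod_hom R P (free_module R B). \<forall>x\<in>carrier P. g (s x) = x"
  shows "projective R P"
proof -
  obtain B :: "'p set" and g where "g \<in> mod_hom R (free_module R B) P" "g ` carrier (free_module R B) = carrier P"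
    using free_cover[OF assms(1) subset_imp_lepoll[OF subset_UNIV]] by metis
  with assms(2) show ?thesis unfolding projective_def by blast
qed

text \<open>\<open>k\<close> after \<open>g\<close> lifts on the free module, and the section
  \<open>s\<close> carries the lift back to \<open>P\<close>. The types of \<open>E\<close> and
  \<open>E'\<close> are arbitrary: this recovers the lifting property over all types from the
  definition by retracts.\<close>

lemma projective_lift:
  fixes P :: "('a, 'p, 'm) module_scheme"
  assumes "left_module R E" "left_module R E'" "left_module R P" "projective R P"
    and h: "h \<in> mod_hom R E E'" and k: "k \<in> mod_hom R P E'"
    and sub: "k ` carrier P \<subseteq> h ` carrier E"
  obtains l where "l \<in> mod_hom R P E" "\<And>x. x \<in> carrier P \<Longrightarrow> h (l x) = k x"
proof -
  obtain B :: "'p set" and g s where g: "g \<in> mod_hom R (free_module R B) P" and s: "s \<in> mod_hom R P (free_module R B)"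
    and gs: "\<And>x. x \<in> carrier P \<Longrightarrow> g (s x) = x"
    using assms(4) unfolding projective_def by blast
  obtain l where l: "l \<in> mod_hom R (free_module R B) E"
    "\<And>x. x \<in> carrier (free_module R B) \<Longrightarrow> h (l x) = k (g x)"
    using free_module_lift[OF assms(1,2) h mod_hom_comp[OF g k]] sub mod_homD(1)[OF g] by blast
  show thesis
    by (rule that[OF mod_hom_comp[OF s l(1)]]) (simp add: l(2) mod_homD[OF s] gs)
qed

lemma projective_free_module:
  assumes "ring R"
  shows "projective R (free_module R B)"
proof (rule projectiveI)
  fix B' g assume g: "g \<in> mod_hom R (free_module R B') (free_module R B)"
    "g ` carrier (free_module R B') = carrier (free_module R B)"
  show "\<exists>s \<in> mod_hom R (free_module R B) (free_module R B'). \<forall>x\<in>carrier (free_module R B). g (s x) = x"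
    by (rule free_module_lift[OF left_module_free_module[OF assms] left_module_free_module[OF assms] g(1) mod_hom_id])
       (use g(2) in auto)
qed (rule left_module_free_module[OF assms])

definition direct_sum :: "('a, 'b, 'm) module_scheme \<Rightarrow> ('a, 'c, 'n) module_scheme \<Rightarrow> ('a, 'b \<times> 'c) module"
  where "direct_sum M N = \<lparr>carrier = carrier M \<times> carrier N, monoid.mult = undefined, one = undefined,
    zero = (\<zero>\<^bsub>M\<^esub>, \<zero>\<^bsub>N\<^esub>), add = (\<lambda>(x, y) (x', y'). (x \<oplus>\<^bsub>M\<^esub> x', y \<oplus>\<^bsub>N\<^esub> y')),
    smult = (\<lambda>a (x, y). (a \<odot>\<^bsub>M\<^esub> x, a \<odot>\<^bsub>N\<^esub> y))\<rparr>"

lemma left_module_direct_sum: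
  assumes "left_module R M" "left_module R N"
  shows "left_module R (direct_sum M N)"
proof -
  interpret M: left_module R M by fact
  interpret N: left_module R N by fact
  show ?thesis
  proof (intro left_module.intro left_module_axioms.intro)
    show "abelian_group (direct_sum M N)"
    proof (rule abelian_groupI)
      fix x assume "x \<in> carrier (direct_sum M N)"
      then show "\<exists>y\<in>carrier (direct_sum M N). y \<oplus>\<^bsub>direct_sum M N\<^esub> x = \<zero>\<^bsub>direct_sum M N\<^esub>"
        by (intro bexI[of _ "(\<ominus>\<^bsub>M\<^esub> fst x, \<ominus>\<^bsub>N\<^esub> snd x)"]) (auto simp: direct_sum_def M.M.l_neg N.M.l_neg)
    qed (auto simp: direct_sum_def M.M.a_ac N.M.a_ac)
  qed (auto simp: direct_sum_def M.R.ring_axioms M.smult_l_distr M.smult_r_distr N.smult_l_distr N.smult_r_distr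
        M.smult_assoc1 N.smult_assoc1)
qed

lemma direct_sum_carrier [simp]: "carrier (direct_sum M N) = carrier M \<times> carrier N"
  by (simp add: direct_sum_def)

lemma direct_sum_injections:
  assumes "left_module R M" "left_module R N"
  shows "(\<lambda>x. (x, \<zero>\<^bsub>N\<^esub>)) \<in> mod_hom R M (direct_sum M N)" "(\<lambda>y. (\<zero>\<^bsub>M\<^esub>, y)) \<in> mod_hom R N (direct_sum M N)"
proof -
  interpret M: left_module R M by fact
  interpret N: left_module R N by fact
  show "(\<lambda>x. (x, \<zero>\<^bsub>N\<^esub>)) \<in> mod_hom R M (direct_sum M N)" "(\<lambda>y. (\<zero>\<^bsub>M\<^esub>, y)) \<in> mod_hom R N (direct_sum M N)"
    by (auto intro!: mod_homI simp: direct_sum_def)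
qed

lemma direct_sum_projections:
  "fst \<in> mod_hom R (direct_sum M N) M" "snd \<in> mod_hom R (direct_sum M N) N"
  by (auto intro!: mod_homI simp: direct_sum_def)

lemma mod_hom_direct_sum_out:
  assumes "left_module R L" "f \<in> mod_hom R M L" "g \<in> mod_hom R N L"
  shows "(\<lambda>x. f (fst x) \<oplus>\<^bsub>L\<^esub> g (snd x)) \<in> mod_hom R (direct_sum M N) L"
  by (intro mod_hom_add assms mod_hom_comp[OF direct_sum_projections(1)] mod_hom_comp[OF direct_sum_projections(2)])

lemma mod_hom_direct_sum_in:
  assumes "f \<in> mod_hom R L M" "g \<in> mod_hom R L N"
  shows "(\<lambda>x. (f x, g x)) \<in> mod_hom R L (direct_sum M N)"
  by (auto intro!: mod_homI simp: direct_sum_def mod_homD[OF assms(1)] mod_homD[OF assms(2)])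

text \<open>Both injections into the sum lift along the cover \<open>g\<close>; the section is the
  sum of the two lifts.\<close>

lemma projective_direct_sum:
  fixes M :: "('a, 'b, 'm) module_scheme" and N :: "('a, 'c, 'n) module_scheme"
  assumes "left_module R M" "left_module R N" "projective R M" "projective R N"
  shows "projective R (direct_sum M N)"
proof (rule projectiveI)
  let ?S = "direct_sum M N"
  show S: "left_module R ?S" by (rule left_module_direct_sum[OF assms(1,2)])
  interpret M: left_module R M by fact
  interpret N: left_module R N by fact
  fix B :: "('b \<times> 'c) set" and g
  assume g: "g \<in> mod_hom R (free_module R B) ?S" "g ` carrier (free_module R B) = carrier ?S"
  have R: "ring R" by unfold_locales
  note F = left_module_free_module[OF R, of B]
  note i = direct_sum_injections[OF assms(1,2)]
  obtain s where s: "s \<in> mod_hom R M (free_module R B)" "\<And>x. x \<in> carrier M \<Longrightarrow> g (s x) = (x, \<zero>\<^bsub>N\<^esub>)"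
    by (rule projective_lift[OF F S assms(1,3) g(1) i(1)]) (use g(2) in auto)
  obtain t where t: "t \<in> mod_hom R N (free_module R B)" "\<And>x. x \<in> carrier N \<Longrightarrow> g (t x) = (\<zero>\<^bsub>M\<^esub>, x)"
    by (rule projective_lift[OF F S assms(2,4) g(1) i(2)]) (use g(2) in auto)
  let ?s = "\<lambda>x. s (fst x) \<oplus>\<^bsub>free_module R B\<^esub> t (snd x)"
  have "g (?s x) = x" if "x \<in> carrier ?S" for x
  proof -
    have "fst x \<in> carrier M" "snd x \<in> carrier N" using that by auto
    then have "g (?s x) = (fst x, \<zero>\<^bsub>N\<^esub>) \<oplus>\<^bsub>?S\<^esub> (\<zero>\<^bsub>M\<^esub>, snd x)"
      by (simp add: mod_homD[OF g(1)] mod_homD[OF s(1)] mod_homD[OF t(1)] s(2) t(2) del: direct_sum_carrier)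
    also have "\<dots> = x" using that by (auto simp: direct_sum_def)
    finally show ?thesis .
  qed
  then show "\<exists>s \<in> mod_hom R ?S (free_module R B). \<forall>x\<in>carrier ?S. g (s x) = x"
    by (intro bexI[OF _ mod_hom_direct_sum_out[OF F s(1) t(1)]] ballI)
qed

section \<open>Projective resolutions\<close>

text \<open>The terms are projective and not necessarily free because idempotent parts and mapping
  cones of free resolutions are not of the form \<open>free_module\<close>. All terms share one
  element type so that the complex is a function of the degree.\<close>

locale projective_resolution =
  fixes R :: "('a, 'r) ring_scheme" and N :: "('a, 'b, 'm) module_scheme"
    and P :: "nat \<Rightarrow> ('a, 'p, 'l) module_scheme" and d :: "nat \<Rightarrow> 'p \<Rightarrow> 'p" and e :: "'p \<Rightarrow> 'b"
  assumes left_module: "left_module R N"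
    and left_modules: "left_module R (P i)"
    and projective: "projective R (P i)"
    and augmentation: "e \<in> mod_hom R (P 0) N" and surj: "e ` carrier (P 0) = carrier N"
    and differential: "d i \<in> mod_hom R (P (Suc i)) (P i)"
    and exact_0: "d 0 ` carrier (P (Suc 0)) = {x \<in> carrier (P 0). e x = \<zero>\<^bsub>N\<^esub>}"
    and exact_Suc: "d (Suc i) ` carrier (P (Suc (Suc i))) =
      {x \<in> carrier (P (Suc i)). d i x = \<zero>\<^bsub>P i\<^esub>}"
begin

lemma augmentation_differential: "x \<in> carrier (P (Suc 0)) \<Longrightarrow> e (d 0 x) = \<zero>\<^bsub>N\<^esub>"
  using exact_0 by blast

lemma differential_differential: "x \<in> carrier (P (Suc (Suc i))) \<Longrightarrow> d i (d (Suc i) x) = \<zero>\<^bsub>P i\<^esub>"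
  using exact_Suc by blast

lemmas closed = mod_homD(1)[OF augmentation] mod_homD(1)[OF differential]

end

text \<open>Exactness of the complex Hom(P, R) in all positive degrees. Cochains range over
  \<open>mod_hom\<close>, whose members are unconstrained outside the carrier, so that composites
  are again cochains without being cut off.\<close>

definition dual_acyclic ::
    "('a, 'r) ring_scheme \<Rightarrow> (nat \<Rightarrow> ('a, 'p, 'l) module_scheme) \<Rightarrow> (nat \<Rightarrow> 'p \<Rightarrow> 'p) \<Rightarrow> bool"
  where "dual_acyclic R P d \<longleftrightarrow> (\<forall>i. \<forall>c \<in> mod_hom R (P (Suc i)) (regular R).
    (\<forall>x \<in> carrier (P (Suc (Suc i))). c (d (Suc i) x) = \<zero>\<^bsub>R\<^esub>) \<longrightarrow>
    (\<exists>b \<in> mod_hom R (P i) (regular R). \<forall>x \<in> carrier (P (Suc i)). c x = b (d i x)))"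

lemma dual_acyclicI:
  assumes "\<And>i c. c \<in> mod_hom R (P (Suc i)) (regular R) \<Longrightarrow>
      (\<And>x. x \<in> carrier (P (Suc (Suc i))) \<Longrightarrow> c (d (Suc i) x) = \<zero>\<^bsub>R\<^esub>) \<Longrightarrow>
      \<exists>b \<in> mod_hom R (P i) (regular R). \<forall>x \<in> carrier (P (Suc i)). c x = b (d i x)"
  shows "dual_acyclic R P d"
  using assms unfolding dual_acyclic_def by blast

lemma dual_acyclicE:
  assumes "dual_acyclic R P d" "c \<in> mod_hom R (P (Suc i)) (regular R)"
    and "\<And>x. x \<in> carrier (P (Suc (Suc i))) \<Longrightarrow> c (d (Suc i) x) = \<zero>\<^bsub>R\<^esub>"
  obtains b where "b \<in> mod_hom R (P i) (regular R)" "\<And>x. x \<in> carrier (P (Suc i)) \<Longrightarrow> c x = b (d i x)"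
  using assms unfolding dual_acyclic_def by blast

section \<open>Comparison maps, homotopies and independence of the resolution\<close>

lemma comparison_exists:
  assumes "projective_resolution R N P d e" "projective_resolution R N' P' d' e'" "f \<in> mod_hom R N N'"
  obtains F where "\<And>i. F i \<in> mod_hom R (P i) (P' i)"
    and "\<And>x. x \<in> carrier (P 0) \<Longrightarrow> e' (F 0 x) = f (e x)"
    and "\<And>i x. x \<in> carrier (P (Suc i)) \<Longrightarrow> d' i (F (Suc i) x) = F i (d i x)"
proof -
  interpret P: projective_resolution R N P d e by fact
  interpret P': projective_resolution R N' P' d' e' by fact
  \<comment> \<open>Each stage records that \<open>F\<close> after \<open>d i\<close> lands in the
    image of \<open>d' i\<close>: this is what lets the next component be lifted.\<close>
  define A where "A i F \<longleftrightarrow> F \<in> mod_hom R (P i) (P' i) \<and>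
    (\<forall>x \<in> carrier (P (Suc i)). F (d i x) \<in> d' i ` carrier (P' (Suc i))) \<and>
    (i = 0 \<longrightarrow> (\<forall>x \<in> carrier (P 0). e' (F x) = f (e x)))" for i F
  define C where "C i F G \<longleftrightarrow> (\<forall>x \<in> carrier (P (Suc i)). d' i (G x) = F (d i x))" for i F G
  have "\<exists>F. \<forall>i. A i (F i) \<and> C i (F i) (F (Suc i))"
  proof (rule dependent_nat_choice)
    obtain F where F: "F \<in> mod_hom R (P 0) (P' 0)" "\<And>x. x \<in> carrier (P 0) \<Longrightarrow> e' (F x) = f (e x)"
      by (rule projective_lift[OF P'.left_modules P'.left_module P.left_modules P.projective P'.augmentation
            mod_hom_comp[OF P.augmentation assms(3)]])
         (use P'.surj P.closed mod_homD(1)[OF assms(3)] in auto)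
    moreover have "F (d 0 x) \<in> d' 0 ` carrier (P' (Suc 0))" if "x \<in> carrier (P (Suc 0))" for x
      using that mod_homD(1)[OF F(1)] P.closed
      by (simp add: P'.exact_0 F(2) P.augmentation_differential
          mod_hom_zero[OF P.left_module P'.left_module assms(3)])
    ultimately have "A 0 F" by (simp add: A_def)
    then show "\<exists>F. A 0 F" by (intro exI[of _ F])
  next
    fix F i assume "A i F"
    then have F: "F \<in> mod_hom R (P i) (P' i)"
      and im: "\<forall>x \<in> carrier (P (Suc i)). F (d i x) \<in> d' i ` carrier (P' (Suc i))" by (auto simp: A_def)
    obtain G where G: "G \<in> mod_hom R (P (Suc i)) (P' (Suc i))"
        "\<And>x. x \<in> carrier (P (Suc i)) \<Longrightarrow> d' i (G x) = F (d i x)"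
      by (rule projective_lift[OF P'.left_modules P'.left_modules P.left_modules P.projective P'.differential
            mod_hom_comp[OF P.differential F]])
         (use im in auto)
    have "G (d (Suc i) x) \<in> d' (Suc i) ` carrier (P' (Suc (Suc i)))"
      if "x \<in> carrier (P (Suc (Suc i)))" for x
      using that mod_homD(1)[OF G(1)] P.closed
      by (simp add: P'.exact_Suc G(2) P.differential_differential
          mod_hom_zero[OF P.left_modules P'.left_modules F])
    then have "A (Suc i) G \<and> C i F G" using G by (simp add: A_def C_def)
    then show "\<exists>G. A (Suc i) G \<and> C i F G" by (intro exI[of _ G])
  qed
  then obtain F where F: "\<And>i. A i (F i)" "\<And>i. C i (F i) (F (Suc i))" by blast
  show thesis
    by (rule that[of F]) (use F in \<open>simp_all add: A_def C_def\<close>)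
qed

lemma (in abelian_group) minus_add_minus_cancel:
  assumes "x \<in> carrier G" "y \<in> carrier G"
  shows "x \<ominus> (y \<oplus> (x \<ominus> y)) = \<zero>" "x = y \<oplus> (x \<ominus> y)"
proof -
  show "x = y \<oplus> (x \<ominus> y)"
    using assms by (metis minus_closed a_comm a_assoc l_neg minus_eq r_zero a_inv_closed)
  then show "x \<ominus> (y \<oplus> (x \<ominus> y)) = \<zero>"
    using assms by (metis minus_eq r_neg)
qed

text \<open>Once corrected by the previous component of the homotopy, the difference of two chain
  maps that agree after augmentation is a cycle in each degree, hence a boundary. The formula is
  given in the positive degrees, where \<open>dual_acyclic\<close> is tested.\<close>

lemma chain_homotopy_exists:
  assumes "projective_resolution R N P d e" "projective_resolution R N' P' d' e'"
    and F: "\<And>i. F i \<in> mod_hom R (P i) (P' i)"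
      "\<And>i x. x \<in> carrier (P (Suc i)) \<Longrightarrow> d' i (F (Suc i) x) = F i (d i x)"
    and G: "\<And>i. G i \<in> mod_hom R (P i) (P' i)"
      "\<And>i x. x \<in> carrier (P (Suc i)) \<Longrightarrow> d' i (G (Suc i) x) = G i (d i x)"
    and eq: "\<And>x. x \<in> carrier (P 0) \<Longrightarrow> e' (F 0 x) = e' (G 0 x)"
  obtains s where "\<And>i. s i \<in> mod_hom R (P i) (P' (Suc i))"
    and "\<And>i x. x \<in> carrier (P (Suc i)) \<Longrightarrow>
      F (Suc i) x = (G (Suc i) x \<oplus>\<^bsub>P' (Suc i)\<^esub> s i (d i x)) \<oplus>\<^bsub>P' (Suc i)\<^esub> d' (Suc i) (s (Suc i) x)"
proof -
  interpret P: projective_resolution R N P d e by fact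
  interpret P': projective_resolution R N' P' d' e' by fact
  note cl = mod_homD(1)[OF F(1)] mod_homD(1)[OF G(1)] P.closed P'.closed
  note zero = mod_hom_zero[OF P.left_modules P'.left_modules]
  have M: "abelian_group (P' i)" for i by (rule left_module.axioms(2)[OF P'.left_modules])
  have N': "abelian_group N'" by (rule left_module.axioms(2)[OF P'.left_module])
  \<comment> \<open>\<open>r i s\<close> is the part of the difference of \<open>F\<close> and
    \<open>G\<close> in degree \<open>Suc i\<close> not yet accounted for by \<open>s\<close>; the
    next component of the homotopy is a lift of it along \<open>d'\<close>.\<close>
  define r where "r i s x = F (Suc i) x \<ominus>\<^bsub>P' (Suc i)\<^esub> (G (Suc i) x \<oplus>\<^bsub>P' (Suc i)\<^esub> s (d i x))" for i s x
  define A where "A i s \<longleftrightarrow> s \<in> mod_hom R (P i) (P' (Suc i)) \<and>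
    (\<forall>x \<in> carrier (P (Suc i)). d' i (r i s x) = \<zero>\<^bsub>P' i\<^esub>)" for i s
  define C where "C i s t \<longleftrightarrow> (\<forall>x \<in> carrier (P (Suc i)). d' (Suc i) (t x) = r i s x)" for i s t
  have r: "r i s \<in> mod_hom R (P (Suc i)) (P' (Suc i))" if "s \<in> mod_hom R (P i) (P' (Suc i))" for i s
    unfolding r_def
    by (intro mod_hom_diff mod_hom_add F G P'.left_modules mod_hom_comp[OF P.differential that])
  have dr: "d' i (r i s x) = F i (d i x) \<ominus>\<^bsub>P' i\<^esub> (G i (d i x) \<oplus>\<^bsub>P' i\<^esub> d' i (s (d i x)))"
    if "s \<in> mod_hom R (P i) (P' (Suc i))" "x \<in> carrier (P (Suc i))" for i s x
  proof -
    interpret M: abelian_group "P' (Suc i)" by (rule M)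
    show ?thesis
      unfolding r_def using that mod_homD(1)[OF that(1)]
      by (simp add: mod_hom_a_minus[OF P'.left_modules P'.left_modules P'.differential]
          mod_homD(2)[OF P'.differential] cl F(2) G(2))
  qed
  have "\<exists>s. \<forall>i. A i (s i) \<and> C i (s i) (s (Suc i))"
  proof (rule dependent_nat_choice)
    interpret M: abelian_group "P' 0" by (rule M)
    interpret N': abelian_group N' by (rule N')
    have diff: "(\<lambda>x. F 0 x \<ominus>\<^bsub>P' 0\<^esub> G 0 x) \<in> mod_hom R (P 0) (P' 0)"
      by (intro mod_hom_diff F G P'.left_modules)
    have "F 0 x \<ominus>\<^bsub>P' 0\<^esub> G 0 x \<in> d' 0 ` carrier (P' (Suc 0))" if "x \<in> carrier (P 0)" for x
      using that by (simp add: P'.exact_0 cl mod_hom_a_minus[OF P'.left_modules P'.left_module P'.augmentation]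
          eq N'.minus_eq N'.r_neg)
    then obtain s where s: "s \<in> mod_hom R (P 0) (P' (Suc 0))"
        "\<And>x. x \<in> carrier (P 0) \<Longrightarrow> d' 0 (s x) = F 0 x \<ominus>\<^bsub>P' 0\<^esub> G 0 x"
      using projective_lift[OF P'.left_modules P'.left_modules P.left_modules P.projective P'.differential diff]
      by blast
    have "d' 0 (r 0 s x) = \<zero>\<^bsub>P' 0\<^esub>" if "x \<in> carrier (P (Suc 0))" for x
      using that by (simp add: dr s cl M.minus_add_minus_cancel)
    then have "A 0 s" using s(1) by (simp add: A_def)
    then show "\<exists>s. A 0 s" by (intro exI[of _ s])
  next
    fix s i assume "A i s"
    then have s: "s \<in> mod_hom R (P i) (P' (Suc i))"
      and z: "\<And>x. x \<in> carrier (P (Suc i)) \<Longrightarrow> d' i (r i s x) = \<zero>\<^bsub>P' i\<^esub>" by (auto simp: A_def)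
    have "r i s ` carrier (P (Suc i)) \<subseteq> d' (Suc i) ` carrier (P' (Suc (Suc i)))"
      using z mod_homD(1)[OF r[OF s]] by (auto simp: P'.exact_Suc)
    then obtain t where t: "t \<in> mod_hom R (P (Suc i)) (P' (Suc (Suc i)))"
        "\<And>x. x \<in> carrier (P (Suc i)) \<Longrightarrow> d' (Suc i) (t x) = r i s x"
      using projective_lift[OF P'.left_modules P'.left_modules P.left_modules P.projective P'.differential r[OF s]]
      by blast
    interpret M: abelian_group "P' (Suc i)" by (rule M)
    have "d' (Suc i) (r (Suc i) t x) = \<zero>\<^bsub>P' (Suc i)\<^esub>" if x: "x \<in> carrier (P (Suc (Suc i)))" for x
    proof -
      have "r i s (d (Suc i) x) = F (Suc i) (d (Suc i) x) \<ominus>\<^bsub>P' (Suc i)\<^esub> G (Suc i) (d (Suc i) x)"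
        using x by (simp add: r_def cl P.differential_differential zero[OF s])
      then show ?thesis
        using x by (simp add: dr t cl M.minus_add_minus_cancel)
    qed
    then have "A (Suc i) t \<and> C i s t" using t by (simp add: A_def C_def)
    then show "\<exists>t. A (Suc i) t \<and> C i s t" by (intro exI[of _ t])
  qed
  then obtain s where "\<And>i. A i (s i)" "\<And>i. C i (s i) (s (Suc i))" by blast
  then have s: "\<And>i. s i \<in> mod_hom R (P i) (P' (Suc i))"
      "\<And>i x. x \<in> carrier (P (Suc i)) \<Longrightarrow> d' (Suc i) (s (Suc i) x) = r i (s i) x"
    by (simp_all add: A_def C_def)
  show thesis
  proof (rule that[OF s(1)])
    fix i x assume x: "x \<in> carrier (P (Suc i))"
    interpret M: abelian_group "P' (Suc i)" by (rule M)
    show "F (Suc i) x = (G (Suc i) x \<oplus>\<^bsub>P' (Suc i)\<^esub> s i (d i x)) \<oplus>\<^bsub>P' (Suc i)\<^esub> d' (Suc i) (s (Suc i) x)"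
      using x by (simp add: s(2) r_def cl mod_homD(1)[OF s(1)] M.minus_add_minus_cancel(2)[symmetric])
  qed
qed

text \<open>\<open>G\<close> after \<open>F\<close> is homotopic to the identity of
  \<open>P\<close>. Pull the cocycle back along \<open>G\<close>, write it as a coboundary on
  \<open>P'\<close> and return along \<open>F\<close>; the homotopy accounts for the
  difference.\<close>

lemma dual_acyclic_transfer:
  assumes "projective_resolution R N P d e" "projective_resolution R N P' d' e'" "dual_acyclic R P' d'"
  shows "dual_acyclic R P d"
proof (rule dual_acyclicI)
  interpret P: projective_resolution R N P d e by fact
  interpret P': projective_resolution R N P' d' e' by fact
  interpret N: left_module R N by (rule P.left_module)
  have reg: "left_module R (regular R)" by (rule left_module_regular) unfold_locales
  obtain F where F: "\<And>i. F i \<in> mod_hom R (P i) (P' i)" "\<And>x. x \<in> carrier (P 0) \<Longrightarrow> e' (F 0 x) = e x"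
      "\<And>i x. x \<in> carrier (P (Suc i)) \<Longrightarrow> d' i (F (Suc i) x) = F i (d i x)"
    using comparison_exists[OF assms(1,2) mod_hom_id] by metis
  obtain G where G: "\<And>i. G i \<in> mod_hom R (P' i) (P i)" "\<And>x. x \<in> carrier (P' 0) \<Longrightarrow> e (G 0 x) = e' x"
      "\<And>i x. x \<in> carrier (P' (Suc i)) \<Longrightarrow> d i (G (Suc i) x) = G i (d' i x)"
    using comparison_exists[OF assms(2,1) mod_hom_id] by metis
  note cl = mod_homD(1)[OF F(1)] mod_homD(1)[OF G(1)] P.closed P'.closed
  \<comment> \<open>The homotopy joins the identity and \<open>G\<close> after \<open>F\<close>,
    both of which cover the identity of \<open>N\<close>.\<close>
  obtain s where s: "\<And>i. s i \<in> mod_hom R (P i) (P (Suc i))"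
    "\<And>i x. x \<in> carrier (P (Suc i)) \<Longrightarrow>
      x = (G (Suc i) (F (Suc i) x) \<oplus>\<^bsub>P (Suc i)\<^esub> s i (d i x)) \<oplus>\<^bsub>P (Suc i)\<^esub> d (Suc i) (s (Suc i) x)"
  proof (rule chain_homotopy_exists[OF assms(1,1), of "\<lambda>i x. x" "\<lambda>i x. G i (F i x)"])
    show "(\<lambda>x. G i (F i x)) \<in> mod_hom R (P i) (P i)" for i
      by (rule mod_hom_comp[OF F(1) G(1)])
  qed (auto simp: mod_hom_id F G cl)
  fix i c
  assume c: "c \<in> mod_hom R (P (Suc i)) (regular R)"
    and z: "\<And>x. x \<in> carrier (P (Suc (Suc i))) \<Longrightarrow> c (d (Suc i) x) = \<zero>\<^bsub>R\<^esub>"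
  have "c (G (Suc i) (d' (Suc i) x)) = \<zero>\<^bsub>R\<^esub>" if "x \<in> carrier (P' (Suc (Suc i)))" for x
    using z[of "G (Suc (Suc i)) x"] that by (simp add: G(3) cl)
  then obtain b where b: "b \<in> mod_hom R (P' i) (regular R)"
      "\<And>x. x \<in> carrier (P' (Suc i)) \<Longrightarrow> c (G (Suc i) x) = b (d' i x)"
    using dual_acyclicE[OF assms(3) mod_hom_comp[OF G(1) c]] by metis
  \<comment> \<open>Apply \<open>c\<close> to x = G F x + s d x + d s x. The last term is killed by
    the cocycle condition, and c (G (F x)) = b (d' (F x)) = b (F (d x)).\<close>
  let ?b = "\<lambda>x. b (F i x) \<oplus>\<^bsub>R\<^esub> c (s i x)"
  have "?b \<in> mod_hom R (P i) (regular R)"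
    using mod_hom_add[OF reg mod_hom_comp[OF F(1) b(1)] mod_hom_comp[OF s(1) c]] by simp
  moreover have "c x = ?b (d i x)" if x: "x \<in> carrier (P (Suc i))" for x
  proof -
    interpret M: left_module R "P (Suc i)" by (rule P.left_modules)
    have "G (Suc i) (F (Suc i) x) \<in> carrier (P (Suc i))" "s i (d i x) \<in> carrier (P (Suc i))"
        "d (Suc i) (s (Suc i) x) \<in> carrier (P (Suc i))"
      using x by (simp_all add: cl mod_homD(1)[OF s(1)])
    then have "c ((G (Suc i) (F (Suc i) x) \<oplus>\<^bsub>P (Suc i)\<^esub> s i (d i x)) \<oplus>\<^bsub>P (Suc i)\<^esub> d (Suc i) (s (Suc i) x)) =
        (c (G (Suc i) (F (Suc i) x)) \<oplus>\<^bsub>R\<^esub> c (s i (d i x))) \<oplus>\<^bsub>R\<^esub> c (d (Suc i) (s (Suc i) x))"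
      by (simp add: mod_homD(2)[OF c])
    then have "c x = (c (G (Suc i) (F (Suc i) x)) \<oplus>\<^bsub>R\<^esub> c (s i (d i x))) \<oplus>\<^bsub>R\<^esub> c (d (Suc i) (s (Suc i) x))"
      by (rule trans[OF arg_cong[where f = c, OF s(2)[OF x]]])
    then show ?thesis
      using x mod_homD(1)[OF c] mod_homD(1)[OF b(1)] by (simp add: z b(2) F(3) cl mod_homD(1)[OF s(1)])
  qed
  ultimately show "\<exists>b \<in> mod_hom R (P i) (regular R). \<forall>x \<in> carrier (P (Suc i)). c x = b (d i x)"
    by (intro bexI[of _ ?b] ballI)
qed

section \<open>Semi-Gorenstein-projectivity from projective resolutions\<close>

text \<open>The Hom group into the regular module is the additive group of the dual, which is
  already known to be a module.\<close>

lemma comm_group_Hom_regular: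
  assumes "left_module R M"
  shows "comm_group (Hom_group R M (regular R))"
proof -
  interpret M: left_module R M by fact
  interpret D: left_module "opp R" "dual R M" by (rule left_module_dual[OF assms])
  let ?H = "Hom_group R M (regular R)"
  have eq: "carrier ?H = carrier (dual R M)" "monoid.mult ?H = add (dual R M)" "one ?H = zero (dual R M)"
    by (simp_all add: dual_def)
  show ?thesis
  proof (rule comm_groupI)
    show "\<exists>y\<in>carrier ?H. y \<otimes>\<^bsub>?H\<^esub> x = \<one>\<^bsub>?H\<^esub>" if "x \<in> carrier ?H" for x
      using that D.M.l_neg[of x] D.M.a_inv_closed[of x] by (auto simp: eq)
  qed (auto simp: eq D.M.a_ac)
qed

lemma trivial_group_Mod_iff:
  assumes "comm_group G" "subgroup H G"
  shows "trivial_group (G Mod H) \<longleftrightarrow> carrier G \<subseteq> H"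
proof -
  interpret comm_group G by fact
  interpret H: subgroup H G by fact
  have N: "H \<lhd> G" by (rule subgroup_imp_normal[OF assms(2)])
  have "carrier (G Mod H) = {\<one>\<^bsub>G Mod H\<^esub>} \<longleftrightarrow> (\<forall>x\<in>carrier G. H #>\<^bsub>G\<^esub> x = H)"
    using coset_join2[OF _ assms(2) H.one_closed] by (auto simp: FactGroup_def RCOSETS_def)
  also have "\<dots> \<longleftrightarrow> carrier G \<subseteq> H"
    using coset_join2[OF _ assms(2)] rcos_self[OF _ assms(2)] by blast
  finally show ?thesis
    by (simp add: trivial_group_def normal.factorgroup_is_group[OF N])
qed

lemma dual_map_Hom_group:
  assumes "left_module R M" "left_module R N" "f \<in> mod_hom R M N"
  shows "group_hom (Hom_group R N (regular R)) (Hom_group R M (regular R)) (dual_map M f)"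
proof -
  have "dual_map M f \<in> hom (Hom_group R N (regular R)) (Hom_group R M (regular R))"
    using dual_map_mod_hom[OF assms] by (auto simp: mod_hom_def hom_def dual_def)
  then show ?thesis
    using comm_group_Hom_regular[OF assms(1)] comm_group_Hom_regular[OF assms(2)]
    by (intro group_hom.intro group_hom_axioms.intro) (auto simp: comm_group_def)
qed

lemma restrict_Hom_regular:
  assumes "left_module R M" "f \<in> mod_hom R M (regular R)"
  shows "restrict f (carrier M) \<in> carrier (Hom_group R M (regular R))"
  using mod_hom_cong[OF assms(2,1)] by (auto simp: Hom_group_def)

lemma free_resolution_projective_resolution:
  assumes "free_resolution R N B d e" "left_module R N"
  shows "projective_resolution R N (\<lambda>i. free_module R (B i)) d e"
proof -
  have R: "ring R" using assms(2) by (rule left_module.axioms(1))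
  note F = left_module_free_module[OF R]
  show ?thesis
    using assms unfolding free_resolution_def
    by (intro projective_resolution.intro) (auto simp: F projective_free_module[OF R] a_kernel_def')
qed

text \<open>Only degrees at least 1 occur, so the coboundaries always come from the second equation
  of \<open>coboundaries\<close>, and triviality of the quotient group means that every cocycle is a
  coboundary.\<close>

lemma trivial_cohomology_iff:
  assumes "projective_resolution R N (\<lambda>i. free_module R (B i)) d e"
  shows "(\<forall>i\<ge>1. trivial_group (cohomology R B d (regular R) i)) \<longleftrightarrow>
    dual_acyclic R (\<lambda>i. free_module R (B i)) d"
proof -
  interpret P: projective_resolution R N "\<lambda>i. free_module R (B i)" d e by fact
  let ?P = "\<lambda>i. free_module R (B i)"
  let ?H = "\<lambda>i. Hom_group R (?P i) (regular R)"
  have *: "trivial_group (cohomology R B d (regular R) (Suc i)) \<longleftrightarrow>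
      (\<forall>c \<in> mod_hom R (?P (Suc i)) (regular R). (\<forall>x \<in> carrier (?P (Suc (Suc i))). c (d (Suc i) x) = \<zero>\<^bsub>R\<^esub>) \<longrightarrow>
      (\<exists>b \<in> mod_hom R (?P i) (regular R). \<forall>x \<in> carrier (?P (Suc i)). c x = b (d i x)))" for i
  proof -
    let ?Z = "cocycles R B d (regular R) (Suc i)" and ?B = "coboundaries R B d (regular R) (Suc i)"
    interpret H: comm_group "?H (Suc i)" by (rule comm_group_Hom_regular[OF P.left_modules])
    interpret d: group_hom "?H i" "?H (Suc i)" "dual_map (?P (Suc i)) (d i)"
      by (rule dual_map_Hom_group[OF P.left_modules P.left_modules P.differential])
    interpret d': group_hom "?H (Suc i)" "?H (Suc (Suc i))" "dual_map (?P (Suc (Suc i))) (d (Suc i))"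
      by (rule dual_map_Hom_group[OF P.left_modules P.left_modules P.differential])
    have z: "f \<zero>\<^bsub>?P i\<^esub> = \<zero>\<^bsub>R\<^esub>" if "f \<in> mod_hom R (?P i) (regular R)" for f
    proof -
      interpret N: left_module R N by (rule P.left_module)
      show ?thesis
        using mod_hom_zero[OF P.left_modules left_module_regular that] N.R.ring_axioms by simp
    qed
    have Z: "c \<in> ?Z \<longleftrightarrow> c \<in> carrier (?H (Suc i)) \<and> (\<forall>x \<in> carrier (?P (Suc (Suc i))). c (d (Suc i) x) = \<zero>\<^bsub>R\<^esub>)" for c
      unfolding cocycles_def kernel_def
      by (auto simp: Hom_group_def dual_map_def compose_def fun_eq_iff restrict_def split: if_splits)
    have Z': "subgroup ?Z (?H (Suc i))" unfolding cocycles_def by (rule d'.subgroup_kernel)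
    moreover have B: "subgroup ?B (?H (Suc i))" using d.img_is_subgroup by simp
    moreover have "?B \<subseteq> ?Z"
      using d.hom_closed P.closed P.differential_differential z
      by (auto simp: Z) (auto simp: dual_map_def compose_def Hom_group_def)
    ultimately have B': "subgroup ?B (?H (Suc i)\<lparr>carrier := ?Z\<rparr>)" by (intro H.subgroup_incl)
    have "comm_group (?H (Suc i)\<lparr>carrier := ?Z\<rparr>)"
      using H.subgroup_imp_group[OF Z'] subgroup.subset[OF Z']
      by (intro group.group_comm_groupI) (auto simp: H.m_comm subset_iff)
    with B' have "trivial_group (cohomology R B d (regular R) (Suc i)) \<longleftrightarrow> ?Z \<subseteq> ?B"
      unfolding cohomology_def by (subst trivial_group_Mod_iff) simp_all
    also have "\<dots> \<longleftrightarrow> (\<forall>c \<in> mod_hom R (?P (Suc i)) (regular R).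
      (\<forall>x \<in> carrier (?P (Suc (Suc i))). c (d (Suc i) x) = \<zero>\<^bsub>R\<^esub>) \<longrightarrow>
      (\<exists>b \<in> mod_hom R (?P i) (regular R). \<forall>x \<in> carrier (?P (Suc i)). c x = b (d i x)))" (is "?L \<longleftrightarrow> ?R")
    proof
      assume L: ?L
      show ?R
      proof (intro ballI impI)
        fix c assume c: "c \<in> mod_hom R (?P (Suc i)) (regular R)"
          and cz: "\<forall>x \<in> carrier (?P (Suc (Suc i))). c (d (Suc i) x) = \<zero>\<^bsub>R\<^esub>"
        \<comment> \<open>Elements of the Hom group are extensional, unlike the members of
          \<open>mod_hom\<close>, so \<open>c\<close> is first cut off outside the carrier.\<close>
        have "restrict c (carrier (?P (Suc i))) \<in> ?Z"
          unfolding Z using cz P.closed restrict_Hom_regular[OF P.left_modules c] by simp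
        with L obtain b where "b \<in> carrier (?H i)"
            "restrict c (carrier (?P (Suc i))) = dual_map (?P (Suc i)) (d i) b" by auto
        then show "\<exists>b \<in> mod_hom R (?P i) (regular R). \<forall>x \<in> carrier (?P (Suc i)). c x = b (d i x)"
          by (intro bexI[of _ b]) (auto simp: Hom_group_def dual_map_def compose_def fun_eq_iff split: if_splits)
      qed
    next
      assume R: ?R
      show ?L
      proof
        fix c assume "c \<in> ?Z"
        then have c: "c \<in> mod_hom R (?P (Suc i)) (regular R)" "c \<in> extensional (carrier (?P (Suc i)))"
            "\<forall>x \<in> carrier (?P (Suc (Suc i))). c (d (Suc i) x) = \<zero>\<^bsub>R\<^esub>"
          unfolding Z by (auto simp: Hom_group_def)
        with R obtain b where b: "b \<in> mod_hom R (?P i) (regular R)" "\<forall>x \<in> carrier (?P (Suc i)). c x = b (d i x)"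
          by blast
        have "c = dual_map (?P (Suc i)) (d i) (restrict b (carrier (?P i)))"
          using b(2) P.closed
          by (intro extensionalityI[OF c(2)]) (auto simp: dual_map_def compose_def)
        then show "c \<in> ?B" using restrict_Hom_regular[OF P.left_modules b(1)] by simp
      qed
    qed
    finally show ?thesis .
  qed
  show ?thesis
    unfolding dual_acyclic_def *[symmetric]
    by (metis One_nat_def Suc_le_D le_add1 plus_1_eq_Suc)
qed

text \<open>The choice made in \<open>Ext\<close> yields a free resolution, since one exists by
  \<open>free_resolution_exists\<close>; \<open>dual_acyclic_transfer\<close> then passes between it
  and \<open>P\<close> in both directions.\<close>

theorem semi_Gorenstein_projective_iff:
  fixes R :: "('a, 'r) ring_scheme" and N :: "('a, 'b, 'm) module_scheme"
  assumes "projective_resolution R N P d e"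
  shows "semi_Gorenstein_projective R N \<longleftrightarrow> dual_acyclic R P d"
proof -
  have N: "left_module R N" by (rule projective_resolution.left_module[OF assms])
  obtain B :: "nat \<Rightarrow> ('a + 'b) list set" and \<delta>
    where Bd: "(SOME (B :: nat \<Rightarrow> ('a + 'b) list set, d). \<exists>e. free_resolution R N B d e) = (B, \<delta>)"
    by force
  have "\<exists>x. (\<lambda>(B :: nat \<Rightarrow> ('a + 'b) list set, d). \<exists>e. free_resolution R N B d e) x"
    using free_resolution_exists[OF N] by auto
  from someI_ex[OF this] obtain \<epsilon> where "free_resolution R N B \<delta> \<epsilon>"
    unfolding Bd by auto
  then have Q: "projective_resolution R N (\<lambda>i. free_module R (B i)) \<delta> \<epsilon>"
    by (rule free_resolution_projective_resolution[OF _ N])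
  have "semi_Gorenstein_projective R N \<longleftrightarrow> dual_acyclic R (\<lambda>i. free_module R (B i)) \<delta>"
    unfolding semi_Gorenstein_projective_def Ext_def Bd by (simp add: trivial_cohomology_iff[OF Q, simplified])
  then show ?thesis using dual_acyclic_transfer[OF Q assms] dual_acyclic_transfer[OF assms Q] by blast
qed

lemma projective_resolution_exists:
  fixes R :: "('a, 'r) ring_scheme" and N :: "('a, 'b, 'm) module_scheme"
  assumes "left_module R N"
  obtains B :: "nat \<Rightarrow> ('a + 'b) list set" and d e
  where "projective_resolution R N (\<lambda>i. free_module R (B i)) d e"
proof -
  obtain B :: "nat \<Rightarrow> ('a + 'b) list set" and d e where "free_resolution R N B d e"
    using free_resolution_exists[OF assms] by auto
  then show thesis by (rule that[OF free_resolution_projective_resolution[OF _ assms]])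
qed

section \<open>Short exact sequences\<close>

lemma a_inv_regular [simp]: "\<ominus>\<^bsub>regular R\<^esub> x = \<ominus>\<^bsub>R\<^esub> x"
  by (simp add: a_inv_def m_inv_def)

lemma a_minus_regular [simp]: "x \<ominus>\<^bsub>regular R\<^esub> y = x \<ominus>\<^bsub>R\<^esub> y"
  by (simp add: a_minus_def)

text \<open>Surjectivity of the dual map is extension of functionals along \<open>f\<close>; this
  form absorbs the extensionality convention for elements of the dual.\<close>

lemma dual_map_surj_iff:
  assumes "left_module R M" "left_module R N" "f \<in> mod_hom R M N"
  shows "dual_map M f ` carrier (dual R N) = carrier (dual R M) \<longleftrightarrow>
    (\<forall>h \<in> mod_hom R M (regular R). \<exists>t \<in> mod_hom R N (regular R). \<forall>x \<in> carrier M. t (f x) = h x)"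
    (is "?L \<longleftrightarrow> ?R")
proof
  assume L: ?L
  show ?R
  proof
    fix h assume h: "h \<in> mod_hom R M (regular R)"
    then have "restrict h (carrier M) \<in> dual_map M f ` carrier (dual R N)"
      using restrict_Hom_regular[OF assms(1) h] L by (simp add: dual_def)
    then obtain t where "t \<in> carrier (dual R N)" "restrict h (carrier M) = dual_map M f t" by auto
    then show "\<exists>t \<in> mod_hom R N (regular R). \<forall>x \<in> carrier M. t (f x) = h x"
      by (intro bexI[of _ t])
         (auto simp: dual_def Hom_group_def dual_map_def compose_def fun_eq_iff split: if_splits)
  qed
next
  assume R: ?R
  have "carrier (dual R M) \<subseteq> dual_map M f ` carrier (dual R N)"
  proof
    fix h assume "h \<in> carrier (dual R M)"
    then have h: "h \<in> mod_hom R M (regular R)" "h \<in> extensional (carrier M)"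
      by (auto simp: dual_def Hom_group_def)
    with R obtain t where t: "t \<in> mod_hom R N (regular R)" "\<forall>x \<in> carrier M. t (f x) = h x" by auto
    have "h = dual_map M f (restrict t (carrier N))"
      using t(2) mod_homD(1)[OF assms(3)]
      by (intro extensionalityI[OF h(2)]) (auto simp: dual_map_def compose_def)
    then show "h \<in> dual_map M f ` carrier (dual R N)"
      using restrict_Hom_regular[OF assms(2) t(1)] by (simp add: dual_def)
  qed
  then show ?L
    using mod_homD(1)[OF dual_map_mod_hom[OF assms]] by auto
qed

locale short_exact_sequence =
  fixes R :: "('a, 'r) ring_scheme" and N' :: "('a, 'b, 'm) module_scheme"
    and N :: "('a, 'c, 'n) module_scheme" and N'' :: "('a, 'd, 'o) module_scheme"
    and \<iota> :: "'b \<Rightarrow> 'c" and q :: "'c \<Rightarrow> 'd"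
  assumes left_modules: "left_module R N'" "left_module R N" "left_module R N''"
    and homs: "\<iota> \<in> mod_hom R N' N" "q \<in> mod_hom R N N''"
    and inj: "inj_on \<iota> (carrier N')"
    and surj: "q ` carrier N = carrier N''"
    and exact: "\<iota> ` carrier N' = {x \<in> carrier N. q x = \<zero>\<^bsub>N''\<^esub>}"
begin

sublocale N': left_module R N' by (rule left_modules)
sublocale N: left_module R N by (rule left_modules)
sublocale N'': left_module R N'' by (rule left_modules)

lemma regular: "left_module R (regular R)"
  by (rule left_module_regular) (rule N'.R.ring_axioms)

lemma comp_zero: "x \<in> carrier N' \<Longrightarrow> q (\<iota> x) = \<zero>\<^bsub>N''\<^esub>"
  using exact by blast

lemma inj_zero: "x \<in> carrier N' \<Longrightarrow> \<iota> x = \<zero>\<^bsub>N\<^esub> \<Longrightarrow> x = \<zero>\<^bsub>N'\<^esub>"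
  using inj_onD[OF inj, of x "\<zero>\<^bsub>N'\<^esub>"] mod_hom_zero[OF left_modules(1,2) homs(1)] by simp

end

text \<open>A zero module with the element type and the operations of \<open>M\<close>. It fills
  degree 0 of a shifted complex, and it is the upper component of triples in which only the lower
  one matters.\<close>

lemma zero_submodule:
  assumes "left_module R M"
  shows "left_module R (M\<lparr>carrier := {\<zero>\<^bsub>M\<^esub>}\<rparr>)" "projective R (M\<lparr>carrier := {\<zero>\<^bsub>M\<^esub>}\<rparr>)"
proof -
  interpret M: left_module R M by fact
  let ?Z = "M\<lparr>carrier := {\<zero>\<^bsub>M\<^esub>}\<rparr>"
  have ab: "abelian_group ?Z" by (rule abelian_groupI) auto
  show Z: "left_module R ?Z"
    by (intro left_module.intro left_module_axioms.intro ab) (auto simp: M.R.ring_axioms)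
  show "projective R ?Z"
  proof (rule projectiveI[OF Z])
    fix B g assume g: "g \<in> mod_hom R (free_module R B) ?Z"
    have F: "left_module R (free_module R B)" by (rule left_module_free_module) unfold_locales
    show "\<exists>s \<in> mod_hom R ?Z (free_module R B). \<forall>x\<in>carrier ?Z. g (s x) = x"
      using mod_hom_zero[OF F Z g] by (intro bexI[OF _ mod_hom_const_zero[OF F]]) simp
  qed
qed

section \<open>Mapping cones and the third term of a short exact sequence\<close>

definition suspension :: "(nat \<Rightarrow> ('a, 'p, 'l) module_scheme) \<Rightarrow> nat \<Rightarrow> ('a, 'p, 'l) module_scheme"
  where "suspension P i = (case i of 0 \<Rightarrow> (P 0)\<lparr>carrier := {\<zero>\<^bsub>P 0\<^esub>}\<rparr> | Suc k \<Rightarrow> P k)"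

text \<open>The minus sign makes the differential of the cone square to zero: the terms d F and F d'
  cancel.\<close>

definition suspension_differential ::
    "(nat \<Rightarrow> ('a, 'p, 'l) module_scheme) \<Rightarrow> (nat \<Rightarrow> 'p \<Rightarrow> 'p) \<Rightarrow> nat \<Rightarrow> 'p \<Rightarrow> 'p"
  where "suspension_differential P d i x = (case i of 0 \<Rightarrow> \<zero>\<^bsub>P 0\<^esub> | Suc k \<Rightarrow> \<ominus>\<^bsub>P k\<^esub> d k x)"

definition cone_differential ::
    "(nat \<Rightarrow> ('a, 'p, 'l) module_scheme) \<Rightarrow> (nat \<Rightarrow> 'p \<Rightarrow> 'p) \<Rightarrow>
     (nat \<Rightarrow> ('a, 'q, 'k) module_scheme) \<Rightarrow> (nat \<Rightarrow> 'q \<Rightarrow> 'q) \<Rightarrow> (nat \<Rightarrow> 'q \<Rightarrow> 'p) \<Rightarrow> nat \<Rightarrow> 'p \<times> 'q \<Rightarrow> 'p \<times> 'q"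
  where "cone_differential P d P' d' F i x =
    (d i (fst x) \<oplus>\<^bsub>P i\<^esub> F i (snd x), suspension_differential P' d' i (snd x))"

lemma suspension_simps [simp]:
  "suspension P 0 = (P 0)\<lparr>carrier := {\<zero>\<^bsub>P 0\<^esub>}\<rparr>" "suspension P (Suc i) = P i"
  "suspension_differential P d 0 x = \<zero>\<^bsub>P 0\<^esub>" "suspension_differential P d (Suc i) x = \<ominus>\<^bsub>P i\<^esub> d i x"
  "\<zero>\<^bsub>suspension P i\<^esub> = (case i of 0 \<Rightarrow> \<zero>\<^bsub>P 0\<^esub> | Suc k \<Rightarrow> \<zero>\<^bsub>P k\<^esub>)"
  by (simp_all add: suspension_def suspension_differential_def split: nat.split)

locale mapping_cone = short_exact_sequence R N' N N'' \<iota> q +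
  P': projective_resolution R N' P' d' e' + P: projective_resolution R N P d e
  for R :: "('a, 'r) ring_scheme" and N' :: "('a, 'b, 'm) module_scheme"
    and N :: "('a, 'c, 'n) module_scheme" and N'' :: "('a, 'd, 'o) module_scheme"
    and \<iota> :: "'b \<Rightarrow> 'c" and q :: "'c \<Rightarrow> 'd"
    and P' :: "nat \<Rightarrow> ('a, 'q, 'k) module_scheme" and d' e'
    and P :: "nat \<Rightarrow> ('a, 'p, 'l) module_scheme" and d e +
  fixes F :: "nat \<Rightarrow> 'q \<Rightarrow> 'p"
  assumes F: "\<And>i. F i \<in> mod_hom R (P' i) (P i)" "\<And>x. x \<in> carrier (P' 0) \<Longrightarrow> e (F 0 x) = \<iota> (e' x)"
    "\<And>i x. x \<in> carrier (P' (Suc i)) \<Longrightarrow> d i (F (Suc i) x) = F i (d' i x)"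
begin

abbreviation "C i \<equiv> direct_sum (P i) (suspension P' i)"
abbreviation "D \<equiv> cone_differential P d P' d' F"

lemmas cl = mod_homD(1)[OF F(1)] P.closed P'.closed mod_homD(1)[OF homs(1)] mod_homD(1)[OF homs(2)]

text \<open>The cone of a lift of an injection resolves the cokernel. In a cycle
  \<open>(p, y)\<close> the component \<open>y\<close> is a boundary in \<open>P'\<close>, in degree
  0 because \<open>\<iota>\<close> is injective; removing that boundary leaves a cycle of
  \<open>P\<close>, which is a boundary too.\<close>

lemma cone_resolution: "projective_resolution R N'' C D (\<lambda>x. q (e (fst x)))"
proof -
  let ?S = "suspension P'"
  have M: "abelian_group (P i)" for i by (rule left_module.axioms(2)[OF P.left_modules])
  have M': "abelian_group (P' i)" for i by (rule left_module.axioms(2)[OF P'.left_modules])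
  have S: "left_module R (?S i)" "projective R (?S i)" for i
    by (cases i; simp add: zero_submodule P'.left_modules P'.projective)+
  have sd: "suspension_differential P' d' i \<in> mod_hom R (?S (Suc i)) (?S i)" for i
  proof (cases i)
    case 0
    interpret P'0: left_module R "P' 0" by (rule P'.left_modules)
    show ?thesis unfolding 0 by (rule mod_homI) simp_all
  next
    case (Suc k)
    have "suspension_differential P' d' (Suc k) = (\<lambda>x. \<ominus>\<^bsub>P' k\<^esub> d' k x)" by (rule ext) simp
    then show ?thesis unfolding Suc using mod_hom_minus[OF P'.left_modules P'.differential] by simp
  qed
  have D: "D i \<in> mod_hom R (C (Suc i)) (C i)" for i
    unfolding cone_differential_def[abs_def]
    by (intro mod_hom_direct_sum_in mod_hom_add P.left_modules mod_hom_comp[OF direct_sum_projections(1)]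
        mod_hom_comp[OF direct_sum_projections(2)] P.differential sd) (simp add: F)
  have eps: "(\<lambda>x. q (e (fst x))) \<in> mod_hom R (C 0) N''"
    by (rule mod_hom_comp[OF mod_hom_comp[OF direct_sum_projections(1) P.augmentation] homs(2)])
  show ?thesis
  proof (intro projective_resolution.intro left_module_direct_sum projective_direct_sum
      left_modules P.left_modules P.projective S D eps)
    show "(\<lambda>x. q (e (fst x))) ` carrier (C 0) = carrier N''"
      unfolding surj[symmetric] P.surj[symmetric] by (force simp: image_iff)
    show "D 0 ` carrier (C (Suc 0)) = {x \<in> carrier (C 0). q (e (fst x)) = \<zero>\<^bsub>N''\<^esub>}"
    proof (intro equalityI subsetI)
      interpret M: abelian_group "P 0" by (rule M)
      fix x assume "x \<in> D 0 ` carrier (C (Suc 0))"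
      then show "x \<in> {x \<in> carrier (C 0). q (e (fst x)) = \<zero>\<^bsub>N''\<^esub>}"
        by (auto simp: cone_differential_def cl mod_homD(2)[OF P.augmentation] P.augmentation_differential
            F(2) comp_zero)
    next
      interpret M: abelian_group "P 0" by (rule M)
      fix x assume "x \<in> {x \<in> carrier (C 0). q (e (fst x)) = \<zero>\<^bsub>N''\<^esub>}"
      then obtain p where p: "x = (p, \<zero>\<^bsub>P' 0\<^esub>)" "p \<in> carrier (P 0)" "q (e p) = \<zero>\<^bsub>N''\<^esub>" by auto
      \<comment> \<open>\<open>q\<close> kills \<open>e p\<close>, so \<open>e p\<close> comes from
        \<open>N'\<close>, say from \<open>e' y\<close>; subtracting \<open>F 0 y\<close> moves
        \<open>p\<close> into the kernel of \<open>e\<close>.\<close>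
      then have "e p \<in> \<iota> ` carrier N'" by (simp add: exact cl)
      then obtain y where y: "y \<in> carrier (P' 0)" "e p = \<iota> (e' y)"
        unfolding P'.surj[symmetric] by auto
      then have "e (p \<ominus>\<^bsub>P 0\<^esub> F 0 y) = \<zero>\<^bsub>N\<^esub>"
        using p(2) by (simp add: mod_hom_a_minus[OF P.left_modules left_modules(2) P.augmentation] cl F(2))
      then have "p \<ominus>\<^bsub>P 0\<^esub> F 0 y \<in> d 0 ` carrier (P (Suc 0))" using p(2) y(1) by (simp add: P.exact_0 cl)
      then obtain w where w: "w \<in> carrier (P (Suc 0))" "p \<ominus>\<^bsub>P 0\<^esub> F 0 y = d 0 w" by auto
      then have "d 0 w \<oplus>\<^bsub>P 0\<^esub> F 0 y = p"
        using M.minus_add_minus_cancel(2)[of p "F 0 y"] p(2) y(1) by (simp add: cl M.a_comm)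
      then have "x = D 0 (w, y)" by (simp add: p cone_differential_def)
      then show "x \<in> D 0 ` carrier (C (Suc 0))" using w(1) y(1) by auto
    qed
    fix i
    interpret M: abelian_group "P i" by (rule M)
    interpret MS: abelian_group "P (Suc i)" by (rule M)
    interpret M': abelian_group "P' i" by (rule M')
    show "D (Suc i) ` carrier (C (Suc (Suc i))) = {x \<in> carrier (C (Suc i)). D i x = \<zero>\<^bsub>C i\<^esub>}"
    proof (intro equalityI subsetI)
      fix x assume "x \<in> D (Suc i) ` carrier (C (Suc (Suc i)))"
      then obtain p y where py: "p \<in> carrier (P (Suc (Suc i)))" "y \<in> carrier (P' (Suc i))" "x = D (Suc i) (p, y)"
        by auto
      have "d i (fst x) \<oplus>\<^bsub>P i\<^esub> F i (snd x) = \<zero>\<^bsub>P i\<^esub>"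
        using py by (simp add: cone_differential_def mod_homD(2)[OF P.differential] cl P.differential_differential
            F(3) mod_hom_a_inv[OF P'.left_modules P.left_modules F(1)] M.r_neg)
      moreover have "suspension_differential P' d' i (snd x) = \<zero>\<^bsub>?S i\<^esub>"
      proof (cases i)
        case (Suc k)
        interpret Mk: abelian_group "P' k" by (rule M')
        show ?thesis using py unfolding Suc
          by (simp add: cone_differential_def cl P'.differential_differential
              mod_hom_a_inv[OF P'.left_modules P'.left_modules P'.differential])
      qed simp
      moreover have "x \<in> carrier (C (Suc i))" using mod_homD(1)[OF D, of "(p, y)" "Suc i"] py by simp
      ultimately show "x \<in> {x \<in> carrier (C (Suc i)). D i x = \<zero>\<^bsub>C i\<^esub>}"
        by (simp add: cone_differential_def) (simp add: direct_sum_def)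
    next
      fix x assume x: "x \<in> {x \<in> carrier (C (Suc i)). D i x = \<zero>\<^bsub>C i\<^esub>}"
      then obtain p y where py: "x = (p, y)" "p \<in> carrier (P (Suc i))" "y \<in> carrier (P' i)" by auto
      have eq: "d i p \<oplus>\<^bsub>P i\<^esub> F i y = \<zero>\<^bsub>P i\<^esub>" "suspension_differential P' d' i y = \<zero>\<^bsub>?S i\<^esub>"
        using x py by (auto simp: cone_differential_def direct_sum_def)
      have "y \<in> d' i ` carrier (P' (Suc i))"
      proof (cases i)
        case 0
        have "e (d i p \<oplus>\<^bsub>P i\<^esub> F i y) = \<iota> (e' y)"
          using py unfolding 0 by (simp add: mod_homD(2)[OF P.augmentation] cl P.augmentation_differential F(2))
        then have "e' y = \<zero>\<^bsub>N'\<^esub>"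
          using py eq(1) unfolding 0
          by (intro inj_zero) (simp_all add: cl mod_hom_zero[OF P.left_modules left_modules(2) P.augmentation])
        then show ?thesis using py(3) unfolding 0 by (simp add: P'.exact_0)
      next
        case (Suc k)
        interpret Mk: abelian_group "P' k" by (rule M')
        have "\<ominus>\<^bsub>P' k\<^esub> d' k y = \<zero>\<^bsub>P' k\<^esub>" using eq(2) unfolding Suc by simp
        then have "d' k y = \<zero>\<^bsub>P' k\<^esub>"
          using py(3) Mk.minus_minus[of "d' k y"] unfolding Suc by (simp add: cl)
        then show ?thesis using py(3) unfolding Suc by (simp add: P'.exact_Suc)
      qed
      then obtain v where v: "v \<in> carrier (P' (Suc i))" "y = d' i v" by auto
      interpret MS': abelian_group "P' (Suc i)" by (rule M')
      \<comment> \<open>The sign absorbs the one in the shifted differential, so that the second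
        component of \<open>D (Suc i) (u, w)\<close> is \<open>y\<close>.\<close>
      define w where "w = \<ominus>\<^bsub>P' (Suc i)\<^esub> v"
      have w: "w \<in> carrier (P' (Suc i))" "y = \<ominus>\<^bsub>P' i\<^esub> d' i w"
        using v by (auto simp: w_def mod_hom_a_inv[OF P'.left_modules P'.left_modules P'.differential] cl)
      have "d i (p \<ominus>\<^bsub>P (Suc i)\<^esub> F (Suc i) w) = d i p \<oplus>\<^bsub>P i\<^esub> F i y"
        using py w by (simp add: mod_hom_a_minus[OF P.left_modules P.left_modules P.differential] cl F(3)
            mod_hom_a_inv[OF P'.left_modules P.left_modules F(1)] M.minus_eq)
      then have "p \<ominus>\<^bsub>P (Suc i)\<^esub> F (Suc i) w \<in> d (Suc i) ` carrier (P (Suc (Suc i)))"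
        using eq(1) py(2) w(1) by (simp add: P.exact_Suc cl)
      then obtain u where u: "u \<in> carrier (P (Suc (Suc i)))" "p \<ominus>\<^bsub>P (Suc i)\<^esub> F (Suc i) w = d (Suc i) u" by auto
      then have "d (Suc i) u \<oplus>\<^bsub>P (Suc i)\<^esub> F (Suc i) w = p"
        using MS.minus_add_minus_cancel(2)[of p "F (Suc i) w"] py(2) w(1) by (simp add: cl MS.a_comm)
      then have "x = D (Suc i) (u, w)" using w(2) by (simp add: py cone_differential_def)
      then show "x \<in> D (Suc i) ` carrier (C (Suc (Suc i)))" using u(1) w(1) by auto
    qed
  qed
qed

text \<open>A cocycle on the cone is a pair \<open>c1\<close>, \<open>c2\<close> with c1 d = 0 and
  c1 F = c2 d'. Write c1 = b d; then g = c2 - b F is a cocycle on \<open>P'\<close>. In positive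
  degree it is a coboundary. In degree 0 it is a functional on \<open>N'\<close>, which
  \<open>ext\<close> extends to \<open>N\<close>.\<close>

lemma dual_acyclic_cone:
  assumes DA': "dual_acyclic R P' d'" and DA: "dual_acyclic R P d"
    and ext: "dual_map N' \<iota> ` carrier (dual R N) = carrier (dual R N')"
  shows "dual_acyclic R C D"
proof (rule dual_acyclicI)
  fix i c
  assume c: "c \<in> mod_hom R (C (Suc i)) (regular R)"
    and cD: "\<And>x. x \<in> carrier (C (Suc (Suc i))) \<Longrightarrow> c (D (Suc i) x) = \<zero>\<^bsub>R\<^esub>"
  interpret Pi: left_module R "P i" by (rule P.left_modules)
  interpret PS: left_module R "P (Suc i)" by (rule P.left_modules)
  interpret PSS: left_module R "P (Suc (Suc i))" by (rule P.left_modules)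
  interpret P'i: left_module R "P' i" by (rule P'.left_modules)
  interpret P'S: left_module R "P' (Suc i)" by (rule P'.left_modules)
  define c1 where "c1 p = c (p, \<zero>\<^bsub>P' i\<^esub>)" for p
  define c2 where "c2 y = c (\<zero>\<^bsub>P (Suc i)\<^esub>, y)" for y
  have c1: "c1 \<in> mod_hom R (P (Suc i)) (regular R)"
    using mod_hom_comp[OF direct_sum_injections(1)[OF P.left_modules[of "Suc i"] P'.left_modules[of i]]] c
    by (simp add: c1_def[abs_def])
  have c2: "c2 \<in> mod_hom R (P' i) (regular R)"
    using mod_hom_comp[OF direct_sum_injections(2)[OF P.left_modules[of "Suc i"] P'.left_modules[of i]]] c
    by (simp add: c2_def[abs_def])
  have c12: "c (p, y) = c1 p \<oplus>\<^bsub>R\<^esub> c2 y" if "p \<in> carrier (P (Suc i))" "y \<in> carrier (P' i)" for p y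
  proof -
    have "(p, y) = (p, \<zero>\<^bsub>P' i\<^esub>) \<oplus>\<^bsub>C (Suc i)\<^esub> (\<zero>\<^bsub>P (Suc i)\<^esub>, y)" using that by (simp add: direct_sum_def)
    then show ?thesis
      using mod_homD(2)[OF c, of "(p, \<zero>\<^bsub>P' i\<^esub>)" "(\<zero>\<^bsub>P (Suc i)\<^esub>, y)"] that by (simp add: c1_def c2_def)
  qed
  have c1d: "c1 (d (Suc i) p) = \<zero>\<^bsub>R\<^esub>" if p: "p \<in> carrier (P (Suc (Suc i)))" for p
  proof -
    have "D (Suc i) (p, \<zero>\<^bsub>P' (Suc i)\<^esub>) = (d (Suc i) p, \<zero>\<^bsub>P' i\<^esub>)"
      using p by (simp add: cone_differential_def cl mod_hom_zero[OF P'.left_modules P.left_modules F(1)]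
          mod_hom_zero[OF P'.left_modules P'.left_modules P'.differential])
    then show ?thesis using cD[of "(p, \<zero>\<^bsub>P' (Suc i)\<^esub>)"] p by (simp add: c1_def)
  qed
  have c1F: "c1 (F (Suc i) y) = c2 (d' i y)" if y: "y \<in> carrier (P' (Suc i))" for y
  proof -
    have "D (Suc i) (\<zero>\<^bsub>P (Suc (Suc i))\<^esub>, y) = (F (Suc i) y, \<ominus>\<^bsub>P' i\<^esub> d' i y)"
      using y by (simp add: cone_differential_def cl mod_hom_zero[OF P.left_modules P.left_modules P.differential])
    then have "c1 (F (Suc i) y) \<oplus>\<^bsub>R\<^esub> c2 (\<ominus>\<^bsub>P' i\<^esub> d' i y) = \<zero>\<^bsub>R\<^esub>"
      using cD[of "(\<zero>\<^bsub>P (Suc (Suc i))\<^esub>, y)"] y by (simp add: c12 cl)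
    moreover have "c2 (\<ominus>\<^bsub>P' i\<^esub> d' i y) = \<ominus>\<^bsub>R\<^esub> c2 (d' i y)"
      using mod_hom_a_inv[OF P'.left_modules regular c2, of "d' i y"] y by (simp add: cl)
    ultimately show ?thesis
      using y mod_homD(1)[OF c1] mod_homD(1)[OF c2] cl
      by (simp add: N'.R.minus_eq[symmetric])
  qed
  obtain b where b: "b \<in> mod_hom R (P i) (regular R)" "\<And>x. x \<in> carrier (P (Suc i)) \<Longrightarrow> c1 x = b (d i x)"
    using dual_acyclicE[OF DA c1] c1d by metis
  note cl' = cl mod_homD(1)[OF c1, simplified] mod_homD(1)[OF c2, simplified] mod_homD(1)[OF b(1), simplified]
  define g where "g y = c2 y \<ominus>\<^bsub>R\<^esub> b (F i y)" for y
  have g: "g \<in> mod_hom R (P' i) (regular R)"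
    using mod_hom_diff[OF regular c2 mod_hom_comp[OF F(1) b(1)]] by (simp add: g_def[abs_def])
  have gd: "g (d' i y) = \<zero>\<^bsub>R\<^esub>" if "y \<in> carrier (P' (Suc i))" for y
    using that b(2)[of "F (Suc i) y"] by (simp add: g_def cl' F(3) c1F)
  have c2g: "c2 y = b (F i y) \<oplus>\<^bsub>R\<^esub> g y" if "y \<in> carrier (P' i)" for y
    using that N'.R.minus_add_minus_cancel(2)[of "c2 y" "b (F i y)"] by (simp add: g_def cl')
  have "\<exists>k \<in> mod_hom R (C i) (regular R). \<forall>p \<in> carrier (P (Suc i)). \<forall>y \<in> carrier (P' i).
    k (D i (p, y)) = b (d i p) \<oplus>\<^bsub>R\<^esub> (b (F i y) \<oplus>\<^bsub>R\<^esub> g y)"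
  proof (cases i)
    case 0
    interpret P0: left_module R "P 0" by (rule P.left_modules)
    have "g x = \<zero>\<^bsub>regular R\<^esub>" if x: "x \<in> carrier (P' 0)" "e' x = \<zero>\<^bsub>N'\<^esub>" for x
    proof -
      obtain y where "y \<in> carrier (P' (Suc 0))" "x = d' 0 y" using x P'.exact_0 by auto
      then show ?thesis using gd unfolding 0 by simp
    qed
    then obtain h where h: "h \<in> mod_hom R N' (regular R)" "\<And>x. x \<in> carrier (P' 0) \<Longrightarrow> h (e' x) = g x"
      using mod_hom_factor_surj[OF P'.left_modules left_modules(1) regular P'.augmentation P'.surj g[unfolded 0]]
      by metis
    obtain t where t: "t \<in> mod_hom R N (regular R)" "\<And>x. x \<in> carrier N' \<Longrightarrow> t (\<iota> x) = h x"
      using ext h(1) unfolding dual_map_surj_iff[OF left_modules(1,2) homs(1)] by metis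
    have te: "(\<lambda>x. t (e x)) \<in> mod_hom R (P 0) (regular R)" by (rule mod_hom_comp[OF P.augmentation t(1)])
    \<comment> \<open>\<open>t\<close> after \<open>e\<close> kills the image of \<open>d 0\<close>
      and takes the value \<open>g y\<close> at \<open>F 0 y\<close>, because e F = \<iota> e' in
      degree 0.\<close>
    let ?k = "\<lambda>x. b (fst x) \<oplus>\<^bsub>regular R\<^esub> t (e (fst x))"
    have k: "?k \<in> mod_hom R (C 0) (regular R)"
      by (intro mod_hom_add regular mod_hom_comp[OF direct_sum_projections(1) te]
          mod_hom_comp[OF direct_sum_projections(1) b(1)[unfolded 0]])
    have "?k (D 0 (p, y)) = b (d 0 p) \<oplus>\<^bsub>R\<^esub> (b (F 0 y) \<oplus>\<^bsub>R\<^esub> g y)"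
      if "p \<in> carrier (P (Suc 0))" "y \<in> carrier (P' 0)" for p y
      using that cl' g mod_homD(1)[OF g, simplified] unfolding 0
      by (simp add: cone_differential_def mod_homD(2)[OF b(1)[unfolded 0]] mod_homD(2)[OF P.augmentation]
          P.augmentation_differential F(2) t(2) h(2) N'.R.a_assoc)
    then show ?thesis unfolding 0 by (intro bexI[OF _ k] ballI)
  next
    case (Suc k)
    have "\<And>x. x \<in> carrier (P' (Suc (Suc k))) \<Longrightarrow> g (d' (Suc k) x) = \<zero>\<^bsub>R\<^esub>" using gd unfolding Suc .
    then obtain b' where b': "b' \<in> mod_hom R (P' k) (regular R)"
        "\<And>x. x \<in> carrier (P' (Suc k)) \<Longrightarrow> g x = b' (d' k x)"
      using dual_acyclicE[OF DA' g[unfolded Suc]] by metis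
    interpret P'k: left_module R "P' k" by (rule P'.left_modules)
    have nb': "(\<lambda>x. \<ominus>\<^bsub>R\<^esub> b' x) \<in> mod_hom R (P' k) (regular R)"
      using mod_hom_minus[OF regular b'(1)] by simp
    \<comment> \<open>The minus sign cancels the one in
      \<open>suspension_differential\<close>.\<close>
    let ?k = "\<lambda>x. b (fst x) \<oplus>\<^bsub>regular R\<^esub> (\<ominus>\<^bsub>R\<^esub> b' (snd x))"
    have k: "?k \<in> mod_hom R (C i) (regular R)"
      unfolding Suc by (rule mod_hom_direct_sum_out[OF regular b(1)[unfolded Suc]]) (simp add: nb')
    have nn: "b' (\<ominus>\<^bsub>P' k\<^esub> x) = \<ominus>\<^bsub>R\<^esub> b' x" if "x \<in> carrier (P' k)" for x
      using mod_hom_a_inv[OF P'.left_modules regular b'(1) that] by simp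
    have "?k (D i (p, y)) = b (d i p) \<oplus>\<^bsub>R\<^esub> (b (F i y) \<oplus>\<^bsub>R\<^esub> g y)"
      if "p \<in> carrier (P (Suc i))" "y \<in> carrier (P' i)" for p y
      using that cl' mod_homD(1)[OF b'(1), simplified] unfolding Suc
      by (simp add: cone_differential_def mod_homD(2)[OF b(1)[unfolded Suc]] nn b'(2) N'.R.a_assoc)
    then show ?thesis by (intro bexI[OF _ k] ballI)
  qed
  then obtain k where k: "k \<in> mod_hom R (C i) (regular R)"
    "\<And>p y. p \<in> carrier (P (Suc i)) \<Longrightarrow> y \<in> carrier (P' i) \<Longrightarrow>
      k (D i (p, y)) = b (d i p) \<oplus>\<^bsub>R\<^esub> (b (F i y) \<oplus>\<^bsub>R\<^esub> g y)" by auto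
  have "c x = k (D i x)" if "x \<in> carrier (C (Suc i))" for x
    using that by (auto simp: c12 k(2) b(2) c2g)
  then show "\<exists>k \<in> mod_hom R (C i) (regular R). \<forall>x \<in> carrier (C (Suc i)). c x = k (D i x)"
    by (intro bexI[OF _ k(1)] ballI)
  qed

text \<open>\<open>h\<close> after \<open>e'\<close> on the second component is a cocycle of degree
  1 on the cone. Writing it as a coboundary gives a functional on \<open>P 0\<close> that vanishes
  on the kernel of \<open>e\<close>, hence a functional on \<open>N\<close>; evaluating the
  coboundary at pairs (0, y) shows that it extends \<open>h\<close>.\<close>

lemma extend_if_dual_acyclic_cone:
  assumes DA: "dual_acyclic R C D" and h: "h \<in> mod_hom R N' (regular R)"
  shows "\<exists>t \<in> mod_hom R N (regular R). \<forall>x \<in> carrier N'. t (\<iota> x) = h x"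
proof -
  interpret P0: left_module R "P 0" by (rule P.left_modules)
  interpret P1: left_module R "P (Suc 0)" by (rule P.left_modules)
  interpret P'0: left_module R "P' 0" by (rule P'.left_modules)
  note cl' = cl mod_homD(1)[OF h, simplified]
  have he: "(\<lambda>x. h (e' (snd x))) \<in> mod_hom R (C (Suc 0)) (regular R)"
    using mod_hom_comp[OF direct_sum_projections(2) mod_hom_comp[OF P'.augmentation h]] by simp
  have "h (e' (snd (D (Suc 0) x))) = \<zero>\<^bsub>R\<^esub>" if "x \<in> carrier (C (Suc (Suc 0)))" for x
    using that mod_hom_zero[OF left_modules(1) regular h]
    by (auto simp: cone_differential_def mod_hom_a_inv[OF P'.left_modules left_modules(1) P'.augmentation]
        cl P'.augmentation_differential mod_hom_a_inv[OF left_modules(1) regular h])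
  then obtain b where b: "b \<in> mod_hom R (C 0) (regular R)"
      "\<And>x. x \<in> carrier (C (Suc 0)) \<Longrightarrow> h (e' (snd x)) = b (D 0 x)"
    using dual_acyclicE[OF DA he] by metis
  let ?b = "\<lambda>p. b (p, \<zero>\<^bsub>P' 0\<^esub>)"
  have b1: "?b \<in> mod_hom R (P 0) (regular R)"
    by (rule mod_hom_comp[OF mod_hom_direct_sum_in[OF mod_hom_id] b(1)]) (auto intro!: mod_homI)
  have bd: "?b p = \<zero>\<^bsub>regular R\<^esub>" if p: "p \<in> carrier (P 0)" "e p = \<zero>\<^bsub>N\<^esub>" for p
  proof -
    obtain z where z: "z \<in> carrier (P (Suc 0))" "p = d 0 z" using p P.exact_0 by auto
    then show ?thesis
      using b(2)[of "(z, \<zero>\<^bsub>P' 0\<^esub>)"] mod_hom_zero[OF left_modules(1) regular h]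
      by (simp add: cone_differential_def cl mod_hom_zero[OF P'.left_modules P.left_modules F(1)]
          mod_hom_zero[OF P'.left_modules left_modules(1) P'.augmentation])
  qed
  obtain t where t: "t \<in> mod_hom R N (regular R)" "\<And>p. p \<in> carrier (P 0) \<Longrightarrow> t (e p) = ?b p"
    using mod_hom_factor_surj[OF P.left_modules left_modules(2) regular P.augmentation P.surj b1 bd] by metis
  have "t (\<iota> x) = h x" if x: "x \<in> carrier N'" for x
  proof -
    obtain y where y: "y \<in> carrier (P' 0)" "x = e' y" using x unfolding P'.surj[symmetric] by auto
    then have "t (\<iota> x) = ?b (F 0 y)" by (simp add: F(2)[symmetric] t(2) cl)
    also have "\<dots> = h x"
      using y b(2)[of "(\<zero>\<^bsub>P (Suc 0)\<^esub>, y)"]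
      by (simp add: cone_differential_def cl mod_hom_zero[OF P.left_modules P.left_modules P.differential])
    finally show ?thesis .
  qed
  then show ?thesis by (intro bexI[OF _ t(1)] ballI)
qed

end

context short_exact_sequence
begin

lemma mapping_cone_exists:
  obtains B' :: "nat \<Rightarrow> ('a + 'b) list set" and d' e' and B :: "nat \<Rightarrow> ('a + 'c) list set" and d e F
  where "mapping_cone R N' N N'' \<iota> q (\<lambda>i. free_module R (B' i)) d' e' (\<lambda>i. free_module R (B i)) d e F"
proof -
  obtain B' :: "nat \<Rightarrow> ('a + 'b) list set" and d' e'
    where P': "projective_resolution R N' (\<lambda>i. free_module R (B' i)) d' e'"
    by (rule projective_resolution_exists[OF left_modules(1)])
  obtain B :: "nat \<Rightarrow> ('a + 'c) list set" and d e
    where P: "projective_resolution R N (\<lambda>i. free_module R (B i)) d e"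
    by (rule projective_resolution_exists[OF left_modules(2)])
  obtain F where F: "\<And>i. F i \<in> mod_hom R (free_module R (B' i)) (free_module R (B i))"
      "\<And>x. x \<in> carrier (free_module R (B' 0)) \<Longrightarrow> e (F 0 x) = \<iota> (e' x)"
      "\<And>i x. x \<in> carrier (free_module R (B' (Suc i))) \<Longrightarrow> d i (F (Suc i) x) = F i (d' i x)"
    using comparison_exists[OF P' P homs(1)] by metis
  have "mapping_cone R N' N N'' \<iota> q (\<lambda>i. free_module R (B' i)) d' e' (\<lambda>i. free_module R (B i)) d e F"
    by (intro mapping_cone.intro mapping_cone_axioms.intro short_exact_sequence_axioms P' P) (fact F)+
  then show thesis by (rule that)
qed

text \<open>Ext^1 of the third term contains the obstruction to extending functionals from
  \<open>N'\<close> to \<open>N\<close>.\<close>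

theorem dual_surj:
  assumes "semi_Gorenstein_projective R N''"
  shows "dual_map N' \<iota> ` carrier (dual R N) = carrier (dual R N')"
proof -
  obtain B' d' e' B d e F
    where "mapping_cone R N' N N'' \<iota> q (\<lambda>i. free_module R (B' i :: ('a + 'b) list set)) d' e'
      (\<lambda>i. free_module R (B i :: ('a + 'c) list set)) d e F"
    by (rule mapping_cone_exists)
  then interpret mapping_cone R N' N N'' \<iota> q "\<lambda>i. free_module R (B' i)" d' e' "\<lambda>i. free_module R (B i)" d e F .
  show ?thesis
    unfolding dual_map_surj_iff[OF left_modules(1,2) homs(1)]
    using assms semi_Gorenstein_projective_iff[OF cone_resolution] extend_if_dual_acyclic_cone by simp
qed

text \<open>In terms of the long exact sequence, \<open>ext\<close> and the vanishing for
  \<open>N\<close> settle degree 1; in higher degrees Ext of the third term lies between Ext of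
  \<open>N'\<close> and Ext of \<open>N\<close>.\<close>

theorem semi_Gorenstein_projective_quotient:
  assumes "semi_Gorenstein_projective R N'" "semi_Gorenstein_projective R N"
    and ext: "dual_map N' \<iota> ` carrier (dual R N) = carrier (dual R N')"
  shows "semi_Gorenstein_projective R N''"
proof -
  obtain B' d' e' B d e F
    where "mapping_cone R N' N N'' \<iota> q (\<lambda>i. free_module R (B' i :: ('a + 'b) list set)) d' e'
      (\<lambda>i. free_module R (B i :: ('a + 'c) list set)) d e F"
    by (rule mapping_cone_exists)
  then interpret mapping_cone R N' N N'' \<iota> q "\<lambda>i. free_module R (B' i)" d' e' "\<lambda>i. free_module R (B i)" d e F .
  show ?thesis
    using assms dual_acyclic_cone semi_Gorenstein_projective_iff[OF cone_resolution]
      semi_Gorenstein_projective_iff[OF P.projective_resolution_axioms]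
      semi_Gorenstein_projective_iff[OF P'.projective_resolution_axioms] by simp
qed

end

section \<open>Modules over the ring of triangular matrices\<close>

lemma T2_simps [simp]:
  "(a1, a2, a3) \<in> carrier (T2 R) \<longleftrightarrow> a1 \<in> carrier R \<and> a2 \<in> carrier R \<and> a3 \<in> carrier R"
  "(a1, a2, a3) \<otimes>\<^bsub>T2 R\<^esub> (b1, b2, b3) = (a1 \<otimes>\<^bsub>R\<^esub> b1, (a1 \<otimes>\<^bsub>R\<^esub> b2) \<oplus>\<^bsub>R\<^esub> (a2 \<otimes>\<^bsub>R\<^esub> b3), a3 \<otimes>\<^bsub>R\<^esub> b3)"
  "(a1, a2, a3) \<oplus>\<^bsub>T2 R\<^esub> (b1, b2, b3) = (a1 \<oplus>\<^bsub>R\<^esub> b1, a2 \<oplus>\<^bsub>R\<^esub> b2, a3 \<oplus>\<^bsub>R\<^esub> b3)"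
  "\<zero>\<^bsub>T2 R\<^esub> = (\<zero>\<^bsub>R\<^esub>, \<zero>\<^bsub>R\<^esub>, \<zero>\<^bsub>R\<^esub>)" "\<one>\<^bsub>T2 R\<^esub> = (\<one>\<^bsub>R\<^esub>, \<zero>\<^bsub>R\<^esub>, \<one>\<^bsub>R\<^esub>)"
  by (auto simp: T2_def)

lemma T2_module_simps [simp]:
  "carrier (T2_module X Y \<phi>) = carrier X \<times> carrier Y"
  "(x, y) \<oplus>\<^bsub>T2_module X Y \<phi>\<^esub> (x', y') = (x \<oplus>\<^bsub>X\<^esub> x', y \<oplus>\<^bsub>Y\<^esub> y')"
  "(a1, a2, a3) \<odot>\<^bsub>T2_module X Y \<phi>\<^esub> (x, y) = ((a1 \<odot>\<^bsub>X\<^esub> x) \<oplus>\<^bsub>X\<^esub> (a2 \<odot>\<^bsub>X\<^esub> \<phi> y), a3 \<odot>\<^bsub>Y\<^esub> y)"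
  "\<zero>\<^bsub>T2_module X Y \<phi>\<^esub> = (\<zero>\<^bsub>X\<^esub>, \<zero>\<^bsub>Y\<^esub>)"
  by (auto simp: T2_module_def)

text \<open>
  A module \<open>W\<close> over \<^term>\<open>T2 R\<close> is the triple of \<open>e\<^sub>1W\<close>, \<open>e\<^sub>2W\<close> and the map \<open>e\<^sub>2W \<rightarrow> e\<^sub>1W\<close> given
  by the matrix unit in the upper right corner.
\<close>

definition top_part :: "('a, 'r) ring_scheme \<Rightarrow> ('a \<times> 'a \<times> 'a, 'w, 'm) module_scheme \<Rightarrow> ('a, 'w) module"
  where "top_part R W = \<lparr>carrier = {x \<in> carrier W. (\<one>\<^bsub>R\<^esub>, \<zero>\<^bsub>R\<^esub>, \<zero>\<^bsub>R\<^esub>) \<odot>\<^bsub>W\<^esub> x = x}, monoid.mult = undefined,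
    one = undefined, zero = \<zero>\<^bsub>W\<^esub>, add = add W, smult = (\<lambda>a x. (a, \<zero>\<^bsub>R\<^esub>, \<zero>\<^bsub>R\<^esub>) \<odot>\<^bsub>W\<^esub> x)\<rparr>"

definition bottom_part :: "('a, 'r) ring_scheme \<Rightarrow> ('a \<times> 'a \<times> 'a, 'w, 'm) module_scheme \<Rightarrow> ('a, 'w) module"
  where "bottom_part R W = \<lparr>carrier = {x \<in> carrier W. (\<zero>\<^bsub>R\<^esub>, \<zero>\<^bsub>R\<^esub>, \<one>\<^bsub>R\<^esub>) \<odot>\<^bsub>W\<^esub> x = x}, monoid.mult = undefined,
    one = undefined, zero = \<zero>\<^bsub>W\<^esub>, add = add W, smult = (\<lambda>a x. (\<zero>\<^bsub>R\<^esub>, \<zero>\<^bsub>R\<^esub>, a) \<odot>\<^bsub>W\<^esub> x)\<rparr>"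

definition link :: "('a, 'r) ring_scheme \<Rightarrow> ('a \<times> 'a \<times> 'a, 'w, 'm) module_scheme \<Rightarrow> 'w \<Rightarrow> 'w"
  where "link R W x = (\<zero>\<^bsub>R\<^esub>, \<one>\<^bsub>R\<^esub>, \<zero>\<^bsub>R\<^esub>) \<odot>\<^bsub>W\<^esub> x"

definition to_top :: "('a, 'r) ring_scheme \<Rightarrow> ('a \<times> 'a \<times> 'a, 'w, 'm) module_scheme \<Rightarrow> 'w \<Rightarrow> 'w"
  where "to_top R W x = (\<one>\<^bsub>R\<^esub>, \<zero>\<^bsub>R\<^esub>, \<zero>\<^bsub>R\<^esub>) \<odot>\<^bsub>W\<^esub> x"

definition to_bottom :: "('a, 'r) ring_scheme \<Rightarrow> ('a \<times> 'a \<times> 'a, 'w, 'm) module_scheme \<Rightarrow> 'w \<Rightarrow> 'w"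
  where "to_bottom R W x = (\<zero>\<^bsub>R\<^esub>, \<zero>\<^bsub>R\<^esub>, \<one>\<^bsub>R\<^esub>) \<odot>\<^bsub>W\<^esub> x"

lemma part_simps [simp]:
  "add (top_part R W) = add W" "\<zero>\<^bsub>top_part R W\<^esub> = \<zero>\<^bsub>W\<^esub>" "a \<odot>\<^bsub>top_part R W\<^esub> x = (a, \<zero>\<^bsub>R\<^esub>, \<zero>\<^bsub>R\<^esub>) \<odot>\<^bsub>W\<^esub> x"
  "add (bottom_part R W) = add W" "\<zero>\<^bsub>bottom_part R W\<^esub> = \<zero>\<^bsub>W\<^esub>"
  "a \<odot>\<^bsub>bottom_part R W\<^esub> x = (\<zero>\<^bsub>R\<^esub>, \<zero>\<^bsub>R\<^esub>, a) \<odot>\<^bsub>W\<^esub> x"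
  by (simp_all add: top_part_def bottom_part_def)

lemma part_carrier:
  "x \<in> carrier (top_part R W) \<longleftrightarrow> x \<in> carrier W \<and> to_top R W x = x"
  "x \<in> carrier (bottom_part R W) \<longleftrightarrow> x \<in> carrier W \<and> to_bottom R W x = x"
  by (simp_all add: top_part_def bottom_part_def to_top_def to_bottom_def)

locale triangular_module =
  fixes R :: "('a, 'r) ring_scheme" (structure) and W :: "('a \<times> 'a \<times> 'a, 'w, 'm) module_scheme"
  assumes ring: "ring R" and module: "left_module (T2 R) W"
begin

sublocale R: ring R by (rule ring)
sublocale W: left_module "T2 R" W by (rule module)

abbreviation "Top \<equiv> top_part R W"
abbreviation "Bottom \<equiv> bottom_part R W"

lemma part_carrierD:
  "x \<in> carrier (top_part R W) \<Longrightarrow> x \<in> carrier W" "x \<in> carrier (bottom_part R W) \<Longrightarrow> x \<in> carrier W"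
  by (simp_all add: part_carrier)

lemma smult_smult:
  assumes "a1 \<in> carrier R" "a2 \<in> carrier R" "a3 \<in> carrier R" "b1 \<in> carrier R" "b2 \<in> carrier R" "b3 \<in> carrier R"
    and "x \<in> carrier W"
  shows "(a1, a2, a3) \<odot>\<^bsub>W\<^esub> ((b1, b2, b3) \<odot>\<^bsub>W\<^esub> x) =
    (a1 \<otimes> b1, (a1 \<otimes> b2) \<oplus> (a2 \<otimes> b3), a3 \<otimes> b3) \<odot>\<^bsub>W\<^esub> x"
  using assms W.smult_assoc1[of "(a1, a2, a3)" "(b1, b2, b3)" x] by simp

lemma smult_add:
  assumes "a1 \<in> carrier R" "a2 \<in> carrier R" "a3 \<in> carrier R" "b1 \<in> carrier R" "b2 \<in> carrier R" "b3 \<in> carrier R"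
    and "x \<in> carrier W"
  shows "(a1, a2, a3) \<odot>\<^bsub>W\<^esub> x \<oplus>\<^bsub>W\<^esub> (b1, b2, b3) \<odot>\<^bsub>W\<^esub> x = (a1 \<oplus> b1, a2 \<oplus> b2, a3 \<oplus> b3) \<odot>\<^bsub>W\<^esub> x"
  using assms W.smult_l_distr[of "(a1, a2, a3)" "(b1, b2, b3)" x] by simp

lemma smult_zero [simp]: "x \<in> carrier W \<Longrightarrow> (\<zero>, \<zero>, \<zero>) \<odot>\<^bsub>W\<^esub> x = \<zero>\<^bsub>W\<^esub>"
  using W.smult_l_null[of x] by simp

lemmas unfolds = link_def to_top_def to_bottom_def

lemma left_module_parts: "left_module R Top" "left_module R Bottom"
proof -
  have "abelian_group Top"
  proof (rule abelian_groupI)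
    fix x assume x: "x \<in> carrier Top"
    then have "\<ominus>\<^bsub>W\<^esub> x \<in> carrier Top" by (simp add: part_carrier to_top_def W.smult_r_minus)
    then show "\<exists>y\<in>carrier Top. y \<oplus>\<^bsub>Top\<^esub> x = \<zero>\<^bsub>Top\<^esub>"
      using x by (intro bexI[of _ "\<ominus>\<^bsub>W\<^esub> x"]) (auto simp: W.M.l_neg dest: part_carrierD)
  qed (auto simp: part_carrier to_top_def W.M.a_ac W.smult_r_distr)
  then show "left_module R Top"
  proof (intro left_module.intro left_module_axioms.intro ring)
    show "a \<odot>\<^bsub>Top\<^esub> x \<in> carrier Top" if "a \<in> carrier R" "x \<in> carrier Top" for a x
      using that by (simp add: part_carrier to_top_def smult_smult)
  qed (auto simp: part_carrier W.smult_r_distr smult_add smult_smult, simp add: part_carrier to_top_def)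
  have "abelian_group Bottom"
  proof (rule abelian_groupI)
    fix x assume x: "x \<in> carrier Bottom"
    then have "\<ominus>\<^bsub>W\<^esub> x \<in> carrier Bottom" by (simp add: part_carrier to_bottom_def W.smult_r_minus)
    then show "\<exists>y\<in>carrier Bottom. y \<oplus>\<^bsub>Bottom\<^esub> x = \<zero>\<^bsub>Bottom\<^esub>"
      using x by (intro bexI[of _ "\<ominus>\<^bsub>W\<^esub> x"]) (auto simp: W.M.l_neg dest: part_carrierD)
  qed (auto simp: part_carrier to_bottom_def W.M.a_ac W.smult_r_distr)
  then show "left_module R Bottom"
  proof (intro left_module.intro left_module_axioms.intro ring)
    show "a \<odot>\<^bsub>Bottom\<^esub> x \<in> carrier Bottom" if "a \<in> carrier R" "x \<in> carrier Bottom" for a x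
      using that by (simp add: part_carrier to_bottom_def smult_smult)
  qed (auto simp: part_carrier W.smult_r_distr smult_add smult_smult, simp add: part_carrier to_bottom_def)
qed

lemma closed [simp]:
  "x \<in> carrier W \<Longrightarrow> to_top R W x \<in> carrier Top"
  "x \<in> carrier W \<Longrightarrow> to_bottom R W x \<in> carrier Bottom"
  "x \<in> carrier W \<Longrightarrow> link R W x \<in> carrier Top"
  by (simp_all add: part_carrier unfolds smult_smult)

lemma to_parts [simp]:
  "x \<in> carrier Top \<Longrightarrow> to_top R W x = x" "x \<in> carrier Bottom \<Longrightarrow> to_bottom R W x = x"
  "x \<in> carrier W \<Longrightarrow> link R W (to_bottom R W x) = link R W x"
  by (simp_all add: part_carrier) (simp add: unfolds smult_smult)

lemma top_link_bottom [simp]: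
  "x \<in> carrier Top \<Longrightarrow> link R W x = \<zero>\<^bsub>W\<^esub>" "x \<in> carrier Top \<Longrightarrow> to_bottom R W x = \<zero>\<^bsub>W\<^esub>"
  "x \<in> carrier Bottom \<Longrightarrow> to_top R W x = \<zero>\<^bsub>W\<^esub>"
proof -
  show "link R W x = \<zero>\<^bsub>W\<^esub>" "to_bottom R W x = \<zero>\<^bsub>W\<^esub>" if "x \<in> carrier Top"
    using that smult_smult[of "\<zero>" "\<one>" "\<zero>" "\<one>" "\<zero>" "\<zero>" x]
      smult_smult[of "\<zero>" "\<zero>" "\<one>" "\<one>" "\<zero>" "\<zero>" x]
    by (simp_all add: part_carrier unfolds)
  show "to_top R W x = \<zero>\<^bsub>W\<^esub>" if "x \<in> carrier Bottom"
    using that smult_smult[of "\<one>" "\<zero>" "\<zero>" "\<zero>" "\<zero>" "\<one>" x]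
    by (simp add: part_carrier unfolds)
qed

declare part_carrierD [simp]

lemma parts_add [simp]:
  assumes "x \<in> carrier W" "y \<in> carrier W"
  shows "to_top R W (x \<oplus>\<^bsub>W\<^esub> y) = to_top R W x \<oplus>\<^bsub>W\<^esub> to_top R W y"
    "to_bottom R W (x \<oplus>\<^bsub>W\<^esub> y) = to_bottom R W x \<oplus>\<^bsub>W\<^esub> to_bottom R W y"
    "link R W (x \<oplus>\<^bsub>W\<^esub> y) = link R W x \<oplus>\<^bsub>W\<^esub> link R W y"
  using assms by (simp_all add: unfolds W.smult_r_distr)

text \<open>The matrix action read entry by entry: the corner entry acts only through the
  link.\<close>

lemma parts_smult:
  assumes "a1 \<in> carrier R" "a2 \<in> carrier R" "a3 \<in> carrier R" "x \<in> carrier W"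
  shows "to_top R W ((a1, a2, a3) \<odot>\<^bsub>W\<^esub> x) =
      (a1, \<zero>, \<zero>) \<odot>\<^bsub>W\<^esub> to_top R W x \<oplus>\<^bsub>W\<^esub> (a2, \<zero>, \<zero>) \<odot>\<^bsub>W\<^esub> link R W x"
    "to_bottom R W ((a1, a2, a3) \<odot>\<^bsub>W\<^esub> x) = (\<zero>, \<zero>, a3) \<odot>\<^bsub>W\<^esub> to_bottom R W x"
    "link R W ((a1, a2, a3) \<odot>\<^bsub>W\<^esub> x) = (a3, \<zero>, \<zero>) \<odot>\<^bsub>W\<^esub> link R W x"
  using assms by (simp_all add: unfolds smult_smult smult_add)

lemma link_hom: "link R W \<in> mod_hom R Bottom Top"
proof (rule mod_homI)
  fix a x assume "a \<in> carrier R" "x \<in> carrier Bottom"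
  then show "link R W (a \<odot>\<^bsub>Bottom\<^esub> x) = a \<odot>\<^bsub>Top\<^esub> link R W x"
    by (simp add: parts_smult)
qed simp_all

text \<open>One half of the description of maps into a triple by compatible pairs of maps on the
  parts; \<open>hom_from_T2_module\<close> is the other half.\<close>

lemma hom_into_T2_module:
  assumes "left_module R U" "left_module R V" and \<psi>: "\<psi> \<in> mod_hom R V U"
    and u: "u \<in> mod_hom R Top U" and v: "v \<in> mod_hom R Bottom V"
    and uv: "\<And>y. y \<in> carrier Bottom \<Longrightarrow> u (link R W y) = \<psi> (v y)"
  shows "(\<lambda>w. (u (to_top R W w), v (to_bottom R W w))) \<in> mod_hom (T2 R) W (T2_module U V \<psi>)"
proof (rule mod_homI)
  note u' = mod_homD[OF u, simplified] and v' = mod_homD[OF v, simplified]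
  fix w assume w: "w \<in> carrier W"
  then show "(u (to_top R W w), v (to_bottom R W w)) \<in> carrier (T2_module U V \<psi>)" by (simp add: u' v')
  fix w' assume "w' \<in> carrier W"
  with w show "(u (to_top R W (w \<oplus>\<^bsub>W\<^esub> w')), v (to_bottom R W (w \<oplus>\<^bsub>W\<^esub> w'))) =
      (u (to_top R W w), v (to_bottom R W w)) \<oplus>\<^bsub>T2_module U V \<psi>\<^esub> (u (to_top R W w'), v (to_bottom R W w'))"
    by (simp add: u' v')
next
  note u' = mod_homD[OF u, simplified] and v' = mod_homD[OF v, simplified]
  interpret T: left_module R Top by (rule left_module_parts)
  fix a w assume "a \<in> carrier (T2 R)" and w: "w \<in> carrier W"
  then obtain a1 a2 a3 where a: "a = (a1, a2, a3)" "a1 \<in> carrier R" "a2 \<in> carrier R" "a3 \<in> carrier R"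
    by (cases a) auto
  have "u (link R W w) = \<psi> (v (to_bottom R W w))" using uv[of "to_bottom R W w"] w by simp
  moreover have "(b, \<zero>, \<zero>) \<odot>\<^bsub>W\<^esub> x \<in> carrier Top"
    if "b \<in> carrier R" "x \<in> carrier Top" for b x
    using T.smult_closed[OF that] by simp
  ultimately show "(u (to_top R W (a \<odot>\<^bsub>W\<^esub> w)), v (to_bottom R W (a \<odot>\<^bsub>W\<^esub> w))) =
      a \<odot>\<^bsub>T2_module U V \<psi>\<^esub> (u (to_top R W w), v (to_bottom R W w))"
    using a w by (simp add: parts_smult u' v')
qed

lemma hom_from_T2_module:
  assumes "left_module R U" "left_module R V" and \<psi>: "\<psi> \<in> mod_hom R V U"
    and h: "h \<in> mod_hom (T2 R) W (T2_module U V \<psi>)"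
  shows "(\<lambda>x. fst (h x)) \<in> mod_hom R Top U" "(\<lambda>x. snd (h x)) \<in> mod_hom R Bottom V"
    and "x \<in> carrier Top \<Longrightarrow> snd (h x) = \<zero>\<^bsub>V\<^esub>"
    and "x \<in> carrier Bottom \<Longrightarrow> fst (h x) = \<zero>\<^bsub>U\<^esub>"
    and "x \<in> carrier W \<Longrightarrow> fst (h (to_top R W x)) = fst (h x)"
    and "x \<in> carrier W \<Longrightarrow> snd (h (to_bottom R W x)) = snd (h x)"
    and "x \<in> carrier W \<Longrightarrow> fst (h (link R W x)) = \<psi> (snd (h x))"
proof -
  interpret U: left_module R U by fact
  interpret V: left_module R V by fact
  note h' = mod_homD[OF h]
  have hc: "\<exists>u v. h x = (u, v) \<and> u \<in> carrier U \<and> v \<in> carrier V \<and> \<psi> v \<in> carrier U" if "x \<in> carrier W" for x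
    using h'(1)[OF that] mod_homD(1)[OF \<psi>] by (cases "h x") auto
  have h_smult: "h ((a1, a2, a3) \<odot>\<^bsub>W\<^esub> x) = ((a1 \<odot>\<^bsub>U\<^esub> fst (h x)) \<oplus>\<^bsub>U\<^esub> (a2 \<odot>\<^bsub>U\<^esub> \<psi> (snd (h x))), a3 \<odot>\<^bsub>V\<^esub> snd (h x))"
    if "x \<in> carrier W" "a1 \<in> carrier R" "a2 \<in> carrier R" "a3 \<in> carrier R" for x a1 a2 a3
    using h'(3)[OF that(1), of "(a1, a2, a3)"] hc[OF that(1)] that by auto
  show 1: "fst (h (to_top R W x)) = fst (h x)" "snd (h (to_bottom R W x)) = snd (h x)"
      "fst (h (link R W x)) = \<psi> (snd (h x))" if "x \<in> carrier W" for x
    using hc[OF that] that by (auto simp: unfolds h_smult)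
  have 2: "snd (h (to_top R W x)) = \<zero>\<^bsub>V\<^esub>" "fst (h (to_bottom R W x)) = \<zero>\<^bsub>U\<^esub>" if "x \<in> carrier W" for x
    using hc[OF that] that by (auto simp: unfolds h_smult)
  show "x \<in> carrier Top \<Longrightarrow> snd (h x) = \<zero>\<^bsub>V\<^esub>"
    "x \<in> carrier Bottom \<Longrightarrow> fst (h x) = \<zero>\<^bsub>U\<^esub>" for x
    using 2[of x] by simp_all
  have add: "h (x \<oplus>\<^bsub>W\<^esub> y) = (fst (h x) \<oplus>\<^bsub>U\<^esub> fst (h y), snd (h x) \<oplus>\<^bsub>V\<^esub> snd (h y))"
    if "x \<in> carrier W" "y \<in> carrier W" for x y
    using h'(2)[OF that] hc[OF that(1)] hc[OF that(2)] by auto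
  show "(\<lambda>x. fst (h x)) \<in> mod_hom R Top U"
  proof (rule mod_homI)
    show "fst (h x) \<in> carrier U" if "x \<in> carrier Top" for x
      using hc[of x] that by auto
    show "fst (h (a \<odot>\<^bsub>Top\<^esub> x)) = a \<odot>\<^bsub>U\<^esub> fst (h x)" if "a \<in> carrier R" "x \<in> carrier Top" for a x
      using hc[of x] that by (auto simp: h_smult)
  qed (simp add: add)
  show "(\<lambda>x. snd (h x)) \<in> mod_hom R Bottom V"
  proof (rule mod_homI)
    show "snd (h x) \<in> carrier V" if "x \<in> carrier Bottom" for x
      using hc[of x] that by auto
    show "snd (h (a \<odot>\<^bsub>Bottom\<^esub> x)) = a \<odot>\<^bsub>V\<^esub> snd (h x)" if "a \<in> carrier R" "x \<in> carrier Bottom" for a x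
      using hc[of x] that by (auto simp: h_smult)
  qed (simp add: add)
qed

text \<open>The columns of the matrix ring are the summands (A, 0) and (A, A). The component in (A,
  0) is \<open>f\<close>, which must kill the image of the link because the lower entry is 0. The
  component in (A, A) is determined by its upper half \<open>g\<close>: the lower half is
  \<open>g\<close> after the link.\<close>

lemma hom_into_regular:
  assumes f: "f \<in> mod_hom R Top (regular R)" and g: "g \<in> mod_hom R Top (regular R)"
    and fl: "\<And>y. y \<in> carrier Bottom \<Longrightarrow> f (link R W y) = \<zero>"
  shows "(\<lambda>w. (f (to_top R W w), g (to_top R W w), g (link R W w))) \<in> mod_hom (T2 R) W (regular (T2 R))"
proof (rule mod_homI)
  note f' = mod_homD[OF f, simplified] and g' = mod_homD[OF g, simplified]
  fix w assume w: "w \<in> carrier W"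
  then show "(f (to_top R W w), g (to_top R W w), g (link R W w)) \<in> carrier (regular (T2 R))" by (simp add: f' g')
  fix w' assume "w' \<in> carrier W"
  with w show "(f (to_top R W (w \<oplus>\<^bsub>W\<^esub> w')), g (to_top R W (w \<oplus>\<^bsub>W\<^esub> w')), g (link R W (w \<oplus>\<^bsub>W\<^esub> w'))) =
      (f (to_top R W w), g (to_top R W w), g (link R W w)) \<oplus>\<^bsub>regular (T2 R)\<^esub>
      (f (to_top R W w'), g (to_top R W w'), g (link R W w'))"
    by (simp add: f' g')
next
  note f' = mod_homD[OF f, simplified] and g' = mod_homD[OF g, simplified]
  interpret T: left_module R Top by (rule left_module_parts)
  fix a w assume "a \<in> carrier (T2 R)" and w: "w \<in> carrier W"
  then obtain a1 a2 a3 where a: "a = (a1, a2, a3)" "a1 \<in> carrier R" "a2 \<in> carrier R" "a3 \<in> carrier R"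
    by (cases a) auto
  have "f (link R W w) = \<zero>" using fl[of "to_bottom R W w"] w by simp
  moreover have "(b, \<zero>, \<zero>) \<odot>\<^bsub>W\<^esub> x \<in> carrier Top"
    if "b \<in> carrier R" "x \<in> carrier Top" for b x
    using T.smult_closed[OF that] by simp
  ultimately show "(f (to_top R W (a \<odot>\<^bsub>W\<^esub> w)), g (to_top R W (a \<odot>\<^bsub>W\<^esub> w)), g (link R W (a \<odot>\<^bsub>W\<^esub> w))) =
      a \<odot>\<^bsub>regular (T2 R)\<^esub> (f (to_top R W w), g (to_top R W w), g (link R W w))"
    using a w by (simp add: parts_smult f' g')
qed

lemma hom_from_regular:
  assumes c: "c \<in> mod_hom (T2 R) W (regular (T2 R))"
  shows "(\<lambda>x. fst (c x)) \<in> mod_hom R Top (regular R)"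
    and "(\<lambda>x. fst (snd (c x))) \<in> mod_hom R Top (regular R)"
    and "y \<in> carrier W \<Longrightarrow> fst (c (link R W y)) = \<zero>"
    and "w \<in> carrier W \<Longrightarrow> c w = (fst (c (to_top R W w)), fst (snd (c (to_top R W w))), fst (snd (c (link R W w))))"
proof -
  note c' = mod_homD[OF c]
  have cc: "\<exists>u v z. c x = (u, v, z) \<and> u \<in> carrier R \<and> v \<in> carrier R \<and> z \<in> carrier R" if "x \<in> carrier W" for x
    using c'(1)[OF that] by (cases "c x") auto
  have c_smult: "c ((a1, a2, a3) \<odot>\<^bsub>W\<^esub> x) = (a1 \<otimes> fst (c x),
      (a1 \<otimes> fst (snd (c x))) \<oplus> (a2 \<otimes> snd (snd (c x))), a3 \<otimes> snd (snd (c x)))"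
    if "x \<in> carrier W" "a1 \<in> carrier R" "a2 \<in> carrier R" "a3 \<in> carrier R" for x a1 a2 a3
    using c'(3)[OF that(1), of "(a1, a2, a3)"] cc[OF that(1)] that by auto
  have add: "c (x \<oplus>\<^bsub>W\<^esub> y) = (fst (c x) \<oplus> fst (c y), fst (snd (c x)) \<oplus> fst (snd (c y)),
      snd (snd (c x)) \<oplus> snd (snd (c y)))" if "x \<in> carrier W" "y \<in> carrier W" for x y
    using c'(2)[OF that] cc[OF that(1)] cc[OF that(2)] by auto
  show "fst (c (link R W y)) = \<zero>" if "y \<in> carrier W" for y
    using cc[OF that] that by (auto simp: unfolds c_smult)
  show "c w = (fst (c (to_top R W w)), fst (snd (c (to_top R W w))), fst (snd (c (link R W w))))"
    if "w \<in> carrier W" for w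
    using cc[OF that] that by (auto simp: unfolds c_smult)
  show "(\<lambda>x. fst (c x)) \<in> mod_hom R Top (regular R)"
  proof (rule mod_homI)
    show "fst (c x) \<in> carrier (regular R)" if "x \<in> carrier Top" for x
      using cc[of x] that by auto
    show "fst (c (a \<odot>\<^bsub>Top\<^esub> x)) = a \<odot>\<^bsub>regular R\<^esub> fst (c x)" if "a \<in> carrier R" "x \<in> carrier Top" for a x
      using that by (simp add: c_smult)
  qed (simp add: add)
  show "(\<lambda>x. fst (snd (c x))) \<in> mod_hom R Top (regular R)"
  proof (rule mod_homI)
    show "fst (snd (c x)) \<in> carrier (regular R)" if "x \<in> carrier Top" for x
      using cc[of x] that by auto
    show "fst (snd (c (a \<odot>\<^bsub>Top\<^esub> x))) = a \<odot>\<^bsub>regular R\<^esub> fst (snd (c x))"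
      if "a \<in> carrier R" "x \<in> carrier Top" for a x
      using cc[of x] that by (auto simp: c_smult)
  qed (simp add: add)
qed

lemma T2_module_map:
  assumes "f \<in> mod_hom R U U'" "g \<in> mod_hom R V V'" "\<And>v. v \<in> carrier V \<Longrightarrow> f (\<psi> v) = \<psi>' (g v)"
    and "left_module R U" "\<psi> \<in> mod_hom R V U"
  shows "(\<lambda>x. (f (fst x), g (snd x))) \<in> mod_hom (T2 R) (T2_module U V \<psi>) (T2_module U' V' \<psi>')"
proof -
  interpret U: left_module R U by fact
  show ?thesis
    by (rule mod_homI)
       (auto simp: mod_homD[OF assms(1)] mod_homD[OF assms(2)] assms(3) mod_homD[OF assms(5)])
qed

text \<open>Projectivity of \<open>W\<close> spelled out for an epimorphism of triples. Projectivity
  of the two parts and extension along the link follow by feeding in triples made for the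
  purpose.\<close>

lemma lift_parts:
  assumes proj: "projective (T2 R) W"
    and modules: "left_module R U" "left_module R V" "left_module R U'" "left_module R V'"
    and \<psi>: "\<psi> \<in> mod_hom R V U" "\<psi>' \<in> mod_hom R V' U'"
    and f: "f \<in> mod_hom R U U'" "f ` carrier U = carrier U'"
    and g: "g \<in> mod_hom R V V'" "g ` carrier V = carrier V'"
    and fg: "\<And>v. v \<in> carrier V \<Longrightarrow> f (\<psi> v) = \<psi>' (g v)"
    and u: "u \<in> mod_hom R Top U'" and v: "v \<in> mod_hom R Bottom V'"
    and uv: "\<And>y. y \<in> carrier Bottom \<Longrightarrow> u (link R W y) = \<psi>' (v y)"
  obtains l m where "l \<in> mod_hom R Top U" "m \<in> mod_hom R Bottom V"
    "\<And>x. x \<in> carrier Top \<Longrightarrow> f (l x) = u x"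
    "\<And>y. y \<in> carrier Bottom \<Longrightarrow> g (m y) = v y"
    "\<And>y. y \<in> carrier Bottom \<Longrightarrow> l (link R W y) = \<psi> (m y)"
proof -
  let ?F = "\<lambda>x. (f (fst x), g (snd x))" and ?k = "\<lambda>w. (u (to_top R W w), v (to_bottom R W w))"
  note UV = left_module_T2_module[OF modules(1,2) \<psi>(1)] and UV' = left_module_T2_module[OF modules(3,4) \<psi>(2)]
  have F: "?F \<in> mod_hom (T2 R) (T2_module U V \<psi>) (T2_module U' V' \<psi>')"
    by (rule T2_module_map[OF f(1) g(1) fg modules(1) \<psi>(1)])
  have k: "?k \<in> mod_hom (T2 R) W (T2_module U' V' \<psi>')"
    by (rule hom_into_T2_module[OF modules(3,4) \<psi>(2) u v uv])
  have "z \<in> ?F ` carrier (T2_module U V \<psi>)" if z: "z \<in> carrier (T2_module U' V' \<psi>')" for z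
  proof -
    have "fst z \<in> f ` carrier U" "snd z \<in> g ` carrier V" unfolding f(2) g(2) using z by auto
    then show ?thesis by (cases z) force
  qed
  then have "?k ` carrier W \<subseteq> ?F ` carrier (T2_module U V \<psi>)"
    using mod_homD(1)[OF k] by blast
  then obtain h where h: "h \<in> mod_hom (T2 R) W (T2_module U V \<psi>)" "\<And>w. w \<in> carrier W \<Longrightarrow> ?F (h w) = ?k w"
    using projective_lift[OF UV UV' module proj F k] by metis
  note h' = hom_from_T2_module[OF modules(1,2) \<psi>(1) h(1)]
  show thesis
  proof (rule that[OF h'(1,2)])
    show "f (fst (h x)) = u x" if "x \<in> carrier Top" for x
      using h(2)[of x] that by simp
    show "g (snd (h y)) = v y" if "y \<in> carrier Bottom" for y
      using h(2)[of y] that by simp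
    show "fst (h (link R W y)) = \<psi> (snd (h y))" if "y \<in> carrier Bottom" for y
      using h'(7)[of y] that by simp
  qed
qed

lemma projective_top:
  assumes "projective (T2 R) W"
  shows "projective R Top"
proof (rule projectiveI[OF left_module_parts(1)])
  note T = left_module_parts(1)
  fix B :: "'w set" and g
  assume g: "g \<in> mod_hom R (free_module R B) Top" "g ` carrier (free_module R B) = carrier Top"
  note E = left_module_free_module[OF ring, of B]
  \<comment> \<open>The two triples have identity links, on the free module and on
    \<open>Top\<close>, and the epimorphism is \<open>g\<close> in both components. The map to be
    lifted is the identity on \<open>Top\<close> and the link on \<open>Bottom\<close>.\<close>
  obtain l m where "l \<in> mod_hom R Top (free_module R B)" "m \<in> mod_hom R Bottom (free_module R B)"
    "\<And>x. x \<in> carrier Top \<Longrightarrow> g (l x) = x"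
    using lift_parts[OF assms E E T T mod_hom_id mod_hom_id g g _ mod_hom_id link_hom] by metis
  then show "\<exists>s \<in> mod_hom R Top (free_module R B). \<forall>x\<in>carrier Top. g (s x) = x"
    by (intro bexI[of _ l]) simp_all
qed

lemma projective_bottom:
  assumes "projective (T2 R) W"
  shows "projective R Bottom"
proof (rule projectiveI[OF left_module_parts(2)])
  fix B :: "'w set" and g
  assume g: "g \<in> mod_hom R (free_module R B) Bottom" "g ` carrier (free_module R B) = carrier Bottom"
  note E = left_module_free_module[OF ring, of B] and Z = zero_submodule(1)[OF left_module_regular[OF ring]]
  note c = mod_hom_const_zero[OF Z]
  \<comment> \<open>The upper components of both triples are zero here, so only the lift of the
    identity of \<open>Bottom\<close> carries information.\<close>
  obtain l m where "l \<in> mod_hom R Top ((regular R)\<lparr>carrier := {\<zero>\<^bsub>regular R\<^esub>}\<rparr>)"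
    "m \<in> mod_hom R Bottom (free_module R B)"
    "\<And>y. y \<in> carrier Bottom \<Longrightarrow> g (m y) = y"
    using lift_parts[OF assms Z E Z left_module_parts(2) c c mod_hom_id _ g _ c mod_hom_id] by (metis image_ident)
  then show "\<exists>s \<in> mod_hom R Bottom (free_module R B). \<forall>x\<in>carrier Bottom. g (s x) = x"
    by (intro bexI[of _ m]) simp_all
qed

text \<open>The map from \<open>W\<close> to (0, A) given by \<open>h\<close> lifts along the
  epimorphism (A, A) -> (0, A); the upper half of the lift is the extension.\<close>

lemma extend_along_link:
  assumes "projective (T2 R) W" and h: "h \<in> mod_hom R Bottom (regular R)"
  obtains g where "g \<in> mod_hom R Top (regular R)"
    "\<And>y. y \<in> carrier Bottom \<Longrightarrow> g (link R W y) = h y"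
proof -
  let ?Z = "(regular R)\<lparr>carrier := {\<zero>\<^bsub>regular R\<^esub>}\<rparr>"
  note A = left_module_regular[OF ring]
  note Z = zero_submodule(1)[OF A]
  note c = mod_hom_const_zero[OF Z]
  have "(\<lambda>_. \<zero>\<^bsub>?Z\<^esub>) ` carrier (regular R) = carrier ?Z" using R.zero_closed by auto
  then obtain l m where l: "l \<in> mod_hom R Top (regular R)"
    and m: "\<And>y. y \<in> carrier Bottom \<Longrightarrow> m y = h y" "\<And>y. y \<in> carrier Bottom \<Longrightarrow> l (link R W y) = m y"
    using lift_parts[OF assms(1) A A Z A mod_hom_id c c _ mod_hom_id _ _ c h] by (metis image_ident)
  show thesis by (rule that[OF l]) (simp add: m)
qed

lemma hom_parts:
  assumes "triangular_module R W'" "h \<in> mod_hom (T2 R) W W'"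
  shows "h \<in> mod_hom R Top (top_part R W')" "h \<in> mod_hom R Bottom (bottom_part R W')"
    and "x \<in> carrier W \<Longrightarrow> h (to_top R W x) = to_top R W' (h x)"
    and "x \<in> carrier W \<Longrightarrow> h (to_bottom R W x) = to_bottom R W' (h x)"
    and "x \<in> carrier W \<Longrightarrow> h (link R W x) = link R W' (h x)"
proof -
  interpret W': triangular_module R W' by fact
  note h' = mod_homD[OF assms(2)]
  show *: "h (to_top R W x) = to_top R W' (h x)" "h (to_bottom R W x) = to_bottom R W' (h x)"
    "h (link R W x) = link R W' (h x)" if "x \<in> carrier W" for x
    using that by (simp_all add: unfolds h')
  show "h \<in> mod_hom R Top (top_part R W')"
  proof (rule mod_homI)
    fix x assume x: "x \<in> carrier Top"
    then have "h x = to_top R W' (h x)" using *(1)[of x] by simp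
    also have "\<dots> \<in> carrier (top_part R W')" using x by (simp add: h')
    finally show "h x \<in> carrier (top_part R W')" .
  qed (simp_all add: h')
  show "h \<in> mod_hom R Bottom (bottom_part R W')"
  proof (rule mod_homI)
    fix x assume x: "x \<in> carrier Bottom"
    then have "h x = to_bottom R W' (h x)" using *(2)[of x] by simp
    also have "\<dots> \<in> carrier (bottom_part R W')" using x by (simp add: h')
    finally show "h x \<in> carrier (bottom_part R W')" .
  qed (simp_all add: h')
qed

end

text \<open>The retractions \<open>r\<close> commute with the differentials, so a preimage of an
  element of \<open>Q\<close> can be pushed into \<open>Q\<close>, and exactness is inherited. The
  rings \<open>S\<close> and \<open>R\<close> are kept apart because idempotent parts of
  \<open>T2 R\<close>-modules are \<open>R\<close>-modules.\<close>

lemma projective_resolution_retract: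
  assumes "projective_resolution S N P d e"
    and L: "left_module R L"
    and Q: "\<And>i. left_module R (Q i)" "\<And>i. projective R (Q i)" "\<And>i. d i \<in> mod_hom R (Q (Suc i)) (Q i)"
    and \<epsilon>: "\<epsilon> \<in> mod_hom R (Q 0) L" "\<epsilon> ` carrier (Q 0) = carrier L"
      "\<And>x. x \<in> carrier (Q 0) \<Longrightarrow> \<epsilon> x = \<zero>\<^bsub>L\<^esub> \<longleftrightarrow> e x = \<zero>\<^bsub>N\<^esub>"
    and sub: "\<And>i x. x \<in> carrier (Q i) \<Longrightarrow> x \<in> carrier (P i)" "\<And>i. \<zero>\<^bsub>Q i\<^esub> = \<zero>\<^bsub>P i\<^esub>"
    and r: "\<And>i x. x \<in> carrier (P i) \<Longrightarrow> r i x \<in> carrier (Q i)" "\<And>i x. x \<in> carrier (Q i) \<Longrightarrow> r i x = x"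
      "\<And>i x. x \<in> carrier (P (Suc i)) \<Longrightarrow> d i (r (Suc i) x) = r i (d i x)"
  shows "projective_resolution R L Q d \<epsilon>"
proof -
  interpret P: projective_resolution S N P d e by fact
  have lift: "x \<in> d i ` carrier (Q (Suc i))" if x: "x \<in> carrier (Q i)" "x \<in> d i ` carrier (P (Suc i))" for i x
  proof -
    obtain z where z: "z \<in> carrier (P (Suc i))" "x = d i z" using x(2) by auto
    then have "x = d i (r (Suc i) z)" using r(2)[OF x(1)] by (simp add: r(3))
    then show ?thesis using r(1)[OF z(1)] by blast
  qed
  show ?thesis
  proof (intro projective_resolution.intro L Q \<epsilon>(1,2))
    show "d 0 ` carrier (Q (Suc 0)) = {x \<in> carrier (Q 0). \<epsilon> x = \<zero>\<^bsub>L\<^esub>}"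
      using lift[of _ 0] mod_homD(1)[OF Q(3)] by (auto simp: \<epsilon>(3) P.augmentation_differential P.exact_0 sub(1))
    show "d (Suc i) ` carrier (Q (Suc (Suc i))) = {x \<in> carrier (Q (Suc i)). d i x = \<zero>\<^bsub>Q i\<^esub>}" for i
      using lift[of _ "Suc i"] mod_homD(1)[OF Q(3)] by (auto simp: sub P.differential_differential P.exact_Suc)
  qed
qed

section \<open>Cochains on a resolution of a triple\<close>

locale triangular_resolution =
  projective_resolution "T2 R" "T2_module X Y \<phi>" P d e
  for R :: "('a, 'r) ring_scheme" and X :: "('a, 'x, 'm) module_scheme" and Y :: "('a, 'y, 'n) module_scheme"
    and \<phi> :: "'y \<Rightarrow> 'x" and P :: "nat \<Rightarrow> ('a \<times> 'a \<times> 'a, 'p, 'l) module_scheme" and d e +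
  assumes X: "left_module R X" and Y: "left_module R Y" and \<phi>: "\<phi> \<in> mod_hom R Y X"
begin

sublocale X: left_module R X by (rule X)
sublocale Y: left_module R Y by (rule Y)

lemma triangular: "triangular_module R (P i)"
  by (intro triangular_module.intro left_modules) (rule X.R.ring_axioms)

lemma regular: "left_module R (regular R)"
  by (rule left_module_regular) (rule X.R.ring_axioms)

abbreviation "upper i \<equiv> top_part R (P i)"
abbreviation "lower i \<equiv> bottom_part R (P i)"
abbreviation "lk i \<equiv> link R (P i)"

lemmas part_modules = triangular_module.left_module_parts[OF triangular]
lemmas part_closed = triangular_module.closed[OF triangular]
lemmas part_id = triangular_module.to_parts[OF triangular]
lemmas part_carrierD = triangular_module.part_carrierD[OF triangular]
lemmas d_parts = triangular_module.hom_parts[OF triangular triangular differential]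
lemmas e_parts = triangular_module.hom_from_T2_module[OF triangular X Y \<phi> augmentation]

lemma lk_hom: "lk i \<in> mod_hom R (lower i) (upper i)"
  by (rule triangular_module.link_hom[OF triangular])

lemma lk_closed: "y \<in> carrier (lower i) \<Longrightarrow> lk i y \<in> carrier (upper i)"
  by (simp add: part_closed part_carrierD)

lemma d_closed: "x \<in> carrier (upper (Suc i)) \<Longrightarrow> d i x \<in> carrier (upper i)"
  "y \<in> carrier (lower (Suc i)) \<Longrightarrow> d i y \<in> carrier (lower i)"
  using mod_homD(1)[OF d_parts(1)] mod_homD(1)[OF d_parts(2)] by auto

lemma d_lk: "y \<in> carrier (lower (Suc i)) \<Longrightarrow> d i (lk (Suc i) y) = lk i (d i y)"
  using d_parts(5) part_carrierD(2) by blast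

lemma e_lk: "y \<in> carrier (lower 0) \<Longrightarrow> fst (e (lk 0 y)) = \<phi> (snd (e y))"
  using e_parts(7) part_carrierD(2) by blast

lemma dd: "x \<in> carrier (upper (Suc (Suc i))) \<Longrightarrow> d i (d (Suc i) x) = \<zero>\<^bsub>upper i\<^esub>"
  "y \<in> carrier (lower (Suc (Suc i))) \<Longrightarrow> d i (d (Suc i) y) = \<zero>\<^bsub>lower i\<^esub>"
  by (simp_all add: differential_differential part_carrierD)

lemma ed: "x \<in> carrier (P (Suc 0)) \<Longrightarrow> fst (e (d 0 x)) = \<zero>\<^bsub>X\<^esub>"
  "y \<in> carrier (P (Suc 0)) \<Longrightarrow> snd (e (d 0 y)) = \<zero>\<^bsub>Y\<^esub>"
  by (simp_all add: augmentation_differential)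

text \<open>Multiplication by the upper idempotent commutes with the differentials and is the
  retraction that cuts the upper part out of \<open>P\<close>.\<close>

lemma top_resolution: "projective_resolution R X upper d (\<lambda>x. fst (e x))"
proof (rule projective_resolution_retract[where r = "\<lambda>i. to_top R (P i)", OF projective_resolution_axioms])
  show "(\<lambda>x. fst (e x)) ` carrier (upper 0) = carrier X"
  proof
    show "(\<lambda>x. fst (e x)) ` carrier (upper 0) \<subseteq> carrier X" using mod_homD(1)[OF e_parts(1)] by auto
    show "carrier X \<subseteq> (\<lambda>x. fst (e x)) ` carrier (upper 0)"
    proof
      fix x assume "x \<in> carrier X"
      then have "(x, \<zero>\<^bsub>Y\<^esub>) \<in> e ` carrier (P 0)" unfolding surj by simp
      then obtain w where w: "w \<in> carrier (P 0)" "e w = (x, \<zero>\<^bsub>Y\<^esub>)" by auto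
      then have "fst (e (to_top R (P 0) w)) = x" by (simp add: e_parts(5))
      then show "x \<in> (\<lambda>x. fst (e x)) ` carrier (upper 0)" using part_closed(1)[OF w(1)] by blast
    qed
  qed
  show "fst (e x) = \<zero>\<^bsub>X\<^esub> \<longleftrightarrow> e x = \<zero>\<^bsub>T2_module X Y \<phi>\<^esub>" if "x \<in> carrier (upper 0)" for x
    using e_parts(3)[OF that] by (simp add: prod_eq_iff)
qed (simp_all add: X part_modules triangular_module.projective_top[OF triangular projective] d_parts e_parts
    part_closed part_id part_carrierD)

lemma bottom_resolution: "projective_resolution R Y lower d (\<lambda>x. snd (e x))"
proof (rule projective_resolution_retract[where r = "\<lambda>i. to_bottom R (P i)", OF projective_resolution_axioms])
  show "(\<lambda>x. snd (e x)) ` carrier (lower 0) = carrier Y"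
  proof
    show "(\<lambda>x. snd (e x)) ` carrier (lower 0) \<subseteq> carrier Y" using mod_homD(1)[OF e_parts(2)] by auto
    show "carrier Y \<subseteq> (\<lambda>x. snd (e x)) ` carrier (lower 0)"
    proof
      fix y assume "y \<in> carrier Y"
      then have "(\<zero>\<^bsub>X\<^esub>, y) \<in> e ` carrier (P 0)" unfolding surj by simp
      then obtain w where w: "w \<in> carrier (P 0)" "e w = (\<zero>\<^bsub>X\<^esub>, y)" by auto
      then have "snd (e (to_bottom R (P 0) w)) = y" by (simp add: e_parts(6))
      then show "y \<in> (\<lambda>x. snd (e x)) ` carrier (lower 0)" using part_closed(2)[OF w(1)] by blast
    qed
  qed
  show "snd (e x) = \<zero>\<^bsub>Y\<^esub> \<longleftrightarrow> e x = \<zero>\<^bsub>T2_module X Y \<phi>\<^esub>" if "x \<in> carrier (lower 0)" for x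
    using e_parts(4)[OF that] by (simp add: prod_eq_iff)
qed (simp_all add: Y part_modules triangular_module.projective_bottom[OF triangular projective] d_parts e_parts
    part_closed part_id part_carrierD)

sublocale T: projective_resolution R X upper d "\<lambda>x. fst (e x)" by (rule top_resolution)
sublocale B: projective_resolution R Y lower d "\<lambda>x. snd (e x)" by (rule bottom_resolution)

lemma extend_along_lk:
  assumes "h \<in> mod_hom R (lower i) (regular R)"
  obtains g where "g \<in> mod_hom R (upper i) (regular R)" "\<And>y. y \<in> carrier (lower i) \<Longrightarrow> g (lk i y) = h y"
  using triangular_module.extend_along_link[OF triangular projective assms] by metis

text \<open>Vanishing of Ext into the summand (A, 0): its cochains are the functionals on the upper
  part that vanish on the image of the link.\<close>

lemma lift_cocycle_zero_on_link:
  assumes DA: "dual_acyclic (T2 R) P d"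
    and c: "c \<in> mod_hom R (upper (Suc i)) (regular R)"
      "\<And>x. x \<in> carrier (upper (Suc (Suc i))) \<Longrightarrow> c (d (Suc i) x) = \<zero>\<^bsub>R\<^esub>"
      "\<And>y. y \<in> carrier (lower (Suc i)) \<Longrightarrow> c (lk (Suc i) y) = \<zero>\<^bsub>R\<^esub>"
  obtains b where "b \<in> mod_hom R (upper i) (regular R)"
    "\<And>x. x \<in> carrier (upper (Suc i)) \<Longrightarrow> c x = b (d i x)"
    "\<And>y. y \<in> carrier (lower i) \<Longrightarrow> b (lk i y) = \<zero>\<^bsub>R\<^esub>"
proof -
  let ?C = "\<lambda>w. (c (to_top R (P (Suc i)) w), \<zero>\<^bsub>regular R\<^esub>, \<zero>\<^bsub>regular R\<^esub>)"
  have C: "?C \<in> mod_hom (T2 R) (P (Suc i)) (regular (T2 R))"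
    by (rule triangular_module.hom_into_regular[OF triangular c(1) mod_hom_const_zero[OF regular]]) (rule c(3))
  have "?C (d (Suc i) x) = \<zero>\<^bsub>T2 R\<^esub>" if "x \<in> carrier (P (Suc (Suc i)))" for x
    using that by (simp add: d_parts(3)[symmetric] c(2) part_closed)
  then obtain b where b: "b \<in> mod_hom (T2 R) (P i) (regular (T2 R))"
      "\<And>x. x \<in> carrier (P (Suc i)) \<Longrightarrow> ?C x = b (d i x)"
    using dual_acyclicE[OF DA C] by metis
  show thesis
  proof (rule that[OF triangular_module.hom_from_regular(1)[OF triangular b(1)]])
    show "c x = fst (b (d i x))" if "x \<in> carrier (upper (Suc i))" for x
      using b(2)[of x] that by (simp add: part_carrierD part_id prod_eq_iff)
    show "fst (b (lk i y)) = \<zero>\<^bsub>R\<^esub>" if "y \<in> carrier (lower i)" for y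
      by (rule triangular_module.hom_from_regular(3)[OF triangular b(1)]) (rule part_carrierD(2)[OF that])
  qed
qed

text \<open>Vanishing of Ext into the summand (A, A), whose cochains are all functionals on the
  upper part.\<close>

lemma dual_acyclic_top:
  assumes DA: "dual_acyclic (T2 R) P d"
  shows "dual_acyclic R upper d"
proof (rule dual_acyclicI)
  fix i c assume c: "c \<in> mod_hom R (upper (Suc i)) (regular R)"
    "\<And>x. x \<in> carrier (upper (Suc (Suc i))) \<Longrightarrow> c (d (Suc i) x) = \<zero>\<^bsub>R\<^esub>"
  let ?C = "\<lambda>w. (\<zero>\<^bsub>regular R\<^esub>, c (to_top R (P (Suc i)) w), c (link R (P (Suc i)) w))"
  have C: "?C \<in> mod_hom (T2 R) (P (Suc i)) (regular (T2 R))"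
    by (rule triangular_module.hom_into_regular[OF triangular mod_hom_const_zero[OF regular] c(1)]) simp
  have "?C (d (Suc i) x) = \<zero>\<^bsub>T2 R\<^esub>" if "x \<in> carrier (P (Suc (Suc i)))" for x
    using that by (simp add: d_parts(3,5)[symmetric] c(2) part_closed)
  then obtain b where b: "b \<in> mod_hom (T2 R) (P i) (regular (T2 R))"
      "\<And>x. x \<in> carrier (P (Suc i)) \<Longrightarrow> ?C x = b (d i x)"
    using dual_acyclicE[OF DA C] by metis
  have "c x = fst (snd (b (d i x)))" if "x \<in> carrier (upper (Suc i))" for x
    using b(2)[of x] that by (simp add: part_carrierD part_id prod_eq_iff)
  then show "\<exists>b \<in> mod_hom R (upper i) (regular R). \<forall>x \<in> carrier (upper (Suc i)). c x = b (d i x)"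
    by (intro bexI[OF _ triangular_module.hom_from_regular(2)[OF triangular b(1)]] ballI)
qed

text \<open>
  A cochain \<open>g\<close> whose coboundary vanishes on the image of the link can be corrected to a cocycle
  without changing it there. This is the connecting homomorphism of
  \<open>0 \<rightarrow> (A, 0) \<rightarrow> (A, A) \<rightarrow> (0, A) \<rightarrow> 0\<close>.
\<close>

lemma correct_to_cocycle:
  assumes DA: "dual_acyclic (T2 R) P d"
    and g: "g \<in> mod_hom R (upper i) (regular R)"
      "\<And>y. y \<in> carrier (lower (Suc i)) \<Longrightarrow> g (lk i (d i y)) = \<zero>\<^bsub>R\<^esub>"
  obtains k where "k \<in> mod_hom R (upper i) (regular R)"
    "\<And>x. x \<in> carrier (upper (Suc i)) \<Longrightarrow> k (d i x) = \<zero>\<^bsub>R\<^esub>"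
    "\<And>y. y \<in> carrier (lower i) \<Longrightarrow> k (lk i y) = g (lk i y)"
proof -
  have gd: "(\<lambda>x. g (d i x)) \<in> mod_hom R (upper (Suc i)) (regular R)" by (rule mod_hom_comp[OF d_parts(1) g(1)])
  have gdd: "g (d i (d (Suc i) x)) = \<zero>\<^bsub>R\<^esub>" if "x \<in> carrier (upper (Suc (Suc i)))" for x
    using mod_hom_zero[OF part_modules(1) regular g(1)] dd(1)[OF that] by simp
  have gdl: "g (d i (lk (Suc i) y)) = \<zero>\<^bsub>R\<^esub>" if "y \<in> carrier (lower (Suc i))" for y
    using that by (simp add: d_lk g(2))
  obtain b where b: "b \<in> mod_hom R (upper i) (regular R)"
      "\<And>x. x \<in> carrier (upper (Suc i)) \<Longrightarrow> g (d i x) = b (d i x)"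
      "\<And>y. y \<in> carrier (lower i) \<Longrightarrow> b (lk i y) = \<zero>\<^bsub>R\<^esub>"
    using lift_cocycle_zero_on_link[OF DA gd gdd gdl] by metis
  note cl = mod_homD(1)[OF g(1), simplified] mod_homD(1)[OF b(1), simplified]
  show thesis
  proof (rule that)
    \<comment> \<open>The coboundary of \<open>g\<close> vanishes on links, so it is also the
      coboundary of some \<open>b\<close> that vanishes on links; subtracting \<open>b\<close>
      changes nothing there.\<close>
    show "(\<lambda>x. g x \<ominus>\<^bsub>R\<^esub> b x) \<in> mod_hom R (upper i) (regular R)"
      using mod_hom_diff[OF regular g(1) b(1)] by simp
    show "g (d i x) \<ominus>\<^bsub>R\<^esub> b (d i x) = \<zero>\<^bsub>R\<^esub>" if "x \<in> carrier (upper (Suc i))" for x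
      using that by (simp add: b(2) cl d_closed)
    show "g (lk i y) \<ominus>\<^bsub>R\<^esub> b (lk i y) = g (lk i y)" if "y \<in> carrier (lower i)" for y
      using that by (simp add: b(3) cl lk_closed X.R.minus_eq)
  qed
qed

text \<open>Extend \<open>h\<close> along the link and correct the extension to a cocycle on the
  upper part. That cocycle is the coboundary of some \<open>l\<close>, and \<open>l\<close> after
  the link is the cochain wanted on the lower part.\<close>

lemma dual_acyclic_bottom:
  assumes DA: "dual_acyclic (T2 R) P d"
  shows "dual_acyclic R lower d"
proof (rule dual_acyclicI)
  fix i h assume h: "h \<in> mod_hom R (lower (Suc i)) (regular R)"
    "\<And>x. x \<in> carrier (lower (Suc (Suc i))) \<Longrightarrow> h (d (Suc i) x) = \<zero>\<^bsub>R\<^esub>"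
  obtain g where g: "g \<in> mod_hom R (upper (Suc i)) (regular R)"
      "\<And>y. y \<in> carrier (lower (Suc i)) \<Longrightarrow> g (lk (Suc i) y) = h y"
    using extend_along_lk[OF h(1)] by metis
  have "g (lk (Suc i) (d (Suc i) y)) = \<zero>\<^bsub>R\<^esub>" if "y \<in> carrier (lower (Suc (Suc i)))" for y
    using that by (simp add: g(2) h(2) d_closed)
  then obtain k where k: "k \<in> mod_hom R (upper (Suc i)) (regular R)"
      "\<And>x. x \<in> carrier (upper (Suc (Suc i))) \<Longrightarrow> k (d (Suc i) x) = \<zero>\<^bsub>R\<^esub>"
      "\<And>y. y \<in> carrier (lower (Suc i)) \<Longrightarrow> k (lk (Suc i) y) = g (lk (Suc i) y)"
    using correct_to_cocycle[OF DA g(1)] by metis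
  obtain l where l: "l \<in> mod_hom R (upper i) (regular R)" "\<And>x. x \<in> carrier (upper (Suc i)) \<Longrightarrow> k x = l (d i x)"
    using dual_acyclicE[OF dual_acyclic_top[OF DA] k(1)] k(2) by metis
  have "h y = l (lk i (d i y))" if "y \<in> carrier (lower (Suc i))" for y
    using that k(3)[OF that] l(2)[OF lk_closed[OF that]] by (simp add: g(2) d_lk)
  then show "\<exists>b \<in> mod_hom R (lower i) (regular R). \<forall>x \<in> carrier (lower (Suc i)). h x = b (d i x)"
    by (intro bexI[OF _ mod_hom_comp[OF lk_hom l(1)]] ballI)
qed

text \<open>The degree 0 case of the same correction: a functional on \<open>Y\<close>, pulled back
  to the lower resolution and extended along the link, becomes a 0-cocycle on the upper resolution,
  that is, a functional on \<open>X\<close>.\<close>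

lemma extend_if_dual_acyclic:
  assumes DA: "dual_acyclic (T2 R) P d" and h: "h \<in> mod_hom R Y (regular R)"
  obtains t where "t \<in> mod_hom R X (regular R)" "\<And>y. y \<in> carrier Y \<Longrightarrow> t (\<phi> y) = h y"
proof -
  obtain g where g: "g \<in> mod_hom R (upper 0) (regular R)"
      "\<And>y. y \<in> carrier (lower 0) \<Longrightarrow> g (lk 0 y) = h (snd (e y))"
    using extend_along_lk[OF mod_hom_comp[OF e_parts(2) h]] by metis
  have "g (lk 0 (d 0 y)) = \<zero>\<^bsub>R\<^esub>" if "y \<in> carrier (lower (Suc 0))" for y
    using that mod_hom_zero[OF Y regular h] by (simp add: g(2) d_closed ed part_carrierD)
  then obtain k where k: "k \<in> mod_hom R (upper 0) (regular R)"
      "\<And>x. x \<in> carrier (upper (Suc 0)) \<Longrightarrow> k (d 0 x) = \<zero>\<^bsub>R\<^esub>"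
      "\<And>y. y \<in> carrier (lower 0) \<Longrightarrow> k (lk 0 y) = g (lk 0 y)"
    using correct_to_cocycle[OF DA g(1)] by metis
  have "k x = \<zero>\<^bsub>regular R\<^esub>" if x: "x \<in> carrier (upper 0)" "fst (e x) = \<zero>\<^bsub>X\<^esub>" for x
  proof -
    have "x \<in> d 0 ` carrier (upper (Suc 0))" using x by (simp add: T.exact_0)
    then show ?thesis using k(2) by auto
  qed
  then obtain t where t: "t \<in> mod_hom R X (regular R)" "\<And>x. x \<in> carrier (upper 0) \<Longrightarrow> t (fst (e x)) = k x"
    using mod_hom_factor_surj[OF part_modules(1) X regular T.augmentation T.surj k(1)] by metis
  have "t (\<phi> y) = h y" if y: "y \<in> carrier Y" for y
  proof -
    have "y \<in> (\<lambda>x. snd (e x)) ` carrier (lower 0)" unfolding B.surj by (rule y)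
    then obtain w where w: "w \<in> carrier (lower 0)" "y = snd (e w)" by auto
    then have "t (\<phi> y) = t (fst (e (lk 0 w)))" by (simp add: e_lk)
    also have "\<dots> = h y" using w by (simp add: t(2) lk_closed k(3) g(2))
    finally show ?thesis .
  qed
  with t(1) show thesis by (rule that)
qed

text \<open>\<open>m\<close> after the link is a cocycle on the lower resolution, and it has to be
  lifted to a cocycle on the upper one. In positive degree it is a coboundary of some cochain, which
  extends along the link; in degree 0 it is a functional on \<open>Y\<close>, which
  \<open>ext\<close> extends to \<open>X\<close>.\<close>

lemma correct_to_zero_on_link:
  assumes DA: "dual_acyclic R lower d"
    and ext: "\<And>h. h \<in> mod_hom R Y (regular R) \<Longrightarrow> \<exists>t \<in> mod_hom R X (regular R). \<forall>y \<in> carrier Y. t (\<phi> y) = h y"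
    and m: "m \<in> mod_hom R (upper i) (regular R)"
      "\<And>y. y \<in> carrier (lower (Suc i)) \<Longrightarrow> m (lk i (d i y)) = \<zero>\<^bsub>R\<^esub>"
  obtains n where "n \<in> mod_hom R (upper i) (regular R)"
    "\<And>x. x \<in> carrier (upper (Suc i)) \<Longrightarrow> n (d i x) = \<zero>\<^bsub>R\<^esub>"
    "\<And>y. y \<in> carrier (lower i) \<Longrightarrow> n (lk i y) = m (lk i y)"
proof (cases i)
  case 0
  have ml: "(\<lambda>y. m (lk 0 y)) \<in> mod_hom R (lower 0) (regular R)"
    using mod_hom_comp[OF lk_hom m(1)] unfolding 0 .
  have "m (lk 0 y) = \<zero>\<^bsub>regular R\<^esub>" if y: "y \<in> carrier (lower 0)" "snd (e y) = \<zero>\<^bsub>Y\<^esub>" for y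
  proof -
    have "y \<in> d 0 ` carrier (lower (Suc 0))" using y by (simp add: B.exact_0)
    then show ?thesis using m(2) unfolding 0 by auto
  qed
  then obtain h where h: "h \<in> mod_hom R Y (regular R)" "\<And>y. y \<in> carrier (lower 0) \<Longrightarrow> h (snd (e y)) = m (lk 0 y)"
    using mod_hom_factor_surj[OF part_modules(2) Y regular B.augmentation B.surj ml] by metis
  obtain t where t: "t \<in> mod_hom R X (regular R)" "\<And>y. y \<in> carrier Y \<Longrightarrow> t (\<phi> y) = h y"
    using ext[OF h(1)] by auto
  show thesis
  proof (rule that; unfold 0)
    show "(\<lambda>x. t (fst (e x))) \<in> mod_hom R (upper 0) (regular R)" by (rule mod_hom_comp[OF e_parts(1) t(1)])
    show "t (fst (e (d 0 x))) = \<zero>\<^bsub>R\<^esub>" if "x \<in> carrier (upper (Suc 0))" for x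
      using that mod_hom_zero[OF X regular t(1)] by (simp add: ed part_carrierD)
    show "t (fst (e (lk 0 y))) = m (lk 0 y)" if "y \<in> carrier (lower 0)" for y
      using that mod_homD(1)[OF e_parts(2) that] by (simp add: e_lk t(2) h(2))
  qed
next
  case (Suc k)
  have "(\<lambda>y. m (lk (Suc k) y)) \<in> mod_hom R (lower (Suc k)) (regular R)"
    using mod_hom_comp[OF lk_hom m(1)] unfolding Suc .
  moreover have "m (lk (Suc k) (d (Suc k) y)) = \<zero>\<^bsub>R\<^esub>" if "y \<in> carrier (lower (Suc (Suc k)))" for y
    using m(2) that unfolding Suc .
  ultimately obtain n where n: "n \<in> mod_hom R (lower k) (regular R)"
      "\<And>y. y \<in> carrier (lower (Suc k)) \<Longrightarrow> m (lk (Suc k) y) = n (d k y)"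
    using dual_acyclicE[OF DA, of "\<lambda>y. m (lk (Suc k) y)" k] by metis
  obtain g where g: "g \<in> mod_hom R (upper k) (regular R)" "\<And>y. y \<in> carrier (lower k) \<Longrightarrow> g (lk k y) = n y"
    using extend_along_lk[OF n(1)] by metis
  show thesis
  proof (rule that; unfold Suc)
    show "(\<lambda>x. g (d k x)) \<in> mod_hom R (upper (Suc k)) (regular R)" by (rule mod_hom_comp[OF d_parts(1) g(1)])
    show "g (d k (d (Suc k) x)) = \<zero>\<^bsub>R\<^esub>" if "x \<in> carrier (upper (Suc (Suc k)))" for x
      using mod_hom_zero[OF part_modules(1) regular g(1)] dd(1)[OF that] by simp
    show "g (d k (lk (Suc k) y)) = m (lk (Suc k) y)" if "y \<in> carrier (lower (Suc k))" for y
      using that by (simp add: d_lk g(2) n(2) d_closed)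
  qed
qed

text \<open>The two summands of the regular module are treated separately. The component in (A, A)
  is a coboundary because the upper resolution is acyclic. For the component in (A, 0) a primitive
  \<open>m\<close> exists for the same reason, but must be made to vanish on links without changing
  its coboundary.\<close>

lemma dual_acyclic_if_parts:
  assumes DAT: "dual_acyclic R upper d" and DAB: "dual_acyclic R lower d"
    and ext: "\<And>h. h \<in> mod_hom R Y (regular R) \<Longrightarrow> \<exists>t \<in> mod_hom R X (regular R). \<forall>y \<in> carrier Y. t (\<phi> y) = h y"
  shows "dual_acyclic (T2 R) P d"
proof (rule dual_acyclicI)
  fix i c assume c: "c \<in> mod_hom (T2 R) (P (Suc i)) (regular (T2 R))"
    and cd: "\<And>x. x \<in> carrier (P (Suc (Suc i))) \<Longrightarrow> c (d (Suc i) x) = \<zero>\<^bsub>T2 R\<^esub>"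
  note cr = triangular_module.hom_from_regular[OF triangular c]
  have cd': "fst (c (d (Suc i) x)) = \<zero>\<^bsub>R\<^esub>" "fst (snd (c (d (Suc i) x))) = \<zero>\<^bsub>R\<^esub>"
    if "x \<in> carrier (upper (Suc (Suc i)))" for x
    using cd[of x] that by (simp_all add: part_carrierD)
  obtain m where m: "m \<in> mod_hom R (upper i) (regular R)"
      "\<And>x. x \<in> carrier (upper (Suc i)) \<Longrightarrow> fst (c x) = m (d i x)"
    using dual_acyclicE[OF DAT cr(1)] cd'(1) by metis
  obtain l where l: "l \<in> mod_hom R (upper i) (regular R)"
      "\<And>x. x \<in> carrier (upper (Suc i)) \<Longrightarrow> fst (snd (c x)) = l (d i x)"
    using dual_acyclicE[OF DAT cr(2)] cd'(2) by metis
  have "m (lk i (d i y)) = \<zero>\<^bsub>R\<^esub>" if "y \<in> carrier (lower (Suc i))" for y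
    using m(2)[OF lk_closed[OF that]] cr(3)[of y] that by (simp add: d_lk part_carrierD)
  then obtain n where n: "n \<in> mod_hom R (upper i) (regular R)"
      "\<And>x. x \<in> carrier (upper (Suc i)) \<Longrightarrow> n (d i x) = \<zero>\<^bsub>R\<^esub>"
      "\<And>y. y \<in> carrier (lower i) \<Longrightarrow> n (lk i y) = m (lk i y)"
    using correct_to_zero_on_link[OF DAB ext m(1)] by metis
  note cl = mod_homD(1)[OF m(1), simplified] mod_homD(1)[OF n(1), simplified]
  \<comment> \<open>\<open>n\<close> has zero coboundary and agrees with \<open>m\<close> on links,
    so \<open>b\<close> is still a primitive and vanishes there.\<close>
  define b where "b x = m x \<ominus>\<^bsub>R\<^esub> n x" for x
  have b: "b \<in> mod_hom R (upper i) (regular R)"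
    using mod_hom_diff[OF regular m(1) n(1)] by (simp add: b_def[abs_def])
  have bl: "b (lk i y) = \<zero>\<^bsub>R\<^esub>" if "y \<in> carrier (lower i)" for y
    using that by (simp add: b_def n(3) cl lk_closed)
  have bd: "b (d i x) = fst (c x)" if "x \<in> carrier (upper (Suc i))" for x
    using that by (simp add: b_def n(2) m(2) cl d_closed X.R.minus_eq)
  let ?C = "\<lambda>w. (b (to_top R (P i) w), l (to_top R (P i) w), l (lk i w))"
  have "c x = ?C (d i x)" if "x \<in> carrier (P (Suc i))" for x
    by (subst cr(4)[OF that])
       (use that in \<open>simp add: d_parts(3,5)[symmetric] bd l(2) part_closed\<close>)
  then show "\<exists>b \<in> mod_hom (T2 R) (P i) (regular (T2 R)). \<forall>x \<in> carrier (P (Suc i)). c x = b (d i x)"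
    by (intro bexI[OF _ triangular_module.hom_into_regular[OF triangular b l(1) bl]] ballI)
qed

end

theorem semi_Gorenstein_projective_T2_module:
  fixes R :: "('a, 'r) ring_scheme" and X :: "('a, 'x, 'm) module_scheme" and Y :: "('a, 'y, 'n) module_scheme"
  assumes X: "left_module R X" and Y: "left_module R Y" and \<phi>: "\<phi> \<in> mod_hom R Y X"
  shows "semi_Gorenstein_projective (T2 R) (T2_module X Y \<phi>) \<longleftrightarrow>
    semi_Gorenstein_projective R X \<and> semi_Gorenstein_projective R Y \<and>
    dual_map Y \<phi> ` carrier (dual R X) = carrier (dual R Y)"
proof -
  obtain B :: "nat \<Rightarrow> (('a \<times> 'a \<times> 'a) + ('x \<times> 'y)) list set" and d e
    where "projective_resolution (T2 R) (T2_module X Y \<phi>) (\<lambda>i. free_module (T2 R) (B i)) d e"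
    by (rule projective_resolution_exists[OF left_module_T2_module[OF X Y \<phi>]])
  then interpret triangular_resolution R X Y \<phi> "\<lambda>i. free_module (T2 R) (B i)" d e
    using X Y \<phi> by (intro triangular_resolution.intro triangular_resolution_axioms.intro)
  note iff = semi_Gorenstein_projective_iff[OF projective_resolution_axioms]
    semi_Gorenstein_projective_iff[OF T.projective_resolution_axioms]
    semi_Gorenstein_projective_iff[OF B.projective_resolution_axioms]
    dual_map_surj_iff[OF Y X \<phi>]
  show ?thesis
    unfolding iff
  proof (intro iffI conjI ballI)
    assume DA: "dual_acyclic (T2 R) (\<lambda>i. free_module (T2 R) (B i)) d"
    show "dual_acyclic R (\<lambda>i. upper i) d" by (rule dual_acyclic_top[OF DA])
    show "dual_acyclic R (\<lambda>i. lower i) d" by (rule dual_acyclic_bottom[OF DA])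
    fix h assume "h \<in> mod_hom R Y (regular R)"
    from extend_if_dual_acyclic[OF DA this] obtain t
      where t: "t \<in> mod_hom R X (regular R)" "\<And>y. y \<in> carrier Y \<Longrightarrow> t (\<phi> y) = h y" by metis
    then show "\<exists>t \<in> mod_hom R X (regular R). \<forall>y \<in> carrier Y. t (\<phi> y) = h y" by (intro bexI[of _ t] ballI)
  qed (elim conjE, rule dual_acyclic_if_parts, simp_all)
qed

section \<open>Change of rings along an isomorphism\<close>

text \<open>The dual of a triple is a module over \<open>opp (T2 R)\<close>, which is isomorphic but
  not equal to \<open>T2 (opp R)\<close>. Carrying the inverse \<open>\<tau>\<close> as a parameter
  makes the situation symmetric, see \<open>flip\<close>.\<close>

locale ring_isomorphism =
  fixes R :: "('a, 'r) ring_scheme" and S :: "('b, 's) ring_scheme" and \<sigma> \<tau>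
  assumes rings: "ring R" "ring S" and hom: "\<sigma> \<in> ring_hom R S" and hom_inv: "\<tau> \<in> ring_hom S R"
    and inverse: "\<And>a. a \<in> carrier R \<Longrightarrow> \<tau> (\<sigma> a) = a" "\<And>b. b \<in> carrier S \<Longrightarrow> \<sigma> (\<tau> b) = b"
begin

sublocale R: ring R by (rule rings)
sublocale S: ring S by (rule rings)

lemma closed: "a \<in> carrier R \<Longrightarrow> \<sigma> a \<in> carrier S" "b \<in> carrier S \<Longrightarrow> \<tau> b \<in> carrier R"
  using hom hom_inv by (auto simp: ring_hom_def)

lemma zero: "\<sigma> \<zero>\<^bsub>R\<^esub> = \<zero>\<^bsub>S\<^esub>" "\<tau> \<zero>\<^bsub>S\<^esub> = \<zero>\<^bsub>R\<^esub>"
  using ring_hom_zero[OF hom rings] ring_hom_zero[OF hom_inv rings(2,1)] by auto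

lemmas hom_simps = ring_hom_mult[OF hom] ring_hom_add[OF hom] ring_hom_one[OF hom]
  ring_hom_mult[OF hom_inv] ring_hom_add[OF hom_inv] ring_hom_one[OF hom_inv]

lemma flip: "ring_isomorphism S R \<tau> \<sigma>"
  by (intro ring_isomorphism.intro rings hom hom_inv inverse)

end

definition restrict_scalars :: "('a \<Rightarrow> 'b) \<Rightarrow> ('b, 'c, 'm) module_scheme \<Rightarrow> ('a, 'c) module"
  where "restrict_scalars \<sigma> M = \<lparr>carrier = carrier M, monoid.mult = undefined, one = undefined,
    zero = \<zero>\<^bsub>M\<^esub>, add = add M, smult = (\<lambda>a. smult M (\<sigma> a))\<rparr>"

lemma restrict_scalars_simps [simp]:
  "carrier (restrict_scalars \<sigma> M) = carrier M" "\<zero>\<^bsub>restrict_scalars \<sigma> M\<^esub> = \<zero>\<^bsub>M\<^esub>"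
  "add (restrict_scalars \<sigma> M) = add M" "a \<odot>\<^bsub>restrict_scalars \<sigma> M\<^esub> x = \<sigma> a \<odot>\<^bsub>M\<^esub> x"
  by (simp_all add: restrict_scalars_def)

text \<open>Linearity along \<sigma> is expressed by restricting scalars in the target, so that the
  lemmas on \<open>mod_hom\<close> apply.\<close>

definition semilinear_iso ::
    "('a, 'r) ring_scheme \<Rightarrow> ('a \<Rightarrow> 'b) \<Rightarrow> ('a, 'c, 'm) module_scheme \<Rightarrow> ('b, 'd, 'n) module_scheme \<Rightarrow> ('c \<Rightarrow> 'd) \<Rightarrow> bool"
  where "semilinear_iso R \<sigma> M N f \<longleftrightarrow> bij_betw f (carrier M) (carrier N) \<and> f \<in> mod_hom R M (restrict_scalars \<sigma> N)"

context ring_isomorphism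
begin

lemma left_module_restrict_scalars:
  assumes "left_module S M"
  shows "left_module R (restrict_scalars \<sigma> M)"
proof -
  interpret M: left_module S M by fact
  show ?thesis
    by (intro left_module.intro left_module_axioms.intro rings abelian_groupI'[OF M.M.abelian_group_axioms])
       (auto simp: closed hom_simps M.smult_l_distr M.smult_r_distr M.smult_assoc1)
qed

lemma mod_hom_restrict_scalars:
  assumes "h \<in> mod_hom S M N"
  shows "h \<in> mod_hom R (restrict_scalars \<sigma> M) (restrict_scalars \<sigma> N)"
  using assms closed by (auto simp: mod_hom_def hom_def)

lemma mod_hom_restrict_scalars_left:
  assumes "h \<in> mod_hom S M (restrict_scalars \<tau> N)"
  shows "h \<in> mod_hom R (restrict_scalars \<sigma> M) N"
  using assms closed inverse by (auto simp: mod_hom_def hom_def)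

lemma hom_regular:
  assumes "c \<in> mod_hom S M (regular S)"
  shows "(\<lambda>x. \<tau> (c x)) \<in> mod_hom R (restrict_scalars \<sigma> M) (regular R)"
  by (rule mod_homI) (simp_all add: mod_homD[OF assms, simplified] closed hom_simps inverse)

lemma hom_regular':
  assumes "c \<in> mod_hom R (restrict_scalars \<sigma> M) (regular R)"
  shows "(\<lambda>x. \<sigma> (c x)) \<in> mod_hom S M (regular S)"
proof (rule mod_homI)
  note c = mod_homD[OF assms, simplified]
  show "\<sigma> (c (b \<odot>\<^bsub>M\<^esub> x)) = b \<odot>\<^bsub>regular S\<^esub> \<sigma> (c x)" if "b \<in> carrier S" "x \<in> carrier M" for b x
    using c(3)[OF that(2), of "\<tau> b"] that c(1) by (simp add: closed inverse hom_simps)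
qed (simp_all add: mod_homD[OF assms, simplified] closed hom_simps)

text \<open>A free cover over \<open>R\<close> becomes a map of \<open>S\<close>-modules after
  restriction along \<tau>; there the identity of \<open>P\<close> lifts, and the lift is read back
  over \<open>R\<close>.\<close>

lemma projective_restrict_scalars:
  fixes P :: "('b, 'p, 'm) module_scheme"
  assumes "left_module S P" "projective S P"
  shows "projective R (restrict_scalars \<sigma> P)"
proof (rule projectiveI[OF left_module_restrict_scalars[OF assms(1)]])
  interpret flip: ring_isomorphism S R \<tau> \<sigma> by (rule flip)
  fix B :: "'p set" and g
  assume g: "g \<in> mod_hom R (free_module R B) (restrict_scalars \<sigma> P)"
    "g ` carrier (free_module R B) = carrier (restrict_scalars \<sigma> P)"
  note F = flip.left_module_restrict_scalars[OF left_module_free_module[OF rings(1), of B]]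
  have "g \<in> mod_hom S (restrict_scalars \<tau> (free_module R B)) P"
    by (rule flip.mod_hom_restrict_scalars_left[OF g(1)])
  then obtain s where s: "s \<in> mod_hom S P (restrict_scalars \<tau> (free_module R B))" "\<And>x. x \<in> carrier P \<Longrightarrow> g (s x) = x"
    using projective_lift[OF F assms(1,1,2) _ mod_hom_id] g(2) by (metis image_ident order_refl restrict_scalars_simps(1))
  show "\<exists>s \<in> mod_hom R (restrict_scalars \<sigma> P) (free_module R B). \<forall>x\<in>carrier (restrict_scalars \<sigma> P). g (s x) = x"
    by (rule bexI[OF _ mod_hom_restrict_scalars_left[OF s(1)]]) (simp add: s(2))
qed

text \<open>Cochains correspond under composition with \<tau> and \<sigma>, while carriers and
  differentials stay the same.\<close>

lemma dual_acyclic_restrict_scalars: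
  "dual_acyclic R (\<lambda>i. restrict_scalars \<sigma> (P i)) d \<longleftrightarrow> dual_acyclic S P d"
proof
  assume DA: "dual_acyclic S P d"
  show "dual_acyclic R (\<lambda>i. restrict_scalars \<sigma> (P i)) d"
  proof (rule dual_acyclicI)
    fix i c
    assume c: "c \<in> mod_hom R (restrict_scalars \<sigma> (P (Suc i))) (regular R)"
      "\<And>x. x \<in> carrier (restrict_scalars \<sigma> (P (Suc (Suc i)))) \<Longrightarrow> c (d (Suc i) x) = \<zero>\<^bsub>R\<^esub>"
    obtain b where b: "b \<in> mod_hom S (P i) (regular S)"
        "\<And>x. x \<in> carrier (P (Suc i)) \<Longrightarrow> \<sigma> (c x) = b (d i x)"
      using dual_acyclicE[OF DA hom_regular'[OF c(1)]] c(2) zero(1) by (metis restrict_scalars_simps(1))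
    have "c x = \<tau> (b (d i x))" if "x \<in> carrier (P (Suc i))" for x
      using b(2)[OF that, symmetric] mod_homD(1)[OF c(1)] that by (simp add: inverse)
    then show "\<exists>b \<in> mod_hom R (restrict_scalars \<sigma> (P i)) (regular R).
        \<forall>x \<in> carrier (restrict_scalars \<sigma> (P (Suc i))). c x = b (d i x)"
      by (intro bexI[OF _ hom_regular[OF b(1)]] ballI) simp
  qed
next
  assume DA: "dual_acyclic R (\<lambda>i. restrict_scalars \<sigma> (P i)) d"
  show "dual_acyclic S P d"
  proof (rule dual_acyclicI)
    fix i c
    assume c: "c \<in> mod_hom S (P (Suc i)) (regular S)"
      "\<And>x. x \<in> carrier (P (Suc (Suc i))) \<Longrightarrow> c (d (Suc i) x) = \<zero>\<^bsub>S\<^esub>"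
    obtain b where b: "b \<in> mod_hom R (restrict_scalars \<sigma> (P i)) (regular R)"
        "\<And>x. x \<in> carrier (P (Suc i)) \<Longrightarrow> \<tau> (c x) = b (d i x)"
      using dual_acyclicE[OF DA hom_regular[OF c(1)]] c(2) zero(2) by (metis restrict_scalars_simps(1))
    have "c x = \<sigma> (b (d i x))" if "x \<in> carrier (P (Suc i))" for x
      using b(2)[OF that, symmetric] mod_homD(1)[OF c(1)] that by (simp add: inverse)
    then show "\<exists>b \<in> mod_hom S (P i) (regular S). \<forall>x \<in> carrier (P (Suc i)). c x = b (d i x)"
      by (intro bexI[OF _ hom_regular'[OF b(1)]] ballI) simp
  qed
qed

text \<open>Restricting scalars in a resolution of \<open>N\<close> and composing its augmentation
  with the inverse of \<open>f\<close> gives a resolution of \<open>M\<close>, on which acyclicity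
  means the same.\<close>

theorem semi_Gorenstein_projective_semilinear_iso:
  fixes M :: "('a, 'c, 'm) module_scheme" and N :: "('b, 'd, 'n) module_scheme"
  assumes M: "left_module R M" and N: "left_module S N" and f: "semilinear_iso R \<sigma> M N f"
  shows "semi_Gorenstein_projective R M \<longleftrightarrow> semi_Gorenstein_projective S N"
proof -
  obtain B :: "nat \<Rightarrow> ('b + 'd) list set" and d e
    where "projective_resolution S N (\<lambda>i. free_module S (B i)) d e"
    by (rule projective_resolution_exists[OF N])
  then interpret P: projective_resolution S N "\<lambda>i. free_module S (B i)" d e .
  let ?P = "\<lambda>i. free_module S (B i)"
  let ?g = "inv_into (carrier M) f"
  have fh: "f \<in> mod_hom R M (restrict_scalars \<sigma> N)" and bij: "bij_betw f (carrier M) (carrier N)"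
    using f by (auto simp: semilinear_iso_def)
  have gf: "?g (f x) = x" if "x \<in> carrier M" for x using that bij by (auto simp: bij_betw_def)
  have fg: "f (?g y) = y" "?g y \<in> carrier M" if "y \<in> carrier N" for y
    using that bij by (auto simp: bij_betw_def intro: f_inv_into_f inv_into_into)
  interpret M: left_module R M by (rule M)
  interpret N: left_module S N by (rule N)
  have g: "?g \<in> mod_hom R (restrict_scalars \<sigma> N) M"
  proof (rule mod_homI)
    fix x y assume xy: "x \<in> carrier (restrict_scalars \<sigma> N)" "y \<in> carrier (restrict_scalars \<sigma> N)"
    have "f (?g x \<oplus>\<^bsub>M\<^esub> ?g y) = x \<oplus>\<^bsub>N\<^esub> y" using xy fg mod_homD(2)[OF fh, of "?g x" "?g y"] by simp
    then show "?g (x \<oplus>\<^bsub>restrict_scalars \<sigma> N\<^esub> y) = ?g x \<oplus>\<^bsub>M\<^esub> ?g y"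
      using gf[of "?g x \<oplus>\<^bsub>M\<^esub> ?g y"] xy fg by simp
  next
    fix a x assume ax: "a \<in> carrier R" "x \<in> carrier (restrict_scalars \<sigma> N)"
    have "f (a \<odot>\<^bsub>M\<^esub> ?g x) = \<sigma> a \<odot>\<^bsub>N\<^esub> x" using ax fg mod_homD(3)[OF fh, of "?g x" a] by simp
    then show "?g (a \<odot>\<^bsub>restrict_scalars \<sigma> N\<^esub> x) = a \<odot>\<^bsub>M\<^esub> ?g x"
      using gf[of "a \<odot>\<^bsub>M\<^esub> ?g x"] ax fg by simp
  qed (simp add: fg)
  have g0: "?g y = \<zero>\<^bsub>M\<^esub> \<longleftrightarrow> y = \<zero>\<^bsub>N\<^esub>" if "y \<in> carrier N" for y
    using mod_hom_zero[OF left_module_restrict_scalars[OF N] M g]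
      mod_hom_zero[OF M left_module_restrict_scalars[OF N] fh] fg(1)[OF that] by auto
  have "projective_resolution R M (\<lambda>i. restrict_scalars \<sigma> (?P i)) d (\<lambda>x. ?g (e x))"
  proof (intro projective_resolution.intro M left_module_restrict_scalars projective_restrict_scalars
      P.left_modules P.projective mod_hom_restrict_scalars P.differential
      mod_hom_comp[OF mod_hom_restrict_scalars[OF P.augmentation] g])
    have "?g ` carrier N = carrier M" using bij_betw_inv_into[OF bij] by (simp add: bij_betw_def)
    then show "(\<lambda>x. ?g (e x)) ` carrier (restrict_scalars \<sigma> (?P 0)) = carrier M"
      by (simp add: P.surj[symmetric] image_image)
    show "d 0 ` carrier (restrict_scalars \<sigma> (?P (Suc 0))) =
        {x \<in> carrier (restrict_scalars \<sigma> (?P 0)). ?g (e x) = \<zero>\<^bsub>M\<^esub>}"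
      using g0 P.closed(1) by (auto simp: P.exact_0)
    show "d (Suc i) ` carrier (restrict_scalars \<sigma> (?P (Suc (Suc i)))) =
        {x \<in> carrier (restrict_scalars \<sigma> (?P (Suc i))). d i x = \<zero>\<^bsub>restrict_scalars \<sigma> (?P i)\<^esub>}" for i
      by (simp add: P.exact_Suc)
  qed
  then show ?thesis
    using semi_Gorenstein_projective_iff[OF P.projective_resolution_axioms]
    by (simp add: semi_Gorenstein_projective_iff dual_acyclic_restrict_scalars)
qed

end

section \<open>Duals of triangular modules\<close>

lemma dual_carrier: "f \<in> carrier (dual R M) \<longleftrightarrow> f \<in> mod_hom R M (regular R) \<and> f \<in> extensional (carrier M)"
  by (simp add: dual_def Hom_group_def)

lemma dual_simps:
  "f \<oplus>\<^bsub>dual R M\<^esub> g = (\<lambda>x\<in>carrier M. f x \<oplus>\<^bsub>R\<^esub> g x)" "a \<odot>\<^bsub>dual R M\<^esub> f = (\<lambda>x\<in>carrier M. f x \<otimes>\<^bsub>R\<^esub> a)"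
  "\<zero>\<^bsub>dual R M\<^esub> = (\<lambda>x\<in>carrier M. \<zero>\<^bsub>R\<^esub>)"
  by (simp_all add: dual_def Hom_group_def)

lemma dual_eqI:
  assumes "f \<in> carrier (dual R M)" "g \<in> carrier (dual R M)" "\<And>x. x \<in> carrier M \<Longrightarrow> f x = g x"
  shows "f = g"
  using assms by (intro extensionalityI[of f "carrier M" g]) (auto simp: dual_carrier)

lemma restrict_dual:
  assumes "left_module R M" "f \<in> mod_hom R M (regular R)"
  shows "restrict f (carrier M) \<in> carrier (dual R M)"
  using restrict_Hom_regular[OF assms] by (simp add: dual_def)

lemma dual_map_apply: "x \<in> carrier M \<Longrightarrow> dual_map M f g x = g (f x)"
  by (simp add: dual_map_def compose_def)

lemma bidual_map_apply: "f \<in> carrier (dual R M) \<Longrightarrow> bidual_map R M x f = f x"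
  by (simp add: bidual_map_def)

lemma bidual_map_mod_hom:
  assumes "left_module R M"
  shows "bidual_map R M \<in> mod_hom R M (dual (opp R) (dual R M))"
proof -
  interpret M: left_module R M by fact
  interpret D: left_module "opp R" "dual R M" by (rule left_module_dual[OF assms])
  have f: "f x \<in> carrier R" "f (x \<oplus>\<^bsub>M\<^esub> y) = f x \<oplus>\<^bsub>R\<^esub> f y" "f (a \<odot>\<^bsub>M\<^esub> x) = a \<otimes>\<^bsub>R\<^esub> f x"
    if "f \<in> carrier (dual R M)" "x \<in> carrier M" "y \<in> carrier M" "a \<in> carrier R" for f x y a
    using that mod_homD[of f R M "regular R"] by (auto simp: dual_carrier)
  have f1: "f x \<in> carrier R" if "f \<in> carrier (dual R M)" "x \<in> carrier M" for f x
    using f(1)[OF that that(2) M.R.zero_closed] .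
  have cl: "bidual_map R M x \<in> carrier (dual (opp R) (dual R M))" if "x \<in> carrier M" for x
    unfolding dual_carrier[of _ "opp R"]
  proof
    show "bidual_map R M x \<in> mod_hom (opp R) (dual R M) (regular (opp R))"
    proof (rule mod_homI)
      fix g h assume "g \<in> carrier (dual R M)" "h \<in> carrier (dual R M)"
      moreover from this have "g \<oplus>\<^bsub>dual R M\<^esub> h \<in> carrier (dual R M)" by simp
      ultimately show "bidual_map R M x (g \<oplus>\<^bsub>dual R M\<^esub> h) =
          bidual_map R M x g \<oplus>\<^bsub>regular (opp R)\<^esub> bidual_map R M x h"
        using that by (simp add: bidual_map_apply dual_simps)
    next
      fix a g assume "a \<in> carrier (opp R)" "g \<in> carrier (dual R M)"
      moreover from this have "a \<odot>\<^bsub>dual R M\<^esub> g \<in> carrier (dual R M)" by (rule D.smult_closed)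
      ultimately show "bidual_map R M x (a \<odot>\<^bsub>dual R M\<^esub> g) = a \<odot>\<^bsub>regular (opp R)\<^esub> bidual_map R M x g"
        using that by (simp add: bidual_map_apply dual_simps)
    qed (use that f1 in \<open>simp add: bidual_map_apply\<close>)
    show "bidual_map R M x \<in> extensional (carrier (dual R M))" by (simp add: bidual_map_def)
  qed
  interpret DD: left_module R "dual (opp R) (dual R M)"
    using left_module_dual[OF left_module_dual[OF assms]] by simp
  show ?thesis
  proof (rule mod_homI)
    fix x y assume xy: "x \<in> carrier M" "y \<in> carrier M"
    then have "bidual_map R M x \<oplus>\<^bsub>dual (opp R) (dual R M)\<^esub> bidual_map R M y \<in> carrier (dual (opp R) (dual R M))"
      by (intro DD.M.a_closed cl)
    with cl[OF M.M.a_closed[OF xy]]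
    show "bidual_map R M (x \<oplus>\<^bsub>M\<^esub> y) = bidual_map R M x \<oplus>\<^bsub>dual (opp R) (dual R M)\<^esub> bidual_map R M y"
      by (rule dual_eqI) (simp add: bidual_map_apply dual_simps(1)[of "opp R" "dual R M"]
          f(2)[OF _ xy M.R.zero_closed])
  next
    fix a x assume ax: "a \<in> carrier R" "x \<in> carrier M"
    then have "a \<odot>\<^bsub>dual (opp R) (dual R M)\<^esub> bidual_map R M x \<in> carrier (dual (opp R) (dual R M))"
      by (intro DD.smult_closed cl)
    with cl[OF M.smult_closed[OF ax]]
    show "bidual_map R M (a \<odot>\<^bsub>M\<^esub> x) = a \<odot>\<^bsub>dual (opp R) (dual R M)\<^esub> bidual_map R M x"
      by (rule dual_eqI) (simp add: bidual_map_apply dual_simps(2)[of "opp R" "dual R M"]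
          f(3)[OF _ ax(2) M.M.zero_closed ax(1)])
  qed (rule cl)
qed

text \<open>Duality reverses the direction, so a map linear along \<sigma> dualises to one linear
  along the inverse \<tau>, now between the opposite rings.\<close>

lemma (in ring_isomorphism) dual_semilinear_iso:
  assumes M: "left_module R M" and N: "left_module S N" and f: "semilinear_iso R \<sigma> M N f"
  shows "semilinear_iso (opp S) \<tau> (dual S N) (dual R M) (\<lambda>G. \<lambda>x\<in>carrier M. \<tau> (G (f x)))"
proof -
  interpret M: left_module R M by (rule M)
  interpret N: left_module S N by (rule N)
  interpret DM: left_module "opp R" "dual R M" by (rule left_module_dual[OF M])
  have fh: "f \<in> mod_hom R M (restrict_scalars \<sigma> N)" and bij: "bij_betw f (carrier M) (carrier N)"
    using f by (auto simp: semilinear_iso_def)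
  note f' = mod_homD[OF fh, simplified]
  let ?D = "\<lambda>G. \<lambda>x\<in>carrier M. \<tau> (G (f x))"
  have G: "G y \<in> carrier S" "z \<in> carrier N \<Longrightarrow> G (y \<oplus>\<^bsub>N\<^esub> z) = G y \<oplus>\<^bsub>S\<^esub> G z"
      "b \<in> carrier S \<Longrightarrow> G (b \<odot>\<^bsub>N\<^esub> y) = b \<otimes>\<^bsub>S\<^esub> G y"
    if "G \<in> carrier (dual S N)" "y \<in> carrier N" for G y z b
    using that mod_homD[of G S N "regular S"] by (auto simp: dual_carrier)
  have cl: "?D G \<in> carrier (dual R M)" if G': "G \<in> carrier (dual S N)" for G
  proof (rule restrict_dual[OF M])
    have "(\<lambda>x. \<tau> (G x)) \<in> mod_hom R (restrict_scalars \<sigma> N) (regular R)"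
      using G' by (intro hom_regular) (simp add: dual_carrier)
    then show "(\<lambda>x. \<tau> (G (f x))) \<in> mod_hom R M (regular R)" by (rule mod_hom_comp[OF fh])
  qed
  have "inj_on ?D (carrier (dual S N))"
  proof (rule inj_onI)
    fix G H assume GH: "G \<in> carrier (dual S N)" "H \<in> carrier (dual S N)" "?D G = ?D H"
    show "G = H"
    proof (rule dual_eqI[OF GH(1,2)])
      fix y assume "y \<in> carrier N"
      then obtain x where x: "x \<in> carrier M" "y = f x" using bij by (auto simp: bij_betw_def)
      have "\<tau> (G (f x)) = \<tau> (H (f x))" using fun_cong[OF GH(3), of x] x by simp
      then have "\<sigma> (\<tau> (G (f x))) = \<sigma> (\<tau> (H (f x)))" by simp
      then show "G y = H y" using GH(1,2) x by (simp add: G f' inverse)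
    qed
  qed
  moreover have "carrier (dual R M) \<subseteq> ?D ` carrier (dual S N)"
  proof
    fix h assume h: "h \<in> carrier (dual R M)"
    then have "h \<in> mod_hom R M (regular R)" by (simp add: dual_carrier)
    \<comment> \<open>The preimage of \<open>h\<close> will be \<sigma> after \<open>h\<close> after
      the inverse of \<open>f\<close>.\<close>
    define g where "g = inv_into (carrier M) f"
    have gf: "g (f x) = x" if "x \<in> carrier M" for x using that bij by (auto simp: g_def bij_betw_def)
    have N': "\<exists>x \<in> carrier M. y = f x" if "y \<in> carrier N" for y using that bij by (auto simp: bij_betw_def)
    have h': "h x \<in> carrier R" "y \<in> carrier M \<Longrightarrow> h (x \<oplus>\<^bsub>M\<^esub> y) = h x \<oplus>\<^bsub>R\<^esub> h y"
        "a \<in> carrier R \<Longrightarrow> h (a \<odot>\<^bsub>M\<^esub> x) = a \<otimes>\<^bsub>R\<^esub> h x"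
      if "x \<in> carrier M" for x y a
      using that h mod_homD[of h R M "regular R"] by (auto simp: dual_carrier)
    have "(\<lambda>y. \<sigma> (h (g y))) \<in> mod_hom S N (regular S)"
    proof (rule mod_homI)
      fix y assume "y \<in> carrier N"
      then obtain x where "x \<in> carrier M" "y = f x" using N' by blast
      then show "\<sigma> (h (g y)) \<in> carrier (regular S)" by (simp add: gf h' closed)
    next
      fix y z assume "y \<in> carrier N" "z \<in> carrier N"
      then obtain x w where "x \<in> carrier M" "y = f x" "w \<in> carrier M" "z = f w" using N' by metis
      then show "\<sigma> (h (g (y \<oplus>\<^bsub>N\<^esub> z))) = \<sigma> (h (g y)) \<oplus>\<^bsub>regular S\<^esub> \<sigma> (h (g z))"
        by (simp add: f'(2)[symmetric] gf h' hom_simps)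
    next
      fix b y assume b: "b \<in> carrier S" and "y \<in> carrier N"
      then obtain x where x: "x \<in> carrier M" "y = f x" using N' by blast
      then have "b \<odot>\<^bsub>N\<^esub> y = f (\<tau> b \<odot>\<^bsub>M\<^esub> x)" using b by (simp add: f'(3) closed inverse)
      then show "\<sigma> (h (g (b \<odot>\<^bsub>N\<^esub> y))) = b \<odot>\<^bsub>regular S\<^esub> \<sigma> (h (g y))"
        using b x by (simp add: gf h' hom_simps closed inverse)
    qed
    then have k: "restrict (\<lambda>y. \<sigma> (h (g y))) (carrier N) \<in> carrier (dual S N)" by (rule restrict_dual[OF N])
    have "h = ?D (restrict (\<lambda>y. \<sigma> (h (g y))) (carrier N))"
      by (rule dual_eqI[OF h cl[OF k]]) (simp add: f' gf inverse h')
    then show "h \<in> ?D ` carrier (dual S N)" using k by blast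
  qed
  ultimately have "bij_betw ?D (carrier (dual S N)) (carrier (dual R M))"
    using cl by (auto simp: bij_betw_def)
  moreover have "?D \<in> mod_hom (opp S) (dual S N) (restrict_scalars \<tau> (dual R M))"
    by (rule mod_homI)
       (use cl in \<open>auto simp: dual_simps f' G hom_simps intro!: restrict_ext\<close>)
  ultimately show ?thesis by (simp add: semilinear_iso_def)
qed

lemma coker_facts:
  assumes "left_module R M" "left_module R N" "f \<in> mod_hom R M N"
  shows "coker_map M N f ` carrier N = carrier (coker M N f)"
    and "x \<in> carrier N \<Longrightarrow> coker_map M N f x = \<zero>\<^bsub>coker M N f\<^esub> \<longleftrightarrow> x \<in> f ` carrier M"
proof -
  interpret N: left_module R N by fact
  interpret H: submodule "f ` carrier M" R N by (rule submodule_image[OF assms])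
  interpret H: abelian_subgroup "f ` carrier M" N
    by (rule abelian_subgroupI3) (auto simp: additive_subgroup_def H.subgroup_axioms N.M.abelian_group_axioms)
  show "coker_map M N f ` carrier N = carrier (coker M N f)"
    by (auto simp: coker_map_def coker_def quot_module_def A_RCOSETS_def')
  show "coker_map M N f x = \<zero>\<^bsub>coker M N f\<^esub> \<longleftrightarrow> x \<in> f ` carrier M" if "x \<in> carrier N"
    using that H.a_rcos_self[of x] H.a_rcos_const[of x]
    by (auto simp: coker_map_def coker_def quot_module_def)
qed

text \<open>Reflection in the antidiagonal is an anti-isomorphism of triangular matrix rings.\<close>

definition swap_corners :: "'a \<times> 'a \<times> 'a \<Rightarrow> 'a \<times> 'a \<times> 'a"
  where "swap_corners = (\<lambda>(a1, a2, a3). (a3, a2, a1))"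

lemma swap_corners_simp [simp]: "swap_corners (a1, a2, a3) = (a3, a2, a1)"
  by (simp add: swap_corners_def)

lemma swap_corners_swap_corners [simp]: "swap_corners (swap_corners a) = a"
  by (simp add: swap_corners_def split: prod.split)

lemma ring_isomorphism_swap_corners:
  assumes "ring R"
  shows "ring_isomorphism (T2 (opp R)) (opp (T2 R)) swap_corners swap_corners"
proof -
  interpret ring R by fact
  show ?thesis
    by (intro ring_isomorphism.intro ring_T2 ring_opp assms ring_hom_memI)
       (auto simp: a_comm)
qed

text \<open>
  A map \<open>(X, Y) \<rightarrow> \<Lambda>\<close> has components in \<open>(A, 0)\<close>, which amounts to \<open>g : Coker \<phi> \<rightarrow> A\<close>, and in
  \<open>(A, A)\<close>, which amounts to \<open>f : X \<rightarrow> A\<close>.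
\<close>

definition dual_triple :: "('a, 'x, 'm) module_scheme \<Rightarrow> ('a, 'y, 'n) module_scheme \<Rightarrow> ('y \<Rightarrow> 'x) \<Rightarrow>
    ('x \<Rightarrow> 'a) \<times> ('x set \<Rightarrow> 'a) \<Rightarrow> 'x \<times> 'y \<Rightarrow> 'a \<times> 'a \<times> 'a"
  where "dual_triple X Y \<phi> = (\<lambda>(f, g). \<lambda>w\<in>carrier X \<times> carrier Y.
    (g (coker_map Y X \<phi> (fst w)), f (fst w), f (\<phi> (snd w))))"

lemma dual_triple_apply:
  "x \<in> carrier X \<Longrightarrow> y \<in> carrier Y \<Longrightarrow> dual_triple X Y \<phi> (f, g) (x, y) = (g (coker_map Y X \<phi> x), f x, f (\<phi> y))"
  by (simp add: dual_triple_def)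

locale triangular_triple =
  fixes R :: "('a, 'r) ring_scheme" and X :: "('a, 'x, 'm) module_scheme" and Y :: "('a, 'y, 'n) module_scheme"
    and \<phi> :: "'y \<Rightarrow> 'x"
  assumes X: "left_module R X" and Y: "left_module R Y" and \<phi>: "\<phi> \<in> mod_hom R Y X"
begin

sublocale X: left_module R X by (rule X)
sublocale Y: left_module R Y by (rule Y)

abbreviation "C \<equiv> coker Y X \<phi>"
abbreviation "\<pi> \<equiv> coker_map Y X \<phi>"

lemmas C = left_module_coker(1)[OF Y X \<phi>]
lemmas \<pi> = left_module_coker(2)[OF Y X \<phi>]
lemmas \<pi>_surj = coker_facts(1)[OF Y X \<phi>]
lemmas \<pi>_zero = coker_facts(2)[OF Y X \<phi>]
lemmas closed = mod_homD(1)[OF \<phi>] mod_homD(1)[OF \<pi>]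

lemma \<pi>_\<phi>: "y \<in> carrier Y \<Longrightarrow> \<pi> (\<phi> y) = \<zero>\<^bsub>C\<^esub>"
  by (simp add: \<pi>_zero closed)

lemma regular: "left_module R (regular R)"
  by (rule left_module_regular) (rule X.R.ring_axioms)

lemma dual_homD:
  assumes "f \<in> carrier (dual R M)" "x \<in> carrier M"
  shows "f x \<in> carrier R" "y \<in> carrier M \<Longrightarrow> f (x \<oplus>\<^bsub>M\<^esub> y) = f x \<oplus>\<^bsub>R\<^esub> f y"
    "a \<in> carrier R \<Longrightarrow> f (a \<odot>\<^bsub>M\<^esub> x) = a \<otimes>\<^bsub>R\<^esub> f x"
  using assms mod_homD[of f R M "regular R"] by (auto simp: dual_carrier)

lemma dual_hom_zero: "left_module R M \<Longrightarrow> f \<in> carrier (dual R M) \<Longrightarrow> f \<zero>\<^bsub>M\<^esub> = \<zero>\<^bsub>R\<^esub>"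
  using mod_hom_zero[OF _ regular, of M f] by (simp add: dual_carrier)

abbreviation "M \<equiv> T2_module X Y \<phi>"

lemma module_M: "left_module (T2 R) M"
  by (rule left_module_T2_module[OF X Y \<phi>])

sublocale M: triangular_module R M
  by (intro triangular_module.intro module_M) (rule X.R.ring_axioms)

lemma M_parts:
  assumes "x \<in> carrier X" "y \<in> carrier Y"
  shows "to_top R M (x, y) = (x, \<zero>\<^bsub>Y\<^esub>)" "to_bottom R M (x, y) = (\<zero>\<^bsub>X\<^esub>, y)" "link R M (x, y) = (\<phi> y, \<zero>\<^bsub>Y\<^esub>)"
  using assms by (simp_all add: M.unfolds closed)

text \<open>Together with \<open>pair_hom\<close> this identifies \<open>X\<close> with the upper
  part of the triple, which consists of the pairs (x, 0).\<close>

lemma fst_hom: "fst \<in> mod_hom R (top_part R M) X"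
proof (rule mod_homI)
  have *: "\<exists>x. w = (x, \<zero>\<^bsub>Y\<^esub>) \<and> x \<in> carrier X" if w: "w \<in> carrier (top_part R M)" for w
  proof -
    obtain x y where "w = (x, y)" "x \<in> carrier X" "y \<in> carrier Y"
      using M.part_carrierD(1)[OF w] by auto
    then show ?thesis using M.to_parts(1)[OF w] by (simp add: M_parts)
  qed
  show "fst w \<in> carrier X" if "w \<in> carrier (top_part R M)" for w
    using *[OF that] by auto
  show "fst (w \<oplus>\<^bsub>top_part R M\<^esub> w') = fst w \<oplus>\<^bsub>X\<^esub> fst w'"
    if "w \<in> carrier (top_part R M)" "w' \<in> carrier (top_part R M)" for w w'
    using *[OF that(1)] *[OF that(2)] by auto
  show "fst (a \<odot>\<^bsub>top_part R M\<^esub> w) = a \<odot>\<^bsub>X\<^esub> fst w" if "a \<in> carrier R" "w \<in> carrier (top_part R M)" for a w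
    using *[OF that(2)] that(1) closed by auto
qed

lemma pair_hom: "(\<lambda>x. (x, \<zero>\<^bsub>Y\<^esub>)) \<in> mod_hom R X (top_part R M)"
proof (rule mod_homI)
  show "(x, \<zero>\<^bsub>Y\<^esub>) \<in> carrier (top_part R M)" if "x \<in> carrier X" for x
    using M.closed(1)[of "(x, \<zero>\<^bsub>Y\<^esub>)"] that by (simp add: M_parts)
qed (simp_all add: closed)

lemma dual_triple_closed:
  assumes f: "f \<in> carrier (dual R X)" and g: "g \<in> carrier (dual R C)"
  shows "dual_triple X Y \<phi> (f, g) \<in> carrier (dual (T2 R) M)"
proof -
  have fg: "f \<in> mod_hom R X (regular R)" "g \<in> mod_hom R C (regular R)"
    using f g by (simp_all add: dual_carrier)
  note f' = mod_hom_comp[OF fst_hom fg(1)] and g' = mod_hom_comp[OF mod_hom_comp[OF fst_hom \<pi>] fg(2)]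
  \<comment> \<open>The component in (A, 0) has to vanish on links; it does because \<pi> kills the
    image of \<phi>.\<close>
  have z: "g (\<pi> (fst (link R M w))) = \<zero>\<^bsub>R\<^esub>" if "w \<in> carrier (bottom_part R M)" for w
    using that M.part_carrierD(2)[OF that] dual_hom_zero[OF C g]
    by (cases w) (auto simp: M_parts \<pi>_\<phi>)
  have "restrict (\<lambda>w. (g (\<pi> (fst (to_top R M w))), f (fst (to_top R M w)), f (fst (link R M w)))) (carrier M)
      \<in> carrier (dual (T2 R) M)"
    by (rule restrict_dual[OF module_M M.hom_into_regular[OF g' f' z]])
  moreover have "restrict (\<lambda>w. (g (\<pi> (fst (to_top R M w))), f (fst (to_top R M w)), f (fst (link R M w)))) (carrier M)
      = dual_triple X Y \<phi> (f, g)"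
    by (auto simp: dual_triple_def M_parts intro!: restrict_ext)
  ultimately show ?thesis by simp
qed

text \<open>Multiply the matrix with entries g (\<pi> x), f x and f (\<phi> y) from the right: the
  lower right idempotent keeps \<open>f\<close>, the upper left one keeps \<open>g\<close>, and the
  corner unit moves the entry of \<open>g\<close> to the place of \<open>f\<close>. After reflection
  in the antidiagonal the dual of \<open>X\<close> is therefore the upper component, with
  \<open>\<pi>\<^sup>*\<close> as the link.\<close>

theorem dual_triple_semilinear_iso:
  "semilinear_iso (T2 (opp R)) swap_corners (T2_module (dual R X) (dual R C) (dual_map X \<pi>)) (dual (T2 R) M)
    (dual_triple X Y \<phi>)"
proof -
  let ?N = "T2_module (dual R X) (dual R C) (dual_map X \<pi>)" and ?\<Psi> = "dual_triple X Y \<phi>"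
  have cl: "?\<Psi> n \<in> carrier (dual (T2 R) M)" if "n \<in> carrier ?N" for n
    using that dual_triple_closed by (cases n) auto
  interpret DX: left_module "opp R" "dual R X" by (rule left_module_dual[OF X])
  interpret DC: left_module "opp R" "dual R C" by (rule left_module_dual[OF C])
  have N: "left_module (T2 (opp R)) ?N"
    by (rule left_module_T2_module[OF DX.left_module_axioms DC.left_module_axioms dual_map_mod_hom[OF X C \<pi>]])
  interpret N: left_module "T2 (opp R)" ?N by (rule N)
  interpret DM: left_module "opp (T2 R)" "dual (T2 R) M" by (rule left_module_dual[OF module_M])
  have inj: "inj_on ?\<Psi> (carrier ?N)"
  proof (rule inj_onI)
    fix n n' assume n: "n \<in> carrier ?N" "n' \<in> carrier ?N" "?\<Psi> n = ?\<Psi> n'"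
    obtain f g f' g' where fg: "n = (f, g)" "n' = (f', g')" by (cases n; cases n')
    have eq: "g (\<pi> x) = g' (\<pi> x) \<and> f x = f' x" if "x \<in> carrier X" for x
      using fun_cong[OF n(3), of "(x, \<zero>\<^bsub>Y\<^esub>)"] that unfolding fg by (simp add: dual_triple_apply)
    have "f = f'" by (rule dual_eqI[of _ R X]) (use n fg eq in auto)
    moreover have "g = g'"
      by (rule dual_eqI[of _ R C]) (use n fg eq in \<open>auto simp: \<pi>_surj[symmetric]\<close>)
    ultimately show "n = n'" using fg by simp
  qed
  have "carrier (dual (T2 R) M) \<subseteq> ?\<Psi> ` carrier ?N"
  proof
    fix F assume F: "F \<in> carrier (dual (T2 R) M)"
    then have "F \<in> mod_hom (T2 R) M (regular (T2 R))" by (simp add: dual_carrier)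
    note F' = M.hom_from_regular[OF this]
    define f where "f = restrict (\<lambda>x. fst (snd (F (x, \<zero>\<^bsub>Y\<^esub>)))) (carrier X)"
    have f: "f \<in> carrier (dual R X)"
      unfolding f_def by (rule restrict_dual[OF X mod_hom_comp[OF pair_hom F'(2)]])
    have k: "(\<lambda>x. fst (F (x, \<zero>\<^bsub>Y\<^esub>))) \<in> mod_hom R X (regular R)" by (rule mod_hom_comp[OF pair_hom F'(1)])
    \<comment> \<open>The component of \<open>F\<close> in (A, 0) kills the image of \<phi>, so it
      descends to the cokernel; this gives the second entry of the preimage.\<close>
    have kz: "fst (F (x, \<zero>\<^bsub>Y\<^esub>)) = \<zero>\<^bsub>regular R\<^esub>" if x: "x \<in> carrier X" "\<pi> x = \<zero>\<^bsub>C\<^esub>" for x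
    proof -
      obtain y where y: "y \<in> carrier Y" "x = \<phi> y" using x by (auto simp: \<pi>_zero)
      then show ?thesis using F'(3)[of "(\<zero>\<^bsub>X\<^esub>, y)"] by (simp add: M_parts)
    qed
    obtain t where t: "t \<in> mod_hom R C (regular R)" "\<And>x. x \<in> carrier X \<Longrightarrow> t (\<pi> x) = fst (F (x, \<zero>\<^bsub>Y\<^esub>))"
      using mod_hom_factor_surj[OF X C regular \<pi> \<pi>_surj k kz] by metis
    let ?g = "restrict t (carrier C)"
    have g: "?g \<in> carrier (dual R C)" by (rule restrict_dual[OF C t(1)])
    have "F = ?\<Psi> (f, ?g)"
    proof (rule dual_eqI[OF F dual_triple_closed[OF f g]])
      fix w assume "w \<in> carrier M"
      then obtain x y where w: "w = (x, y)" "x \<in> carrier X" "y \<in> carrier Y" by auto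
      then show "F w = ?\<Psi> (f, ?g) w"
        using F'(4)[of w] by (simp add: dual_triple_apply closed t(2) f_def M_parts)
    qed
    then show "F \<in> ?\<Psi> ` carrier ?N" using f g by auto
  qed
  then have "bij_betw ?\<Psi> (carrier ?N) (carrier (dual (T2 R) M))"
    using inj cl by (auto simp: bij_betw_def)
  moreover have "?\<Psi> \<in> mod_hom (T2 (opp R)) ?N (restrict_scalars swap_corners (dual (T2 R) M))"
  proof (rule mod_homI)
    fix n n' assume n: "n \<in> carrier ?N" "n' \<in> carrier ?N"
    have "?\<Psi> (n \<oplus>\<^bsub>?N\<^esub> n') = ?\<Psi> n \<oplus>\<^bsub>dual (T2 R) M\<^esub> ?\<Psi> n'"
    proof (rule dual_eqI[OF cl[OF N.M.a_closed[OF n]] DM.M.a_closed[OF cl[OF n(1)] cl[OF n(2)]]])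
      fix w assume "w \<in> carrier M"
      then obtain x y where w: "w = (x, y)" "x \<in> carrier X" "y \<in> carrier Y" by auto
      obtain f g f' g' where fg: "n = (f, g)" "n' = (f', g')" by (cases n; cases n')
      show "?\<Psi> (n \<oplus>\<^bsub>?N\<^esub> n') w = (?\<Psi> n \<oplus>\<^bsub>dual (T2 R) M\<^esub> ?\<Psi> n') w"
        using w by (simp add: fg dual_simps dual_triple_apply closed)
    qed
    then show "?\<Psi> (n \<oplus>\<^bsub>?N\<^esub> n') = ?\<Psi> n \<oplus>\<^bsub>restrict_scalars swap_corners (dual (T2 R) M)\<^esub> ?\<Psi> n'" by simp
  next
    fix a n assume a: "a \<in> carrier (T2 (opp R))" and n: "n \<in> carrier ?N"
    obtain a1 a2 a3 where a': "a = (a1, a2, a3)" "a1 \<in> carrier R" "a2 \<in> carrier R" "a3 \<in> carrier R"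
      using a by (cases a) auto
    then have sa: "swap_corners a \<in> carrier (opp (T2 R))" by simp
    have "?\<Psi> (a \<odot>\<^bsub>?N\<^esub> n) = swap_corners a \<odot>\<^bsub>dual (T2 R) M\<^esub> ?\<Psi> n"
    proof (rule dual_eqI[OF cl[OF N.smult_closed[OF a n]] DM.smult_closed[OF sa cl[OF n]]])
      fix w assume "w \<in> carrier M"
      then obtain x y where w: "w = (x, y)" "x \<in> carrier X" "y \<in> carrier Y" by auto
      obtain f g where fg: "n = (f, g)" "f \<in> carrier (dual R X)" "g \<in> carrier (dual R C)" using n by auto
      show "?\<Psi> (a \<odot>\<^bsub>?N\<^esub> n) w = (swap_corners a \<odot>\<^bsub>dual (T2 R) M\<^esub> ?\<Psi> n) w"
        using w a' fg(2,3)
        by (simp add: fg(1) dual_simps dual_triple_apply closed dual_homD(1) dual_map_apply \<pi>_\<phi>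
            dual_hom_zero[OF C] X.R.a_comm)
    qed
    then show "?\<Psi> (a \<odot>\<^bsub>?N\<^esub> n) = a \<odot>\<^bsub>restrict_scalars swap_corners (dual (T2 R) M)\<^esub> ?\<Psi> n" by simp
  qed (use cl in simp)
  ultimately show ?thesis by (simp add: semilinear_iso_def)
qed

lemma semi_Gorenstein_projective_dual:
  "semi_Gorenstein_projective (opp (T2 R)) (dual (T2 R) M) \<longleftrightarrow>
    semi_Gorenstein_projective (opp R) (dual R X) \<and> semi_Gorenstein_projective (opp R) (dual R C) \<and>
    dual_map (dual R C) (dual_map X \<pi>) ` carrier (dual (opp R) (dual R X)) = carrier (dual (opp R) (dual R C))"
proof -
  have h: "dual_map X \<pi> \<in> mod_hom (opp R) (dual R C) (dual R X)" by (rule dual_map_mod_hom[OF X C \<pi>])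
  note D = left_module_dual[OF X] left_module_dual[OF C]
  note iso = ring_isomorphism.semi_Gorenstein_projective_semilinear_iso[OF
      ring_isomorphism_swap_corners[OF X.R.ring_axioms] left_module_T2_module[OF D h] left_module_dual[OF module_M]
      dual_triple_semilinear_iso]
  show ?thesis
    unfolding iso[symmetric] by (rule semi_Gorenstein_projective_T2_module[OF D h])
qed

end

section \<open>Left exactness of the dual and the bidual of a triple\<close>

locale triangular_triple_with_dual = triangular_triple R X Y \<phi> +
  dual: triangular_triple "opp R" "dual R X" "dual R (coker Y X \<phi>)" "dual_map X (coker_map Y X \<phi>)"
  for R :: "('a, 'r) ring_scheme" and X :: "('a, 'x, 'm) module_scheme" and Y :: "('a, 'y, 'n) module_scheme"
    and \<phi> :: "'y \<Rightarrow> 'x"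
begin

abbreviation "D \<equiv> coker (dual R C) (dual R X) (dual_map X \<pi>)"
abbreviation "p \<equiv> coker_map (dual R C) (dual R X) (dual_map X \<pi>)"

lemma p_dual_hom: "dual_map (dual R X) p \<in> mod_hom R (dual (opp R) D) (dual (opp R) (dual R X))"
  using dual_map_mod_hom[OF dual.X dual.C dual.\<pi>] by simp

lemma p_dual_inj: "inj_on (dual_map (dual R X) p) (carrier (dual (opp R) D))"
proof (rule inj_onI)
  fix u v assume uv: "u \<in> carrier (dual (opp R) D)" "v \<in> carrier (dual (opp R) D)"
    "dual_map (dual R X) p u = dual_map (dual R X) p v"
  show "u = v"
  proof (rule dual_eqI[OF uv(1,2)])
    fix z assume "z \<in> carrier D"
    then obtain f where "f \<in> carrier (dual R X)" "z = p f" by (auto simp: dual.\<pi>_surj[symmetric])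
    then show "u z = v z" using fun_cong[OF uv(3), of f] by (simp add: dual_map_apply)
  qed
qed

text \<open>Left exactness of Hom, for arbitrary \<phi>: surjectivity of
  \<open>\<phi>\<^sup>*\<close> is all that is missing for a short exact sequence of duals.\<close>

lemma dual_left_exact:
  "inj_on (dual_map X \<pi>) (carrier (dual R C))"
  "dual_map X \<pi> ` carrier (dual R C) = {f \<in> carrier (dual R X). dual_map Y \<phi> f = \<zero>\<^bsub>dual R Y\<^esub>}"
proof -
  show "inj_on (dual_map X \<pi>) (carrier (dual R C))"
  proof (rule inj_onI)
    fix u v assume uv: "u \<in> carrier (dual R C)" "v \<in> carrier (dual R C)" "dual_map X \<pi> u = dual_map X \<pi> v"
    show "u = v"
    proof (rule dual_eqI[OF uv(1,2)])
      fix z assume "z \<in> carrier C"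
      then obtain x where "x \<in> carrier X" "z = \<pi> x" by (auto simp: \<pi>_surj[symmetric])
      then show "u z = v z" using fun_cong[OF uv(3), of x] by (simp add: dual_map_apply)
    qed
  qed
  show "dual_map X \<pi> ` carrier (dual R C) = {f \<in> carrier (dual R X). dual_map Y \<phi> f = \<zero>\<^bsub>dual R Y\<^esub>}"
  proof (intro equalityI subsetI)
    fix f assume "f \<in> dual_map X \<pi> ` carrier (dual R C)"
    then obtain g where g: "g \<in> carrier (dual R C)" "f = dual_map X \<pi> g" by auto
    have "dual_map Y \<phi> f = \<zero>\<^bsub>dual R Y\<^esub>"
      using g dual_hom_zero[OF C g(1)]
      by (auto simp: dual_simps dual_map_def compose_def \<pi>_\<phi> closed intro!: restrict_ext)
    then show "f \<in> {f \<in> carrier (dual R X). dual_map Y \<phi> f = \<zero>\<^bsub>dual R Y\<^esub>}"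
      using g mod_homD(1)[OF dual.\<phi>] by simp
  next
    fix f assume "f \<in> {f \<in> carrier (dual R X). dual_map Y \<phi> f = \<zero>\<^bsub>dual R Y\<^esub>}"
    then have f: "f \<in> carrier (dual R X)" "dual_map Y \<phi> f = \<zero>\<^bsub>dual R Y\<^esub>" by auto
    have fz: "f x = \<zero>\<^bsub>regular R\<^esub>" if x: "x \<in> carrier X" "\<pi> x = \<zero>\<^bsub>C\<^esub>" for x
    proof -
      obtain y where "y \<in> carrier Y" "x = \<phi> y" using x by (auto simp: \<pi>_zero)
      then show ?thesis using fun_cong[OF f(2), of y] by (simp add: dual_map_apply dual_simps)
    qed
    have fh: "f \<in> mod_hom R X (regular R)" using f(1) by (simp add: dual_carrier)
    obtain t where t: "t \<in> mod_hom R C (regular R)" "\<And>x. x \<in> carrier X \<Longrightarrow> t (\<pi> x) = f x"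
      using mod_hom_factor_surj[OF X C regular \<pi> \<pi>_surj fh fz] by metis
    have g: "restrict t (carrier C) \<in> carrier (dual R C)" by (rule restrict_dual[OF C t(1)])
    have "f = dual_map X \<pi> (restrict t (carrier C))"
      by (rule dual_eqI[OF f(1) mod_homD(1)[OF dual.\<phi> g]]) (simp add: dual_map_apply closed t(2))
    then show "f \<in> dual_map X \<pi> ` carrier (dual R C)" using g by simp
  qed
qed

lemma short_exact_coker:
  assumes "inj_on \<phi> (carrier Y)"
  shows "short_exact_sequence R Y X C \<phi> \<pi>"
proof (intro short_exact_sequence.intro X Y C \<phi> \<pi> \<pi>_surj assms)
  show "\<phi> ` carrier Y = {x \<in> carrier X. \<pi> x = \<zero>\<^bsub>C\<^esub>}"
  proof (intro equalityI subsetI)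
    fix x assume "x \<in> \<phi> ` carrier Y"
    then show "x \<in> {x \<in> carrier X. \<pi> x = \<zero>\<^bsub>C\<^esub>}" using closed(1) \<pi>_\<phi> by blast
  qed (auto simp: \<pi>_zero)
qed

lemma short_exact_dual:
  assumes "dual_map Y \<phi> ` carrier (dual R X) = carrier (dual R Y)"
  shows "short_exact_sequence (opp R) (dual R C) (dual R X) (dual R Y) (dual_map X \<pi>) (dual_map Y \<phi>)"
  by (intro short_exact_sequence.intro left_module_dual X Y C dual.\<phi> dual_map_mod_hom \<phi> dual_left_exact assms)

text \<open>Two isomorphisms end at the dual \<open>?DN\<close> of the dual triple:
  \<open>\<Theta>\<close>, the dual of \<open>dual_triple\<close>, starts at the bidual, and
  \<open>?\<Psi>'\<close>, which is \<open>dual_triple\<close> over the opposite ring, starts at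
  \<open>?T\<close>. Both are linear along \<open>swap_corners\<close>, so \<open>\<Theta>\<close>
  followed by the inverse of \<open>?\<Psi>'\<close> is linear over \<open>T2 R\<close>
  itself.\<close>

theorem bidual_iso:
  assumes \<beta>: "\<beta> \<in> mod_hom (opp R) D (dual R Y)"
    and fact: "\<And>f. f \<in> carrier (dual R X) \<Longrightarrow> dual_map Y \<phi> f = \<beta> (p f)"
  shows "\<exists>\<Phi> \<in> mod_iso (T2 R) (dual (opp (T2 R)) (dual (T2 R) M))
      (T2_module (dual (opp R) (dual R X)) (dual (opp R) D) (dual_map (dual R X) p)).
    \<forall>x \<in> carrier X. \<forall>y \<in> carrier Y.
      \<Phi> (bidual_map (T2 R) M (x, y)) = (bidual_map R X x, dual_map D \<beta> (bidual_map R Y y))"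
proof -
  let ?N = "T2_module (dual R X) (dual R C) (dual_map X \<pi>)"
  let ?B = "dual (opp (T2 R)) (dual (T2 R) M)" and ?DN = "dual (T2 (opp R)) ?N"
  let ?T = "T2_module (dual (opp R) (dual R X)) (dual (opp R) D) (dual_map (dual R X) p)"
  let ?\<Psi> = "dual_triple X Y \<phi>" and ?\<Psi>' = "dual_triple (dual R X) (dual R C) (dual_map X \<pi>)"
  define \<Theta> :: "(('x \<times> 'y \<Rightarrow> 'a \<times> 'a \<times> 'a) \<Rightarrow> 'a \<times> 'a \<times> 'a) \<Rightarrow> ('x \<Rightarrow> 'a) \<times> ('x set \<Rightarrow> 'a) \<Rightarrow> 'a \<times> 'a \<times> 'a"
    where "\<Theta> G = (\<lambda>n\<in>carrier ?N. swap_corners (G (?\<Psi> n)))" for G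
  have \<Theta>: "semilinear_iso (T2 R) swap_corners ?B ?DN \<Theta>"
    using ring_isomorphism.dual_semilinear_iso[OF ring_isomorphism_swap_corners[OF X.R.ring_axioms] dual.module_M
        left_module_dual[OF module_M] dual_triple_semilinear_iso]
    by (simp add: \<Theta>_def[abs_def])
  have \<Psi>': "semilinear_iso (T2 R) swap_corners ?T ?DN ?\<Psi>'"
    using dual.dual_triple_semilinear_iso by simp
  have \<Theta>h: "\<Theta> \<in> mod_hom (T2 R) ?B (restrict_scalars swap_corners ?DN)" and \<Theta>b: "bij_betw \<Theta> (carrier ?B) (carrier ?DN)"
    using \<Theta> by (simp_all add: semilinear_iso_def)
  have \<Psi>'h: "?\<Psi>' \<in> mod_hom (T2 R) ?T (restrict_scalars swap_corners ?DN)"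
    and \<Psi>'b: "bij_betw ?\<Psi>' (carrier ?T) (carrier ?DN)"
    using \<Psi>' by (simp_all only: semilinear_iso_def)
  have T: "left_module (T2 R) ?T"
    using left_module_dual[OF dual.X] left_module_dual[OF dual.C] p_dual_hom by (intro left_module_T2_module) simp_all
  interpret T: left_module "T2 R" ?T by (rule T)
  define \<Phi> where "\<Phi> G = inv_into (carrier ?T) ?\<Psi>' (\<Theta> G)" for G
  have \<Phi>: "\<Phi> G \<in> carrier ?T" "?\<Psi>' (\<Phi> G) = \<Theta> G" if "G \<in> carrier ?B" for G
  proof -
    have "\<Theta> G \<in> ?\<Psi>' ` carrier ?T" using \<Theta>b \<Psi>'b that unfolding bij_betw_def by blast
    then show "\<Phi> G \<in> carrier ?T" "?\<Psi>' (\<Phi> G) = \<Theta> G"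
      unfolding \<Phi>_def by (rule inv_into_into, rule f_inv_into_f)
  qed
  \<comment> \<open>Injectivity of \<open>?\<Psi>'\<close> reduces an equation for
    \<open>\<Phi>\<close> to one for \<open>\<Theta>\<close>.\<close>
  have \<Phi>_eqI: "\<Phi> G = t" if "t \<in> carrier ?T" "?\<Psi>' t = \<Theta> G" for G t
    unfolding \<Phi>_def that(2)[symmetric]
    using \<Psi>'b that(1) by (intro inv_into_f_f) (simp only: bij_betw_def)
  have "\<Phi> \<in> mod_hom (T2 R) ?B ?T"
  proof (rule mod_homI)
    fix G H assume GH: "G \<in> carrier ?B" "H \<in> carrier ?B"
    show "\<Phi> (G \<oplus>\<^bsub>?B\<^esub> H) = \<Phi> G \<oplus>\<^bsub>?T\<^esub> \<Phi> H"
    proof (rule \<Phi>_eqI)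
      show "\<Phi> G \<oplus>\<^bsub>?T\<^esub> \<Phi> H \<in> carrier ?T" by (rule T.M.a_closed[OF \<Phi>(1)[OF GH(1)] \<Phi>(1)[OF GH(2)]])
      show "?\<Psi>' (\<Phi> G \<oplus>\<^bsub>?T\<^esub> \<Phi> H) = \<Theta> (G \<oplus>\<^bsub>?B\<^esub> H)"
        using mod_homD(2)[OF \<Psi>'h \<Phi>(1)[OF GH(1)] \<Phi>(1)[OF GH(2)]] mod_homD(2)[OF \<Theta>h GH] \<Phi>(2)[OF GH(1)] \<Phi>(2)[OF GH(2)]
        by (simp only: restrict_scalars_simps)
    qed
  next
    fix a G assume a: "a \<in> carrier (T2 R)" and G: "G \<in> carrier ?B"
    show "\<Phi> (a \<odot>\<^bsub>?B\<^esub> G) = a \<odot>\<^bsub>?T\<^esub> \<Phi> G"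
    proof (rule \<Phi>_eqI)
      show "a \<odot>\<^bsub>?T\<^esub> \<Phi> G \<in> carrier ?T" by (rule T.smult_closed[OF a \<Phi>(1)[OF G]])
      show "?\<Psi>' (a \<odot>\<^bsub>?T\<^esub> \<Phi> G) = \<Theta> (a \<odot>\<^bsub>?B\<^esub> G)"
        using mod_homD(3)[OF \<Psi>'h \<Phi>(1)[OF G] a] mod_homD(3)[OF \<Theta>h G a] \<Phi>(2)[OF G]
        by (simp only: restrict_scalars_simps)
    qed
  qed (rule \<Phi>(1))
  moreover have "bij_betw \<Phi> (carrier ?B) (carrier ?T)"
    using bij_betw_trans[OF \<Theta>b bij_betw_inv_into[OF \<Psi>'b]] by (simp only: \<Phi>_def[abs_def] comp_def)
  ultimately have "\<Phi> \<in> mod_iso (T2 R) ?B ?T" unfolding mod_iso_def by simp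
  moreover have "\<Phi> (bidual_map (T2 R) M (x, y)) = (bidual_map R X x, dual_map D \<beta> (bidual_map R Y y))"
    if xy: "x \<in> carrier X" "y \<in> carrier Y" for x y
  proof (rule \<Phi>_eqI)
    let ?t = "(bidual_map R X x, dual_map D \<beta> (bidual_map R Y y))"
    have \<beta>': "dual_map D \<beta> \<in> mod_hom R (dual (opp R) (dual R Y)) (dual (opp R) D)"
      using dual_map_mod_hom[OF dual.C left_module_dual[OF Y] \<beta>] by simp
    note mod_homD(1)[OF bidual_map_mod_hom[OF X] xy(1)] mod_homD(1)[OF bidual_map_mod_hom[OF Y] xy(2)]
    then show t: "?t \<in> carrier ?T" using mod_homD(1)[OF \<beta>'] by simp
    have b: "bidual_map (T2 R) M (x, y) \<in> carrier ?B"
      using mod_homD(1)[OF bidual_map_mod_hom[OF module_M]] xy by simp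
    show "?\<Psi>' ?t = \<Theta> (bidual_map (T2 R) M (x, y))"
    proof (rule dual_eqI)
      show "?\<Psi>' ?t \<in> carrier ?DN" using mod_homD(1)[OF \<Psi>'h t] by (simp only: restrict_scalars_simps)
      show "\<Theta> (bidual_map (T2 R) M (x, y)) \<in> carrier ?DN"
        using mod_homD(1)[OF \<Theta>h b] by (simp only: restrict_scalars_simps)
      fix n assume "n \<in> carrier ?N"
      then obtain f g where n: "n = (f, g)" "f \<in> carrier (dual R X)" "g \<in> carrier (dual R C)" by auto
      have "dual_map X \<pi> g \<in> carrier (dual R X)" using n(3) by (rule mod_homD(1)[OF dual.\<phi>])
      moreover have "p f \<in> carrier D" using n(2) by (rule mod_homD(1)[OF dual.\<pi>])
      moreover have "\<beta> (p f) \<in> carrier (dual R Y)" using \<open>p f \<in> carrier D\<close> by (rule mod_homD(1)[OF \<beta>])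
      moreover have "\<beta> (p f) y = f (\<phi> y)" unfolding fact[OF n(2), symmetric] using xy by (simp add: dual_map_apply)
      \<comment> \<open>The first entry is \<open>\<beta> (p f) y\<close>, which the factorisation
        of \<open>\<phi>\<^sup>*\<close> turns into f (\<phi> y); the other side has the same
        entries because \<open>\<Theta>\<close> swaps the corners.\<close>
      ultimately have "?\<Psi>' ?t n = (f (\<phi> y), f x, g (\<pi> x))"
        using n xy by (simp add: dual_triple_apply bidual_map_apply dual_map_apply)
      moreover have "\<Theta> (bidual_map (T2 R) M (x, y)) n = (f (\<phi> y), f x, g (\<pi> x))"
        using n xy dual_triple_closed[OF n(2,3)] by (simp add: \<Theta>_def bidual_map_apply dual_triple_apply)
      ultimately show "?\<Psi>' ?t n = \<Theta> (bidual_map (T2 R) M (x, y)) n" by simp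
    qed
  qed
  ultimately show ?thesis by (intro bexI[of _ \<Phi>] ballI)
qed

end

lemma inj_on_map_prod_iff:
  assumes "A \<noteq> {}" "B \<noteq> {}"
  shows "inj_on (map_prod f g) (A \<times> B) \<longleftrightarrow> inj_on f A \<and> inj_on g B"
proof
  assume inj: "inj_on (map_prod f g) (A \<times> B)"
  obtain a b where ab: "a \<in> A" "b \<in> B" using assms by auto
  have "x = x'" if "x \<in> A" "x' \<in> A" "f x = f x'" for x x'
    using inj_onD[OF inj, of "(x, b)" "(x', b)"] that ab by simp
  moreover have "y = y'" if "y \<in> B" "y' \<in> B" "g y = g y'" for y y'
    using inj_onD[OF inj, of "(a, y)" "(a, y')"] that ab by simp
  ultimately show "inj_on f A \<and> inj_on g B" by (simp add: inj_on_def)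
qed (simp add: map_prod_inj_on)

locale triangular_triple_with_beta = triangular_triple_with_dual R X Y \<phi>
  for R :: "('a, 'r) ring_scheme" and X :: "('a, 'x, 'm) module_scheme" and Y :: "('a, 'y, 'n) module_scheme"
    and \<phi> :: "'y \<Rightarrow> 'x" +
  fixes \<beta> :: "('x \<Rightarrow> 'a) set \<Rightarrow> 'y \<Rightarrow> 'a"
  assumes \<beta>: "\<beta> \<in> mod_hom (opp R) (coker (dual R (coker Y X \<phi>)) (dual R X) (dual_map X (coker_map Y X \<phi>))) (dual R Y)"
    and factor: "\<And>f. f \<in> carrier (dual R X) \<Longrightarrow>
      dual_map Y \<phi> f = \<beta> (coker_map (dual R (coker Y X \<phi>)) (dual R X) (dual_map X (coker_map Y X \<phi>)) f)"
begin

lemma \<beta>_dual: "dual_map D \<beta> \<in> mod_hom R (dual (opp R) (dual R Y)) (dual (opp R) D)"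
  using dual_map_mod_hom[OF dual.C left_module_dual[OF Y] \<beta>] by simp

lemma \<beta>_apply: "f \<in> carrier (dual R X) \<Longrightarrow> y \<in> carrier Y \<Longrightarrow> \<beta> (p f) y = f (\<phi> y)"
  using factor[of f] by (simp add: dual_map_apply flip: factor)

lemma bidual_closed:
  "x \<in> carrier X \<Longrightarrow> bidual_map R X x \<in> carrier (dual (opp R) (dual R X))"
  "y \<in> carrier Y \<Longrightarrow> bidual_map R Y y \<in> carrier (dual (opp R) (dual R Y))"
  using mod_homD(1)[OF bidual_map_mod_hom[OF X]] mod_homD(1)[OF bidual_map_mod_hom[OF Y]] by auto

text \<open>Under \<open>\<Phi>\<close> the canonical map becomes a product of two maps, and both
  carriers are nonempty.\<close>

lemma torsionless_iff:
  "torsionless (T2 R) M \<longleftrightarrow> torsionless R X \<and> inj_on (\<lambda>y. dual_map D \<beta> (bidual_map R Y y)) (carrier Y)"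
proof -
  obtain \<Phi> where \<Phi>: "\<Phi> \<in> mod_iso (T2 R) (dual (opp (T2 R)) (dual (T2 R) M))
      (T2_module (dual (opp R) (dual R X)) (dual (opp R) D) (dual_map (dual R X) p))"
    "\<And>x y. x \<in> carrier X \<Longrightarrow> y \<in> carrier Y \<Longrightarrow>
      \<Phi> (bidual_map (T2 R) M (x, y)) = (bidual_map R X x, dual_map D \<beta> (bidual_map R Y y))"
    using bidual_iso[OF \<beta> factor] by auto
  have "inj_on \<Phi> (bidual_map (T2 R) M ` carrier M)"
    using \<Phi>(1) mod_homD(1)[OF bidual_map_mod_hom[OF module_M]]
    by (auto simp: mod_iso_def bij_betw_def intro: inj_on_subset)
  then have "torsionless (T2 R) M \<longleftrightarrow> inj_on (\<Phi> \<circ> bidual_map (T2 R) M) (carrier M)"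
    unfolding torsionless_def by (metis comp_inj_on inj_on_imageI2)
  also have "\<dots> \<longleftrightarrow> inj_on (map_prod (bidual_map R X) (\<lambda>y. dual_map D \<beta> (bidual_map R Y y))) (carrier X \<times> carrier Y)"
    unfolding T2_module_simps by (rule inj_on_cong) (auto simp: \<Phi>(2))
  also have "\<dots> \<longleftrightarrow> torsionless R X \<and> inj_on (\<lambda>y. dual_map D \<beta> (bidual_map R Y y)) (carrier Y)"
    unfolding torsionless_def by (rule inj_on_map_prod_iff) (use X.M.zero_closed Y.M.zero_closed in auto)
  finally show ?thesis .
qed

lemma bidual_map_epi_iff:
  "bidual_map_epi (T2 R) M \<longleftrightarrow> bidual_map_epi R X \<and>
    (\<lambda>y. dual_map D \<beta> (bidual_map R Y y)) ` carrier Y = carrier (dual (opp R) D)"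
proof -
  let ?B = "dual (opp (T2 R)) (dual (T2 R) M)"
  let ?T = "T2_module (dual (opp R) (dual R X)) (dual (opp R) D) (dual_map (dual R X) p)"
  obtain \<Phi> where \<Phi>: "\<Phi> \<in> mod_iso (T2 R) ?B ?T"
    "\<And>x y. x \<in> carrier X \<Longrightarrow> y \<in> carrier Y \<Longrightarrow>
      \<Phi> (bidual_map (T2 R) M (x, y)) = (bidual_map R X x, dual_map D \<beta> (bidual_map R Y y))"
    using bidual_iso[OF \<beta> factor] by auto
  have b: "bij_betw \<Phi> (carrier ?B) (carrier ?T)" using \<Phi>(1) by (simp only: mod_iso_def mem_Collect_eq)
  have sub: "bidual_map (T2 R) M ` carrier M \<subseteq> carrier ?B"
    using mod_homD(1)[OF bidual_map_mod_hom[OF module_M]] by blast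
  have "bidual_map_epi (T2 R) M \<longleftrightarrow> \<Phi> ` bidual_map (T2 R) M ` carrier M = \<Phi> ` carrier ?B"
    unfolding bidual_map_epi_def
    using inj_on_image_eq_iff[OF bij_betw_imp_inj_on[OF b] sub subset_refl] by simp
  also have "\<Phi> ` bidual_map (T2 R) M ` carrier M =
      (bidual_map R X ` carrier X) \<times> ((\<lambda>y. dual_map D \<beta> (bidual_map R Y y)) ` carrier Y)"
    by (force simp: \<Phi>(2) image_iff)
  also have "\<Phi> ` carrier ?B = carrier (dual (opp R) (dual R X)) \<times> carrier (dual (opp R) D)"
    using b by (simp add: bij_betw_def)
  also have "(bidual_map R X ` carrier X) \<times> ((\<lambda>y. dual_map D \<beta> (bidual_map R Y y)) ` carrier Y) = \<dots> \<longleftrightarrow>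
      bidual_map_epi R X \<and> (\<lambda>y. dual_map D \<beta> (bidual_map R Y y)) ` carrier Y = carrier (dual (opp R) D)"
    unfolding bidual_map_epi_def using X.M.zero_closed Y.M.zero_closed
    by (subst times_eq_iff) auto
  finally show ?thesis .
qed

text \<open>The sequence of duals is short exact only if \<open>\<phi>\<^sup>*\<close> is onto,
  which forces the case distinction; if it is not onto, both sides fail. In the exact case
  \<open>dual_surj\<close> and \<open>semi_Gorenstein_projective_quotient\<close> trade the second
  surjectivity condition for the one on the dual of \<open>Y\<close>.\<close>

lemma double_iff:
  "double_semi_Gorenstein_projective (T2 R) M \<longleftrightarrow>
    double_semi_Gorenstein_projective R X \<and> double_semi_Gorenstein_projective R Y \<and>
    dual_map Y \<phi> ` carrier (dual R X) = carrier (dual R Y) \<and> semi_Gorenstein_projective (opp R) (dual R C)"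
proof (cases "dual_map Y \<phi> ` carrier (dual R X) = carrier (dual R Y)")
  case True
  then interpret E: short_exact_sequence "opp R" "dual R C" "dual R X" "dual R Y" "dual_map X \<pi>" "dual_map Y \<phi>"
    by (rule short_exact_dual)
  show ?thesis
    unfolding double_semi_Gorenstein_projective_def semi_Gorenstein_projective_dual
      semi_Gorenstein_projective_T2_module[OF X Y \<phi>]
    using True E.dual_surj E.semi_Gorenstein_projective_quotient by auto
next
  case False
  then show ?thesis
    unfolding double_semi_Gorenstein_projective_def semi_Gorenstein_projective_T2_module[OF X Y \<phi>] by auto
qed

section \<open>The case in which the dual of \<phi> is onto\<close>

context
  assumes surj: "dual_map Y \<phi> ` carrier (dual R X) = carrier (dual R Y)"
begin

lemma \<beta>_surj: "\<beta> ` carrier D = carrier (dual R Y)"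
proof -
  have "\<beta> ` carrier D = (\<lambda>f. \<beta> (p f)) ` carrier (dual R X)"
    unfolding dual.\<pi>_surj[symmetric] by (rule image_image)
  also have "\<dots> = dual_map Y \<phi> ` carrier (dual R X)" by (rule image_cong) (simp_all add: factor)
  finally show ?thesis using surj by simp
qed

text \<open>If \<open>\<beta> (p f)\<close> vanishes, then \<open>f\<close> lies in the kernel of
  \<open>\<phi>\<^sup>*\<close>, which is the image of \<open>\<pi>\<^sup>*\<close>, and
  \<open>p\<close> kills that image.\<close>

lemma \<beta>_zero: "z \<in> carrier D \<Longrightarrow> \<beta> z = \<zero>\<^bsub>dual R Y\<^esub> \<Longrightarrow> z = \<zero>\<^bsub>D\<^esub>"
proof -
  assume z: "z \<in> carrier D" "\<beta> z = \<zero>\<^bsub>dual R Y\<^esub>"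
  then obtain f where f: "f \<in> carrier (dual R X)" "z = p f" unfolding dual.\<pi>_surj[symmetric] by auto
  then have "f \<in> dual_map X \<pi> ` carrier (dual R C)"
    using z(2) by (simp add: dual_left_exact(2) factor)
  then show "z = \<zero>\<^bsub>D\<^esub>" using f dual.\<pi>_zero by simp
qed

lemma \<beta>_dual_inj: "inj_on (dual_map D \<beta>) (carrier (dual (opp R) (dual R Y)))"
proof (rule inj_onI)
  fix u v assume uv: "u \<in> carrier (dual (opp R) (dual R Y))" "v \<in> carrier (dual (opp R) (dual R Y))"
    "dual_map D \<beta> u = dual_map D \<beta> v"
  show "u = v"
  proof (rule dual_eqI[OF uv(1,2)])
    fix h assume "h \<in> carrier (dual R Y)"
    then obtain z where "z \<in> carrier D" "h = \<beta> z" unfolding \<beta>_surj[symmetric] by auto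
    then show "u h = v h" using fun_cong[OF uv(3), of z] by (simp add: dual_map_apply)
  qed
qed

text \<open>Since \<beta> is onto with zero kernel, every functional on \<open>D\<close> factors
  through it.\<close>

lemma \<beta>_dual_surj: "dual_map D \<beta> ` carrier (dual (opp R) (dual R Y)) = carrier (dual (opp R) D)"
proof (intro equalityI subsetI)
  fix v assume "v \<in> dual_map D \<beta> ` carrier (dual (opp R) (dual R Y))"
  then show "v \<in> carrier (dual (opp R) D)" using mod_homD(1)[OF \<beta>_dual] by blast
next
  fix v assume v: "v \<in> carrier (dual (opp R) D)"
  then have vh: "v \<in> mod_hom (opp R) D (regular (opp R))" by (simp add: dual_carrier)
  have vz: "v z = \<zero>\<^bsub>regular (opp R)\<^esub>" if "z \<in> carrier D" "\<beta> z = \<zero>\<^bsub>dual R Y\<^esub>" for z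
    using \<beta>_zero[OF that] mod_hom_zero[OF dual.C dual.regular vh] by simp
  obtain t where t: "t \<in> mod_hom (opp R) (dual R Y) (regular (opp R))" "\<And>z. z \<in> carrier D \<Longrightarrow> t (\<beta> z) = v z"
    using mod_hom_factor_surj[OF dual.C left_module_dual[OF Y] dual.regular \<beta> \<beta>_surj vh vz] by metis
  have u: "restrict t (carrier (dual R Y)) \<in> carrier (dual (opp R) (dual R Y))"
    by (rule restrict_dual[OF left_module_dual[OF Y] t(1)])
  have "v = dual_map D \<beta> (restrict t (carrier (dual R Y)))"
    by (rule dual_eqI[OF v mod_homD(1)[OF \<beta>_dual u]]) (simp add: dual_map_apply t(2) mod_homD(1)[OF \<beta>])
  then show "v \<in> dual_map D \<beta> ` carrier (dual (opp R) (dual R Y))" using u by blast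
qed

lemma \<beta>_dual_bidual_inj_iff:
  "inj_on (\<lambda>y. dual_map D \<beta> (bidual_map R Y y)) (carrier Y) \<longleftrightarrow> torsionless R Y"
  unfolding torsionless_def using bidual_closed(2)
  by (auto simp: inj_on_def inj_on_eq_iff[OF \<beta>_dual_inj])

lemma \<beta>_dual_bidual_surj_iff:
  "(\<lambda>y. dual_map D \<beta> (bidual_map R Y y)) ` carrier Y = carrier (dual (opp R) D) \<longleftrightarrow> bidual_map_epi R Y"
proof -
  have "bidual_map R Y ` carrier Y \<subseteq> carrier (dual (opp R) (dual R Y))" using bidual_closed(2) by blast
  from inj_on_image_eq_iff[OF \<beta>_dual_inj this subset_refl] show ?thesis
    unfolding bidual_map_epi_def \<beta>_dual_surj by (simp add: image_image)
qed

end

text \<open>At \<open>p f\<close> the functional attached to \<open>y\<close> takes the value f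
  (\<phi> y), so it depends only on \<phi> y.\<close>

lemma inj_if_torsionless:
  assumes "torsionless (T2 R) M"
  shows "inj_on \<phi> (carrier Y)"
proof (rule inj_onI)
  fix y y' assume y: "y \<in> carrier Y" "y' \<in> carrier Y" "\<phi> y = \<phi> y'"
  have "dual_map D \<beta> (bidual_map R Y y) = dual_map D \<beta> (bidual_map R Y y')"
  proof (rule dual_eqI)
    fix z assume "z \<in> carrier D"
    then obtain f where f: "f \<in> carrier (dual R X)" "z = p f" unfolding dual.\<pi>_surj[symmetric] by auto
    moreover then have "p f \<in> carrier D" "\<beta> (p f) \<in> carrier (dual R Y)"
      using mod_homD(1)[OF \<beta>] mod_homD(1)[OF dual.\<pi>] by auto
    ultimately show "dual_map D \<beta> (bidual_map R Y y) z = dual_map D \<beta> (bidual_map R Y y') z"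
      using y by (simp add: dual_map_apply bidual_map_apply \<beta>_apply)
  qed (use mod_homD(1)[OF \<beta>_dual] bidual_closed(2) y in auto)
  moreover have "inj_on (\<lambda>y. dual_map D \<beta> (bidual_map R Y y)) (carrier Y)"
    using assms torsionless_iff by blast
  ultimately show "y = y'" using y by (auto dest: inj_onD)
qed

theorem torsionless_double_iff:
  "torsionless (T2 R) M \<and> double_semi_Gorenstein_projective (T2 R) M \<longleftrightarrow>
    inj_on \<phi> (carrier Y) \<and> double_semi_Gorenstein_projective R X \<and> double_semi_Gorenstein_projective R Y \<and>
    double_semi_Gorenstein_projective R C \<and> torsionless R X \<and> torsionless R Y" (is "?L \<longleftrightarrow> ?R")
proof
  assume L: ?L
  then have d: "double_semi_Gorenstein_projective R X" "double_semi_Gorenstein_projective R Y"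
      "dual_map Y \<phi> ` carrier (dual R X) = carrier (dual R Y)" "semi_Gorenstein_projective (opp R) (dual R C)"
    and inj: "inj_on \<phi> (carrier Y)"
    using double_iff inj_if_torsionless by auto
  interpret short_exact_sequence R Y X C \<phi> \<pi> by (rule short_exact_coker[OF inj])
  \<comment> \<open>\<open>double_iff\<close> already covers the dual of the cokernel. The cokernel
    itself is the third term of a short exact sequence starting with \<phi>, and surjectivity of
    \<open>\<phi>\<^sup>*\<close> is the extension condition.\<close>
  have "double_semi_Gorenstein_projective R C"
    using d semi_Gorenstein_projective_quotient by (auto simp: double_semi_Gorenstein_projective_def)
  then show ?R using L d inj torsionless_iff \<beta>_dual_bidual_inj_iff[OF d(3)] by auto
next
  assume R: ?R
  then interpret short_exact_sequence R Y X C \<phi> \<pi> by (intro short_exact_coker) simp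
  \<comment> \<open>Conversely, vanishing of Ext^1 for the cokernel makes
    \<open>\<phi>\<^sup>*\<close> onto.\<close>
  have s: "dual_map Y \<phi> ` carrier (dual R X) = carrier (dual R Y)"
    using R by (intro dual_surj) (simp add: double_semi_Gorenstein_projective_def)
  then show ?L
    using R torsionless_iff \<beta>_dual_bidual_inj_iff[OF s] double_iff
    by (simp add: double_semi_Gorenstein_projective_def)
qed

text \<open>Either side makes \<open>\<phi>\<^sup>*\<close> onto, the left one by
  \<open>double_iff\<close>; then \<open>\<beta>\<^sup>*\<close> is bijective and can be
  cancelled.\<close>

theorem double_epi_iff:
  "double_semi_Gorenstein_projective (T2 R) M \<and> bidual_map_epi (T2 R) M \<longleftrightarrow>
    dual_map Y \<phi> ` carrier (dual R X) = carrier (dual R Y) \<and> double_semi_Gorenstein_projective R X \<and>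
    double_semi_Gorenstein_projective R Y \<and> semi_Gorenstein_projective (opp R) (dual R C) \<and>
    bidual_map_epi R X \<and> bidual_map_epi R Y"
  using double_iff bidual_map_epi_iff \<beta>_dual_bidual_surj_iff by auto

end

theorem theorem1p5:
  fixes K :: "('k, 'r) ring_scheme" and A :: "('k, 'a, 's) module_scheme"
    and X :: "('a, 'x, 'm) module_scheme" and Y :: "('a, 'y, 'n) module_scheme"
    and \<phi> :: "'y \<Rightarrow> 'x" and \<beta> :: "('x \<Rightarrow> 'a) set \<Rightarrow> ('y \<Rightarrow> 'a)"
    and \<Lambda> M C \<pi> D p
  defines "\<Lambda> \<equiv> T2 A"
    and "M \<equiv> T2_module X Y \<phi>"
    and "C \<equiv> coker Y X \<phi>"
    and "\<pi> \<equiv> coker_map Y X \<phi>"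
    and "D \<equiv> coker (dual A C) (dual A X) (dual_map X \<pi>)"
    and "p \<equiv> coker_map (dual A C) (dual A X) (dual_map X \<pi>)"
  assumes A: "artin_algebra K A"
    and X: "left_module A X" "finitely_generated A X"
    and Y: "left_module A Y" "finitely_generated A Y"
    and \<phi>: "\<phi> \<in> mod_hom A Y X"
    and \<beta>: "\<beta> \<in> mod_hom (opp A) D (dual A Y)"
      "\<forall>f \<in> carrier (dual A X). dual_map Y \<phi> f = \<beta> (p f)"
  shows "(dual_map (dual A X) p \<in> mod_hom A (dual (opp A) D) (dual (opp A) (dual A X)) \<and>
          inj_on (dual_map (dual A X) p) (carrier (dual (opp A) D)) \<and>
          (\<exists>\<Phi> \<in> mod_iso \<Lambda> (dual (opp \<Lambda>) (dual \<Lambda> M))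
                    (T2_module (dual (opp A) (dual A X)) (dual (opp A) D) (dual_map (dual A X) p)).
            \<forall>x \<in> carrier X. \<forall>y \<in> carrier Y.
              \<Phi> (bidual_map \<Lambda> M (x, y)) = (bidual_map A X x, dual_map D \<beta> (bidual_map A Y y))))
       \<and> (torsionless \<Lambda> M \<and> double_semi_Gorenstein_projective \<Lambda> M \<longleftrightarrow>
            inj_on \<phi> (carrier Y) \<and>
            double_semi_Gorenstein_projective A X \<and>
            double_semi_Gorenstein_projective A Y \<and>
            double_semi_Gorenstein_projective A C \<and>
            torsionless A X \<and> torsionless A Y)
       \<and> (double_semi_Gorenstein_projective \<Lambda> M \<and> bidual_map_epi \<Lambda> M \<longleftrightarrow>
            dual_map Y \<phi> ` carrier (dual A X) = carrier (dual A Y) \<and>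
            double_semi_Gorenstein_projective A X \<and>
            double_semi_Gorenstein_projective A Y \<and>
            semi_Gorenstein_projective (opp A) (dual A C) \<and>
            bidual_map_epi A X \<and> bidual_map_epi A Y)"
proof -
  interpret triangular_triple A X Y \<phi> by (intro triangular_triple.intro X(1) Y(1) \<phi>)
  note \<beta>' = \<beta>(1)[unfolded D_def p_def C_def \<pi>_def]
  have factor': "dual_map Y \<phi> f = \<beta> (coker_map (dual A (coker Y X \<phi>)) (dual A X) (dual_map X (coker_map Y X \<phi>)) f)"
    if "f \<in> carrier (dual A X)" for f
    using \<beta>(2) that by (simp add: p_def C_def \<pi>_def)
  interpret triangular_triple_with_beta A X Y \<phi> \<beta>
  proof (intro triangular_triple_with_beta.intro triangular_triple_with_dual.intro
      triangular_triple_with_beta_axioms.intro triangular_triple_axioms)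
    show "triangular_triple (opp A) (dual A X) (dual A (coker Y X \<phi>)) (dual_map X (coker_map Y X \<phi>))"
      by (intro triangular_triple.intro left_module_dual X(1) C dual_map_mod_hom \<pi>)
  qed (fact \<beta>' factor')+
  show ?thesis
    unfolding \<Lambda>_def M_def D_def p_def C_def \<pi>_def
    by (intro conjI p_dual_hom p_dual_inj bidual_iso torsionless_double_iff double_epi_iff) (fact \<beta>' factor')+
qed

end
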